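(* For each $n\ge 2$ let $K_n$ be the complete graph on $n$ vertices whose edges carry independent costs, each exponentially distributed with mean $1$, and let $C_n$ be the minimum cost of an edge cover of $K_n$. Then $$\lim_{n\to\infty}\mathrm{E}[C_n]=W(1)+\frac{W(1)^2}{2}.$$
   Context: An edge cover of a graph is a subset of the edges such that every vertex is an endpoint of at least one edge of the subset; its cost is the sum of the costs of its edges. $W$ is Lambert's $W$-function on $[0,\infty)$, i.e. the inverse of $f:[0,\infty)\to[0,\infty)$, $f(x)=xe^x$; thus $W(1)e^{W(1)}=1$. *)

theory Defs
  imports "HOL-Probability.Probability" "HOL-Library.Ramsey"
begin

text \<open>A finite simple graph is given by a vertex set and a set of edges, each edge being the
  two-element set of its endpoints.\<close>

definition edge_cover :: "'v set \<Rightarrow> 'v set set \<Rightarrow> 'v set set \<Rightarrow> bool" where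
  "edge_cover V E F \<longleftrightarrow> F \<subseteq> E \<and> (\<forall>v\<in>V. \<exists>e\<in>F. v \<in> e)"

text \<open>The minimum is meaningful when \<open>E\<close> is finite and covers \<open>V\<close>, see
  \<open>finite_edge_covers\<close> and \<open>edge_cover_complete_graph\<close>.\<close>

definition min_edge_cover_cost :: "'v set \<Rightarrow> 'v set set \<Rightarrow> ('v set \<Rightarrow> real) \<Rightarrow> real" where
  "min_edge_cover_cost V E c = Min ((\<lambda>F. \<Sum>e\<in>F. c e) ` {F. edge_cover V E F})"

definition complete_vertices :: "nat \<Rightarrow> nat set" where
  "complete_vertices n = {..<n}"

definition complete_edges :: "nat \<Rightarrow> nat set set" where
  "complete_edges n = nsets (complete_vertices n) 2"

lemma finite_edge_covers: "finite E \<Longrightarrow> finite {F. edge_cover V E F}"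
  by (rule finite_subset[of _ "Pow E"]) (auto simp: edge_cover_def)

lemma finite_complete_edges: "finite (complete_edges n)"
  by (simp add: complete_edges_def complete_vertices_def finite_imp_finite_nsets)

lemma edge_cover_complete_graph:
  assumes "n \<ge> 2"
  shows "edge_cover (complete_vertices n) (complete_edges n) (complete_edges n)"
  unfolding edge_cover_def
proof (intro conjI ballI)
  fix v assume v: "v \<in> complete_vertices n"
  define u where "u = (if v = 0 then 1 else 0 :: nat)"
  have "{u, v} \<in> complete_edges n"
    using v assms by (auto simp: complete_edges_def complete_vertices_def nsets_def u_def)
  then show "\<exists>e\<in>complete_edges n. v \<in> e" by blast
qed simp

definition lambert_W :: "real \<Rightarrow> real" where
  "lambert_W = the_inv_into {0..} (\<lambda>x. x * exp x)"

lemma bij_betw_mult_exp: "bij_betw (\<lambda>x::real. x * exp x) {0..} {0..}"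
  unfolding bij_betw_def
proof
  have "strict_mono_on {0..} (\<lambda>x::real. x * exp x)"
    by (intro strict_mono_onI mult_strict_mono') auto
  then show "inj_on (\<lambda>x::real. x * exp x) {0..}"
    by (rule strict_mono_on_imp_inj_on)
  show "(\<lambda>x::real. x * exp x) ` {0..} = {0..}"
  proof (intro equalityI subsetI)
    fix y :: real assume y: "y \<in> {0..}"
    then have "y \<le> y * exp y" by (simp add: mult_le_cancel_left1)
    then have "\<exists>x\<ge>0. x \<le> y \<and> x * exp x = y"
      using y by (intro IVT') (auto intro!: continuous_intros)
    then show "y \<in> (\<lambda>x. x * exp x) ` {0..}" by force
  qed auto
qed

lemma
  assumes "y \<ge> 0"
  shows lambert_W_nonneg: "lambert_W y \<ge> 0"
    and lambert_W_times_exp: "lambert_W y * exp (lambert_W y) = y"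
  using assms bij_betw_mult_exp
    the_inv_into_into[of "\<lambda>x::real. x * exp x" "{0..}" y "{0..}"]
    f_the_inv_into_f[of "\<lambda>x::real. x * exp x" "{0..}" y]
  by (simp_all add: lambert_W_def bij_betw_def)

end

theory Submission
  imports Defs "HOL-Real_Asymp.Real_Asymp"
begin

text \<open>The edge \<open>e = {u,v}\<close> belongs to a minimum edge cover exactly if its cost is below a threshold
  \<open>D\<^sub>e\<close> that depends on the other costs only, so the mean cost is
  \<open>\<Sum>e. E[1 - (1 + D\<^sub>e) exp (- D\<^sub>e)] \<approx> \<Sum>e. E[D\<^sub>e\<^sup>2] / 2\<close>. The threshold is the sum of the marginal costs of
  having to cover \<open>u\<close> and \<open>v\<close>, and a marginal cost obeys the recursion
  \<open>X\<^sub>v = max 0 (min\<^sub>w (c\<^sub>v\<^sub>w - X\<^sub>w))\<close>. As long as the cheap edges near \<open>e\<close> form no cycle, cutting the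
  recursion at depth \<open>k\<close> gives upper and lower bounds for \<open>D\<^sub>e\<close>, according to the parity of \<open>k\<close>. For
  exponential costs the truncated recursion is explicit: given the messages \<open>X\<^sub>w\<close> from \<open>m\<close> neighbours,
  the \<open>p\<close>-th moment of \<open>X\<^sub>v\<close> is \<open>p! exp (- \<Sum>w. X\<^sub>w) / m\<^sup>p\<close>. The sum of all messages of depth
  \<open>k\<close> concentrates at \<open>\<mu>\<^sub>k\<close>, where \<open>\<mu>\<^sub>0 = 0\<close> and \<open>\<mu>\<^sub>k\<^sub>+\<^sub>1 = exp (- \<mu>\<^sub>k)\<close>, and \<open>\<mu>\<^sub>k\<close> tends to \<open>W(1)\<close>; the
  mean cost is thus squeezed between numbers close to \<open>\<mu>\<^sub>k + \<mu>\<^sub>k\<^sup>2 / 2\<close>.\<close>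

section \<open>Marginal costs\<close>

text \<open>About n^2/2 edges contribute about 1/n^2 each, so the estimate for one edge must be
  exact to o(1/n^2). Atypical cost vectors are harmless although their probability merely tends to
  0: for every cost vector the threshold is at most the sum of two plain minima of about n
  exponential costs, whose fourth moment is O(1/n^4), and Cauchy-Schwarz does the rest. The cutoff
  is \<theta> = ln^2 n / n: large enough for every vertex to have an edge below it, so that edges
  above 2 \<theta> never matter, and small enough that edges below 2 \<theta> rarely close a short
  cycle. The messages are not independent, so concentration is a second-moment induction: removing
  one more vertex changes a message by O(1/n^2) on average, and a message that avoids a vertex is
  independent of its star. Origin of the constant: a threshold is the sum of two nearly uncorrelated
  messages with first moment \<mu>/n and second moment 2 \<mu>/n^2, so its square has mean (4 \<mu>
  + 2 \<mu>^2)/n^2; half of it, summed over n^2/2 edges, is \<mu> + \<mu>^2/2.\<close>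

lemma edge_cover_star: "edge_cover (S - {v}) E F \<Longrightarrow> e \<in> F \<Longrightarrow> v \<in> e \<Longrightarrow> edge_cover S E F"
  unfolding edge_cover_def by blast

lemma min_edge_cover_cost_le:
  assumes "finite E" "edge_cover S E F"
  shows "min_edge_cover_cost S E c \<le> sum c F"
  unfolding min_edge_cover_cost_def using assms
  by (intro Min_le) (auto intro: finite_edge_covers)

lemma min_edge_cover_cost_attained:
  assumes "finite E" "S \<subseteq> \<Union>E"
  obtains F where "edge_cover S E F" "min_edge_cover_cost S E c = sum c F"
proof -
  have "edge_cover S E E" using assms by (auto simp: edge_cover_def)
  then have "min_edge_cover_cost S E c \<in> (\<lambda>F. sum c F) ` {F. edge_cover S E F}"
    unfolding min_edge_cover_cost_def using assms by (intro Min_in) (auto intro: finite_edge_covers)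
  then show ?thesis using that by auto
qed

lemma min_edge_cover_cost_mono:
  assumes "finite E" "S \<subseteq> \<Union>E'" "S' \<subseteq> S" "E' \<subseteq> E"
  shows "min_edge_cover_cost S' E c \<le> min_edge_cover_cost S E' c"
proof -
  have "finite E'" using assms finite_subset by blast
  then obtain F where F: "edge_cover S E' F" "min_edge_cover_cost S E' c = sum c F"
    using min_edge_cover_cost_attained assms by metis
  then have "edge_cover S' E F" using assms by (auto simp: edge_cover_def)
  then show ?thesis using F min_edge_cover_cost_le assms by metis
qed

lemma min_edge_cover_cost_geI:
  assumes "finite E" "S \<subseteq> \<Union>E" "\<And>F. edge_cover S E F \<Longrightarrow> t \<le> sum c F"
  shows "t \<le> min_edge_cover_cost S E c"
  using min_edge_cover_cost_attained[OF assms(1,2), of c] assms(3) by metis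

lemma min_edge_cover_cost_insert_le:
  assumes "finite E" "e \<in> E" "S - e \<subseteq> \<Union>(E - {e})"
  shows "min_edge_cover_cost S E c \<le> c e + min_edge_cover_cost (S - e) (E - {e}) c"
proof -
  obtain F where F: "edge_cover (S - e) (E - {e}) F"
      "min_edge_cover_cost (S - e) (E - {e}) c = sum c F"
    using min_edge_cover_cost_attained assms by (metis finite_Diff)
  have fin: "finite F" "e \<notin> F" using F assms by (auto simp: edge_cover_def intro: finite_subset)
  have "edge_cover S E (insert e F)" using F assms by (auto simp: edge_cover_def)
  then have "min_edge_cover_cost S E c \<le> sum c (insert e F)"
    using min_edge_cover_cost_le assms by metis
  then show ?thesis using F fin by simp
qed

text \<open>Removing \<open>v\<close> from \<open>S\<close> only drops the demand to cover it: edges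
  of \<open>E\<close> at \<open>v\<close> remain usable for other vertices. The edge set and the
  demand set are therefore separate arguments, which the recursion shrinks separately.\<close>

definition need :: "('v set \<Rightarrow> real) \<Rightarrow> 'v set set \<Rightarrow> 'v set \<Rightarrow> 'v \<Rightarrow> real" where
  "need c E S v = min_edge_cover_cost S E c - min_edge_cover_cost (S - {v}) E c"

lemma need_nonneg:
  assumes "finite E" "S \<subseteq> \<Union>E"
  shows "0 \<le> need c E S v"
  using min_edge_cover_cost_mono[of E S E "S - {v}" c] assms by (auto simp: need_def)

lemma need_notin: "v \<notin> S \<Longrightarrow> need c E S v = 0"
  by (simp add: need_def)

text \<open>Take an optimal cover of \<open>S - {v}\<close>. If it contains \<open>{v,w}\<close>, it
  already covers \<open>v\<close> and the marginal cost is at most 0, whence the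
  \<open>max 0\<close>. Otherwise deleting \<open>{v,w}\<close> does not raise the optimal cost for
  \<open>S - {v}\<close>, and buying this edge on top of an optimal cover of
  \<open>S - {v,w}\<close> gives the other bound.\<close>

lemma need_le_edge:
  assumes "finite E" "{v,w} \<in> E" "S - {v} \<subseteq> \<Union>(E - {{v,w}})"
  shows "need c E S v \<le> max 0 (c {v,w} - need c (E - {{v,w}}) (S - {v}) w)"
proof -
  let ?E = "E - {{v,w}}"
  have S: "S - {v,w} = S - {v} - {w}" by auto
  have 1: "min_edge_cover_cost S E c \<le> c {v,w} + min_edge_cover_cost (S - {v} - {w}) ?E c"
    unfolding S[symmetric]
  proof (rule min_edge_cover_cost_insert_le[OF assms(1,2)])
    have "S - {v,w} \<subseteq> S - {v}" by auto
    then show "S - {v,w} \<subseteq> \<Union>(E - {{v,w}})" using assms(3) by (rule subset_trans)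
  qed
  have "S - {v} \<subseteq> \<Union>E" using assms by auto
  then obtain F where F: "edge_cover (S - {v}) E F" "min_edge_cover_cost (S - {v}) E c = sum c F"
    using min_edge_cover_cost_attained[OF assms(1)] by metis
  have finF: "finite F" using F assms by (auto simp: edge_cover_def intro: finite_subset)
  show ?thesis
  proof (cases "{v,w} \<in> F")
    case True
    have "edge_cover S E F" by (rule edge_cover_star[OF F(1) True]) simp
    then have "min_edge_cover_cost S E c \<le> min_edge_cover_cost (S - {v}) E c"
      using F min_edge_cover_cost_le assms(1) by metis
    then show ?thesis by (simp add: need_def)
  next
    case False
    then have "edge_cover (S - {v}) ?E F" using F by (auto simp: edge_cover_def)
    then have "min_edge_cover_cost (S - {v}) ?E c \<le> min_edge_cover_cost (S - {v}) E c"
      using F min_edge_cover_cost_le assms(1) by (metis finite_Diff)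
    then show ?thesis using 1 by (simp add: need_def)
  qed
qed

text \<open>Here a cover that uses edges at \<open>v\<close> is charged to the last of these edges, in an order of
  insertion of the star of \<open>v\<close>.\<close>

lemma need_geI:
  assumes fin: "finite E" and E: "\<And>e. e \<in> E \<Longrightarrow> v \<in> e \<Longrightarrow> \<exists>w. e = {v,w}"
    and cov: "S - {v} \<subseteq> \<Union>{e\<in>E. v \<notin> e}" "S \<subseteq> \<Union>E" and v: "v \<in> S" and t: "0 \<le> t"
    and hyp: "\<And>w E'. {v,w} \<in> E \<Longrightarrow> {e\<in>E. v \<notin> e} \<subseteq> E' \<Longrightarrow> E' \<subseteq> E - {{v,w}} \<Longrightarrow>
                t \<le> c {v,w} - need c E' (S - {v}) w"
  shows "t \<le> need c E S v"
proof -
  define E0 where "E0 = {e\<in>E. v \<notin> e}"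
  define b where "b = min_edge_cover_cost (S - {v}) E0 c"
  have E0: "finite E0" "E0 \<subseteq> E" using fin by (auto simp: E0_def)
  \<comment> \<open>The star of \<open>v\<close> is added edge by edge. Both claims concern covers
    of \<open>S - {v}\<close>; those that use a star edge are covers of \<open>S\<close>. The first
    claim, that star edges never make \<open>S - {v}\<close> cheaper to cover than \<open>b\<close>,
    is carried along because the charge to the newest edge compares with the optimum for the
    preceding edge set \<open>E0 \<union> A\<close>. This is also why \<open>hyp\<close> ranges over
    all \<open>E'\<close>.\<close>
  have main: "A \<subseteq> {e\<in>E. v \<in> e} \<Longrightarrow> b \<le> min_edge_cover_cost (S - {v}) (E0 \<union> A) c \<and>
     (\<forall>F. edge_cover (S - {v}) (E0 \<union> A) F \<and> F \<inter> A \<noteq> {} \<longrightarrow> t + b \<le> sum c F)" if "finite A" for A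
    using that
  proof (induction A rule: finite_induct)
    case empty
    show ?case by (simp add: b_def)
  next
    case (insert e A)
    have IH: "b \<le> min_edge_cover_cost (S - {v}) (E0 \<union> A) c"
      "\<And>F. edge_cover (S - {v}) (E0 \<union> A) F \<Longrightarrow> F \<inter> A \<noteq> {} \<Longrightarrow> t + b \<le> sum c F"
      using insert by auto
    have finA: "finite (E0 \<union> A)" "finite (E0 \<union> insert e A)" using E0 insert by auto
    have e: "e \<in> E" "v \<in> e" using insert.prems by auto
    then obtain w where w: "e = {v,w}" using E by blast
    have new: "t + b \<le> sum c F"
      if F: "edge_cover (S - {v}) (E0 \<union> insert e A) F" "F \<inter> insert e A \<noteq> {}" for F
    proof (cases "e \<in> F")
      case False
      then have "edge_cover (S - {v}) (E0 \<union> A) F" "F \<inter> A \<noteq> {}"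
        using F by (auto simp: edge_cover_def)
      then show ?thesis using IH by blast
    next
      case True
      have finF: "finite F" using F finA by (auto simp: edge_cover_def intro: finite_subset)
      have "edge_cover (S - {v} - {w}) (E0 \<union> A) (F - {e})"
        unfolding edge_cover_def
      proof (intro conjI ballI)
        show "F - {e} \<subseteq> E0 \<union> A" using F by (auto simp: edge_cover_def)
        fix x assume x: "x \<in> S - {v} - {w}"
        then obtain f where "f \<in> F" "x \<in> f" using F by (auto simp: edge_cover_def)
        then show "\<exists>f\<in>F - {e}. x \<in> f" using x w by blast
      qed
      then have 1: "min_edge_cover_cost (S - {v} - {w}) (E0 \<union> A) c \<le> sum c (F - {e})"
        using min_edge_cover_cost_le finA by metis
      have "t \<le> c e - need c (E0 \<union> A) (S - {v}) w"
        unfolding w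
      proof (rule hyp)
        show "{v,w} \<in> E" using e w by simp
        show "{e\<in>E. v \<notin> e} \<subseteq> E0 \<union> A" by (auto simp: E0_def)
        show "E0 \<union> A \<subseteq> E - {{v,w}}" using insert w by (auto simp: E0_def)
      qed
      moreover have "sum c F = c e + sum c (F - {e})"
        using finF True by (simp add: sum.remove)
      ultimately show ?thesis using 1 IH(1) by (simp add: need_def)
    qed
    have "b \<le> min_edge_cover_cost (S - {v}) (E0 \<union> insert e A) c"
    proof (rule min_edge_cover_cost_geI[OF finA(2)])
      show "S - {v} \<subseteq> \<Union>(E0 \<union> insert e A)" using cov by (auto simp: E0_def)
      fix F assume F: "edge_cover (S - {v}) (E0 \<union> insert e A) F"
      show "b \<le> sum c F"
      proof (cases "F \<inter> insert e A = {}")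
        case True
        then have "edge_cover (S - {v}) E0 F" using F by (auto simp: edge_cover_def)
        then show ?thesis using min_edge_cover_cost_le E0 unfolding b_def by metis
      next
        case False
        then show ?thesis using new[OF F] t by simp
      qed
    qed
    then show ?case using new by blast
  qed
  have EE: "E0 \<union> {e\<in>E. v \<in> e} = E" by (auto simp: E0_def)
  have "t + b \<le> min_edge_cover_cost S E c"
  proof (rule min_edge_cover_cost_geI[OF fin cov(2)])
    fix F assume F: "edge_cover S E F"
    then have "edge_cover (S - {v}) E F" "F \<inter> {e\<in>E. v \<in> e} \<noteq> {}"
      using v unfolding edge_cover_def by blast+
    then show "t + b \<le> sum c F" using main[of "{e\<in>E. v \<in> e}"] fin EE by auto
  qed
  moreover have "min_edge_cover_cost (S - {v}) E c \<le> b"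
    unfolding b_def using fin cov E0 by (intro min_edge_cover_cost_mono) (auto simp: E0_def)
  ultimately show ?thesis by (simp add: need_def)
qed

text \<open>An edge belongs to an optimal cover exactly if it costs less than what the remaining edges
  charge for covering its endpoints; this turns the cost into a sum over edges.\<close>

definition edge_threshold :: "('v set \<Rightarrow> real) \<Rightarrow> 'v set \<Rightarrow> 'v set set \<Rightarrow> 'v set \<Rightarrow> real" where
  "edge_threshold c V E e =
     min_edge_cover_cost V (E - {e}) c - min_edge_cover_cost (V - e) (E - {e}) c"

text \<open>Comparing an optimal cover with the best covers that avoid or contain a given edge shows
  that it contains every edge strictly below its threshold and none strictly above. Ties stay
  undecided, so there are two sums; for exponential costs they have the same mean.\<close>

lemma min_edge_cover_cost_between:
  assumes fin: "finite E" and cov: "\<And>e. e \<in> E \<Longrightarrow> V \<subseteq> \<Union>(E - {e})" and "E \<noteq> {}"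
    and c: "\<And>e. e \<in> E \<Longrightarrow> 0 \<le> c e"
  shows "(\<Sum>e\<in>E. if c e < edge_threshold c V E e then c e else 0) \<le> min_edge_cover_cost V E c"
    and "min_edge_cover_cost V E c \<le> (\<Sum>e\<in>E. if c e \<le> edge_threshold c V E e then c e else 0)"
proof -
  have V: "V \<subseteq> \<Union>E" using cov \<open>E \<noteq> {}\<close> by blast
  obtain F where F: "edge_cover V E F" "min_edge_cover_cost V E c = sum c F"
    using min_edge_cover_cost_attained[OF fin V] by metis
  have FE: "F \<subseteq> E" "finite F" using F fin by (auto simp: edge_cover_def intro: finite_subset)
  have 1: "c e \<le> edge_threshold c V E e" if "e \<in> F" for e
  proof -
    have "edge_cover (V - e) (E - {e}) (F - {e})"
      unfolding edge_cover_def
    proof (intro conjI ballI)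
      show "F - {e} \<subseteq> E - {e}" using FE by auto
      fix x assume x: "x \<in> V - e"
      then obtain f where "f \<in> F" "x \<in> f" using F by (auto simp: edge_cover_def)
      then show "\<exists>f\<in>F - {e}. x \<in> f" using x by blast
    qed
    then have "min_edge_cover_cost (V - e) (E - {e}) c \<le> sum c (F - {e})"
      using min_edge_cover_cost_le fin by (metis finite_Diff)
    moreover have "sum c F = c e + sum c (F - {e})" using that FE by (simp add: sum.remove)
    moreover have "min_edge_cover_cost V E c \<le> min_edge_cover_cost V (E - {e}) c"
      using fin cov[of e] that FE by (intro min_edge_cover_cost_mono) blast+
    ultimately show ?thesis using F(2) by (simp add: edge_threshold_def)
  qed
  have 2: "edge_threshold c V E e \<le> c e" if "e \<in> E - F" for e
  proof -
    have "edge_cover V (E - {e}) F" using F that by (auto simp: edge_cover_def)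
    then have "min_edge_cover_cost V (E - {e}) c \<le> min_edge_cover_cost V E c"
      using F(2) min_edge_cover_cost_le fin by (metis finite_Diff)
    moreover have "min_edge_cover_cost V E c \<le> c e + min_edge_cover_cost (V - e) (E - {e}) c"
      using that fin cov[of e] by (intro min_edge_cover_cost_insert_le) auto
    ultimately show ?thesis by (simp add: edge_threshold_def)
  qed
  have S: "sum c F = (\<Sum>e\<in>E. if e \<in> F then c e else 0)"
    using FE fin by (simp add: sum.If_cases Int_absorb1)
  show "(\<Sum>e\<in>E. if c e < edge_threshold c V E e then c e else 0) \<le> min_edge_cover_cost V E c"
    unfolding F(2) S using 2 c by (intro sum_mono) (auto, force)
  show "min_edge_cover_cost V E c \<le> (\<Sum>e\<in>E. if c e \<le> edge_threshold c V E e then c e else 0)"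
    unfolding F(2) S using 1 c by (intro sum_mono) auto
qed

text \<open>The endpoints are released one after the other, hence the asymmetry: the marginal cost
  of \<open>v\<close> is taken after \<open>u\<close> has been released.
  \<open>local_threshold\<close> repeats this pattern.\<close>

lemma edge_threshold_eq_need:
  assumes "u \<noteq> v"
  shows "edge_threshold c V E {u,v} = need c (E - {{u,v}}) V u + need c (E - {{u,v}}) (V - {u}) v"
proof -
  have "V - {u,v} = V - {u} - {v}" by auto
  then show ?thesis by (simp add: edge_threshold_def need_def)
qed

section \<open>Message passing\<close>

definition clip_min :: "(nat set \<Rightarrow> real) \<Rightarrow> nat \<Rightarrow> nat set \<Rightarrow> (nat \<Rightarrow> real) \<Rightarrow> real" where
  "clip_min c v N x = max 0 (MIN w\<in>N. c {v,w} - x w)"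

text \<open>Non-backtracking messages: \<open>P\<close> collects the vertices already visited, and \<open>msg n c k P v\<close>
  is the depth \<open>k\<close> truncation of the marginal cost of covering \<open>v\<close> once \<open>P\<close> is removed.\<close>

fun msg :: "nat \<Rightarrow> (nat set \<Rightarrow> real) \<Rightarrow> nat \<Rightarrow> nat set \<Rightarrow> nat \<Rightarrow> real" where
  "msg n c 0 P v = 0"
| "msg n c (Suc k) P v = clip_min c v ({..<n} - insert v P) (msg n c k (insert v P))"

lemma msg_0: "msg n c 0 P = (\<lambda>_. 0)"
  by (simp add: fun_eq_iff)

lemma clip_min_nonneg: "0 \<le> clip_min c v N x"
  by (simp add: clip_min_def)

lemma msg_nonneg: "0 \<le> msg n c k P v"
  by (cases k) (simp_all add: clip_min_nonneg)

lemma clip_min_le: "finite N \<Longrightarrow> w \<in> N \<Longrightarrow> clip_min c v N x \<le> max 0 (c {v,w} - x w)"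
  unfolding clip_min_def by (intro max.mono order.refl Min_le) auto

lemma clip_min_geI:
  assumes "finite N" "N \<noteq> {}" "\<And>w. w \<in> N \<Longrightarrow> t \<le> max 0 (c {v,w} - x w)"
  shows "t \<le> clip_min c v N x"
proof -
  have "(MIN w\<in>N. c {v,w} - x w) \<in> (\<lambda>w. c {v,w} - x w) ` N"
    using assms by (intro Min_in) auto
  then obtain w where "w \<in> N" "(MIN w\<in>N. c {v,w} - x w) = c {v,w} - x w" by auto
  then show ?thesis using assms(3)[of w] by (simp add: clip_min_def)
qed

lemma clip_min_antimono:
  assumes "finite N" "N \<noteq> {}" "\<And>w. w \<in> N \<Longrightarrow> x w \<le> y w"
  shows "clip_min c v N y \<le> clip_min c v N x"
proof (rule clip_min_geI[OF assms(1,2)])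
  fix w assume "w \<in> N"
  then show "clip_min c v N y \<le> max 0 (c {v,w} - x w)"
    using clip_min_le[OF assms(1), of w c v y] assms(3)[of w] by linarith
qed

lemma clip_min_subset:
  assumes "finite N" "N' \<noteq> {}" "N' \<subseteq> N"
  shows "clip_min c v N x \<le> clip_min c v N' x"
proof (rule clip_min_geI)
  show "finite N'" using assms finite_subset by blast
  fix w assume "w \<in> N'"
  then show "clip_min c v N x \<le> max 0 (c {v,w} - x w)" using assms by (intro clip_min_le) auto
qed (use assms in auto)

lemma clip_min_cong:
  assumes "\<And>w. w \<in> N \<Longrightarrow> c {v,w} = c' {v,w}" "\<And>w. w \<in> N \<Longrightarrow> x w = y w"
  shows "clip_min c v N x = clip_min c' v N y"
  unfolding clip_min_def using assms by (intro arg_cong2[where f = max] arg_cong[where f = Min] image_cong) auto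

text \<open>At \<open>v\<close> only edges to vertices outside \<open>insert v P\<close> are read,
  and the recursive calls enlarge \<open>P\<close>, so no edge that meets \<open>P\<close> is ever
  read. Every later use of independence between a message and the star of a removed vertex rests on
  this.\<close>

lemma msg_cong:
  assumes "v < n" "v \<notin> P" "\<And>e. e \<in> complete_edges n \<Longrightarrow> e \<inter> P = {} \<Longrightarrow> c e = c' e"
  shows "msg n c k P v = msg n c' k P v"
  using assms
proof (induction k arbitrary: P v)
  case (Suc k)
  show ?case unfolding msg.simps
  proof (rule clip_min_cong)
    fix w assume w: "w \<in> {..<n} - insert v P"
    show "c {v,w} = c' {v,w}" 
      using w Suc.prems by (intro Suc.prems(3))
        (auto simp: complete_edges_def complete_vertices_def nsets_def card_insert_if)
    show "msg n c k (insert v P) w = msg n c' k (insert v P) w"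
      using w Suc.prems by (intro Suc.IH) auto
  qed
qed simp

section \<open>Edges of complete graphs\<close>

lemma mem_complete_edges: "{v,w} \<in> complete_edges n \<longleftrightarrow> v < n \<and> w < n \<and> v \<noteq> w"
  by (auto simp: complete_edges_def complete_vertices_def nsets_def card_insert_if)

lemma complete_edgesE:
  assumes "e \<in> complete_edges n"
  obtains v w where "e = {v,w}" "v < n" "w < n" "v \<noteq> w"
  using assms by (auto simp: complete_edges_def complete_vertices_def nsets_def card_2_iff)

lemma complete_edges_star: "e \<in> complete_edges n \<Longrightarrow> v \<in> e \<Longrightarrow> \<exists>w. e = {v,w}"
  by (elim complete_edgesE) auto

lemma mem_nsets_pair: "{v,w} \<in> nsets A 2 \<longleftrightarrow> v \<in> A \<and> w \<in> A \<and> v \<noteq> w"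
  by (auto simp: nsets_def card_insert_if)

lemma nsets_2_cover:
  assumes "nsets A 2 \<subseteq> E" "2 \<le> card A"
  shows "A \<subseteq> \<Union>E"
proof
  fix x assume x: "x \<in> A"
  have "card (A - {x}) \<noteq> 0" using assms x by (cases "finite A") auto
  then obtain y where "y \<in> A" "y \<noteq> x" by (metis DiffE all_not_in_conv card.empty insertI1)
  then have "{x,y} \<in> E" using x assms(1) mem_nsets_pair[of x y A] by blast
  then show "x \<in> \<Union>E" by blast
qed

text \<open>Typical cost vectors, for the edge \<open>{r,s}\<close>: every vertex has a cheap edge avoiding any given
  small set, and the cheap edges near \<open>{r,s}\<close> span no cycle and do not connect \<open>r\<close> to \<open>s\<close>.\<close>

definition cheap_escape :: "nat \<Rightarrow> (nat set \<Rightarrow> real) \<Rightarrow> real \<Rightarrow> nat \<Rightarrow> bool" where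
  "cheap_escape n c \<theta> K \<longleftrightarrow>
     (\<forall>x<n. \<forall>B\<subseteq>{..<n}. card B \<le> K \<longrightarrow> (\<exists>w\<in>{..<n} - insert x B. c {x,w} \<le> \<theta>))"

text \<open>Stated by counting: \<open>Q\<close> together with \<open>{r,s}\<close> has at least as
  many edges as \<open>W\<close> has vertices, which forces a cycle, and such a \<open>Q\<close> may
  not consist of edges below 2 \<theta> only. In this form the condition suits both the exploration,
  which keeps an edge count, and a union bound over \<open>W\<close> and \<open>Q\<close>.\<close>

definition locally_acyclic :: "nat \<Rightarrow> (nat set \<Rightarrow> real) \<Rightarrow> real \<Rightarrow> nat \<Rightarrow> nat \<Rightarrow> nat \<Rightarrow> bool" where
  "locally_acyclic n c \<theta> K r s \<longleftrightarrow>
     (\<forall>W Q. {r,s} \<subseteq> W \<and> W \<subseteq> {..<n} \<and> card W \<le> K \<and> Q \<subseteq> nsets W 2 - {{r,s}} \<and> card W \<le> card Q + 1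
        \<longrightarrow> (\<exists>e\<in>Q. 2 * \<theta> \<le> c e))"

text \<open>A stage of the exploration from \<open>r\<close> or \<open>s\<close>: the vertices \<open>P\<close> have been visited along the cheap
  edges \<open>Q\<close>, the current vertex is \<open>v\<close>, and \<open>E\<close> is the set of edges still available.\<close>

locale exploration =
  fixes n :: nat and c :: "nat set \<Rightarrow> real" and \<theta> :: real and K r s :: nat
  assumes rs: "r < n" "s < n" "r \<noteq> s" and \<theta>: "0 \<le> \<theta>" and nK: "K + 4 \<le> n"
    and escape: "cheap_escape n c \<theta> K" and acyclic: "locally_acyclic n c \<theta> K r s"
begin

text \<open>\<open>Q\<close> stands for a forest grown from \<open>r\<close> and \<open>s\<close>,
  recorded only by its size: the explored vertices together with \<open>r\<close> and
  \<open>s\<close> number at most \<open>card Q + 2\<close>, so one further cheap edge among them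
  would violate \<open>locally_acyclic\<close>. The vertices \<open>r\<close> and \<open>s\<close>
  are exempted in the clause on \<open>{v,w} \<in> E\<close> because the edge \<open>{r,s}\<close>
  itself is missing from \<open>E\<close>.\<close>

definition stage :: "nat set \<Rightarrow> nat \<Rightarrow> nat set set \<Rightarrow> nat set set \<Rightarrow> bool" where
  "stage P v E Q \<longleftrightarrow> P \<subseteq> {..<n} \<and> v < n \<and> v \<notin> P \<and> E \<subseteq> complete_edges n \<and>
     nsets ({..<n} - insert v P) 2 \<subseteq> E \<and> (\<forall>w\<in>{..<n} - insert v P - {r,s}. {v,w} \<in> E) \<and>
     Q \<subseteq> nsets (insert v P) 2 - {{r,s}} \<and> Q \<inter> E = {} \<and> {r,s} \<notin> E \<and> (\<forall>e\<in>Q. c e < 2 * \<theta>) \<and>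
     card (insert v P \<union> {r,s}) \<le> card Q + 2"

definition nbrs :: "nat set \<Rightarrow> nat \<Rightarrow> nat set set \<Rightarrow> nat set" where
  "nbrs P v E = {w\<in>{..<n} - insert v P. {v,w} \<in> E}"

lemma finite_nbrs: "finite (nbrs P v E)"
  by (simp add: nbrs_def)

lemma card_rest:
  assumes "P \<subseteq> {..<n}" "card P + 2 \<le> K"
  shows "2 \<le> card ({..<n} - insert v P)"
proof -
  have "finite P" using assms finite_subset by blast
  then have "card (insert v P) \<le> K" using assms card_insert_le_m1[of "card P + 1" P v] by (simp add: card_insert_if split: if_splits)
  moreover have "card ({..<n} - insert v P) \<ge> n - card (insert v P)"
    using diff_card_le_card_Diff[of "insert v P" "{..<n}"] \<open>finite P\<close> by simp
  ultimately show ?thesis using nK by linarith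
qed

lemma cheap_neighbour:
  assumes P: "P \<subseteq> {..<n}" "card P + 2 \<le> K" and v: "v < n"
  obtains w where "w \<in> {..<n} - insert v P - {r,s}" "c {v,w} \<le> \<theta>"
proof -
  have "card (P \<union> {r,s}) \<le> K" using card_Un_le[of P "{r,s}"] P rs by simp
  then obtain w where "w \<in> {..<n} - insert v (P \<union> {r,s})" "c {v,w} \<le> \<theta>"
    using escape P rs v unfolding cheap_escape_def by (meson Un_least empty_subsetI insert_subset lessThan_iff)
  then show ?thesis using that by auto
qed

text \<open>Buying one cheap edge bounds the marginal cost by \<theta>, and messages obey the same
  bound. Consequently an edge of cost at least 2 \<theta> offers at least \<theta> to the minimum
  and can be disregarded. This is the origin of the factor 2 in the cutoff.\<close>

lemma need_le:
  assumes P: "P \<subseteq> {..<n}" "card P + 2 \<le> K" and v: "v < n" and E: "finite E"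
    and sub: "nsets ({..<n} - insert v P) 2 \<subseteq> E" "\<And>w. w \<in> {..<n} - insert v P - {r,s} \<Longrightarrow> {v,w} \<in> E"
  shows "need c E ({..<n} - P) v \<le> \<theta>"
proof -
  obtain w where w: "w \<in> {..<n} - insert v P - {r,s}" "c {v,w} \<le> \<theta>" using cheap_neighbour[OF P v] .
  have wE: "{v,w} \<in> E" using sub(2) w by auto
  let ?E = "E - {{v,w}}"
  have sub': "nsets ({..<n} - insert v P) 2 \<subseteq> ?E" using sub(1) by (auto simp: nsets_def)
  have eq: "{..<n} - P - {v} = {..<n} - insert v P" by auto
  have cov: "{..<n} - P - {v} \<subseteq> \<Union>?E"
    unfolding eq by (rule nsets_2_cover[OF sub' card_rest[OF P]])
  have "need c E ({..<n} - P) v \<le> max 0 (c {v,w} - need c ?E ({..<n} - P - {v}) w)"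
    by (rule need_le_edge[OF E wE cov])
  moreover have "0 \<le> need c ?E ({..<n} - P - {v}) w"
    using E cov by (intro need_nonneg) auto
  ultimately show ?thesis using w \<theta> by linarith
qed

lemma clip_min_le_\<theta>:
  assumes P: "P \<subseteq> {..<n}" "card P + 2 \<le> K" and v: "v < n"
    and N: "finite N" "{..<n} - insert v P - {r,s} \<subseteq> N" and x: "\<And>w. w \<in> N \<Longrightarrow> 0 \<le> x w"
  shows "clip_min c v N x \<le> \<theta>"
proof -
  obtain w where w: "w \<in> {..<n} - insert v P - {r,s}" "c {v,w} \<le> \<theta>" using cheap_neighbour[OF P v] .
  then have wN: "w \<in> N" using N by auto
  have "clip_min c v N x \<le> max 0 (c {v,w} - x w)" using N wN by (intro clip_min_le)
  then show ?thesis using w x[OF wN] \<theta> by linarith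
qed

lemma msg_le_\<theta>:
  assumes P: "P \<subseteq> {..<n}" "card P + 2 \<le> K" and v: "v < n"
  shows "msg n c k P v \<le> \<theta>"
  using \<theta> clip_min_le_\<theta>[OF P v, of "{..<n} - insert v P"] by (cases k) (auto simp: msg_nonneg)

text \<open>Crossing a cheap edge adds at most one vertex to the count and exactly one edge to
  \<open>Q\<close>, so the balance in \<open>stage\<close> is preserved. The new edge set may be
  anything between \<open>E\<close> without the star of \<open>v\<close> and \<open>E\<close>
  without \<open>{v,w}\<close>, since \<open>need_geI\<close> charges against such intermediate
  sets.\<close>

lemma stage_step:
  assumes st: "stage P v E Q" and w: "w \<in> nbrs P v E" "c {v,w} < 2 * \<theta>"
    and E': "{e\<in>E. v \<notin> e} \<subseteq> E'" "E' \<subseteq> E - {{v,w}}"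
  shows "stage (insert v P) w E' (insert {v,w} Q)" "nsets ({..<n} - insert v P) 2 \<subseteq> E'"
proof -
  have full: "nsets ({..<n} - insert v P) 2 \<subseteq> E'"
  proof
    fix e assume e: "e \<in> nsets ({..<n} - insert v P) 2"
    then have "e \<in> E" "v \<notin> e" using st by (auto simp: stage_def nsets_def)
    then show "e \<in> E'" using E' by auto
  qed
  then show "nsets ({..<n} - insert v P) 2 \<subseteq> E'" .
  have P: "P \<subseteq> {..<n}" "v < n" "v \<notin> P" using st by (auto simp: stage_def)
  have finP: "finite P" using P finite_subset by blast
  have "Q \<subseteq> nsets (insert v P) 2" using st by (auto simp: stage_def)
  then have finQ: "finite Q" using finP finite_subset finite_imp_finite_nsets by (metis finite_insert)
  have wE: "{v,w} \<in> E" "w < n" "w \<notin> insert v P" using w by (auto simp: nbrs_def)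
  have notQ: "{v,w} \<notin> Q" using st wE by (auto simp: stage_def)
  have 1: "nsets ({..<n} - insert w (insert v P)) 2 \<subseteq> E'"
    using full nsets_mono[of "{..<n} - insert w (insert v P)" "{..<n} - insert v P" 2] by blast
  have 2: "{w,x} \<in> E'" if "x \<in> {..<n} - insert w (insert v P)" for x
  proof -
    have "{w,x} \<in> nsets ({..<n} - insert v P) 2" using that wE by (auto simp: mem_nsets_pair)
    then show ?thesis using full by blast
  qed
  have 3: "insert {v,w} Q \<subseteq> nsets (insert w (insert v P)) 2 - {{r,s}}"
  proof -
    have "{v,w} \<in> nsets (insert w (insert v P)) 2" using wE by (auto simp: mem_nsets_pair)
    moreover have "{v,w} \<noteq> {r,s}" using st wE by (auto simp: stage_def)
    moreover have "Q \<subseteq> nsets (insert v P) 2 - {{r,s}}" using st by (simp add: stage_def)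
    then have "Q \<subseteq> nsets (insert w (insert v P)) 2 - {{r,s}}"
      using nsets_mono[of "insert v P" "insert w (insert v P)" 2] by blast
    ultimately show ?thesis by blast
  qed
  have "card (insert w (insert v P) \<union> {r,s}) \<le> Suc (card (insert v P \<union> {r,s}))"
    using finP by (simp add: card_insert_if insert_commute)
  then have 4: "card (insert w (insert v P) \<union> {r,s}) \<le> card (insert {v,w} Q) + 2"
    using st finQ notQ by (simp add: stage_def)
  show "stage (insert v P) w E' (insert {v,w} Q)"
    unfolding stage_def
  proof (intro conjI)
    show "\<forall>x\<in>{..<n} - insert w (insert v P) - {r,s}. {w,x} \<in> E'" using 2 by auto
    show "\<forall>e\<in>insert {v,w} Q. c e < 2 * \<theta>" using st w by (auto simp: stage_def)
    show "insert {v,w} Q \<inter> E' = {}" "{r,s} \<notin> E'" "E' \<subseteq> complete_edges n"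
      using st E' by (auto simp: stage_def)
  qed (use P wE 1 3 4 in auto)
qed

text \<open>A cheap edge back to a visited vertex would enlarge \<open>Q\<close> without adding a
  vertex: it closes a cycle or joins the explorations from \<open>r\<close> and \<open>s\<close>.
  The budget \<open>card P + 3\<close> bounds the size of \<open>insert v P\<close> together with
  \<open>r\<close> and \<open>s\<close>.\<close>

lemma back_edge:
  assumes st: "stage P v E Q" and p: "p \<in> P" "{v,p} \<in> E" and K: "card P + 3 \<le> K"
  shows "2 * \<theta> \<le> c {v,p}"
proof -
  have P: "P \<subseteq> {..<n}" "v < n" "v \<notin> P" using st by (auto simp: stage_def)
  have finP: "finite P" using P finite_subset by blast
  have "Q \<subseteq> nsets (insert v P) 2" using st by (auto simp: stage_def)
  then have finQ: "finite Q" using finP finite_subset finite_imp_finite_nsets by (metis finite_insert)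
  define W where "W = insert v P \<union> {r,s}"
  have "insert v P \<subseteq> W" by (auto simp: W_def)
  then have sub: "nsets (insert v P) 2 \<subseteq> nsets W 2" by (rule nsets_mono)
  have notQ: "{v,p} \<notin> Q" "{v,p} \<noteq> {r,s}" using st p by (auto simp: stage_def)
  have Q0: "Q \<subseteq> nsets (insert v P) 2 - {{r,s}}" using st by (simp add: stage_def)
  have "{v,p} \<in> nsets (insert v P) 2" using p P by (auto simp: mem_nsets_pair)
  then have Q: "insert {v,p} Q \<subseteq> nsets W 2 - {{r,s}}"
    using Q0 sub notQ by blast
  have "card W \<le> card (insert v P) + card {r,s}" unfolding W_def by (rule card_Un_le)
  then have cardW: "card W \<le> K" using K finP P rs by simp
  have W: "{r,s} \<subseteq> W" "W \<subseteq> {..<n}" using P rs by (auto simp: W_def)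
  have "card W \<le> card (insert {v,p} Q) + 1" using st finQ notQ by (simp add: stage_def W_def)
  then have "\<exists>e\<in>insert {v,p} Q. 2 * \<theta> \<le> c e"
    using acyclic W cardW Q unfolding locally_acyclic_def by blast
  moreover have "\<forall>e\<in>Q. c e < 2 * \<theta>" using st by (simp add: stage_def)
  ultimately show ?thesis by (metis insert_iff not_le)
qed

text \<open>Each message step reverses the direction of the comparison with the true marginal cost.\<close>

lemma need_msg_step:
  assumes IH: "\<And>P v E Q. stage P v E Q \<Longrightarrow> nsets ({..<n} - P) 2 \<subseteq> E \<Longrightarrow> card P + k + 3 \<le> K \<Longrightarrow>
      (if even k then msg n c k P v \<le> need c E ({..<n} - P) v
       else need c E ({..<n} - P) v \<le> msg n c k P v)"
    and st: "stage P v E Q" and K: "card P + Suc k + 3 \<le> K"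
  shows "if even k then need c E ({..<n} - P) v \<le> clip_min c v (nbrs P v E) (msg n c k (insert v P))
       else clip_min c v (nbrs P v E) (msg n c k (insert v P)) \<le> need c E ({..<n} - P) v"
proof -
  let ?P = "insert v P" and ?N = "nbrs P v E" and ?S = "{..<n} - P"
  have P: "P \<subseteq> {..<n}" "v < n" "v \<notin> P" "card P + 2 \<le> K" using st K by (auto simp: stage_def)
  have finP: "finite P" using P finite_subset by blast
  have P': "?P \<subseteq> {..<n}" "card ?P + 2 \<le> K" "card ?P + k + 3 \<le> K" using P K finP by auto
  have E: "finite E" "E \<subseteq> complete_edges n"
    using st finite_complete_edges finite_subset by (auto simp: stage_def)
  have N: "{..<n} - insert v P - {r,s} \<subseteq> ?N" using st by (auto simp: stage_def nbrs_def)
  have S: "?S - {v} = {..<n} - ?P" by auto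
  have base: "nsets ({..<n} - ?P) 2 \<subseteq> {e\<in>E. v \<notin> e}" using st by (auto simp: stage_def nsets_def)
  have cov: "?S - {v} \<subseteq> \<Union>E'" if "{e\<in>E. v \<notin> e} \<subseteq> E'" for E'
    unfolding S using base that by (intro nsets_2_cover card_rest) (use P in auto)
  obtain w0 where w0: "w0 \<in> {..<n} - insert v P - {r,s}" using cheap_neighbour[OF P(1,4,2)] .
  then have w0N: "w0 \<in> ?N" using N by auto
  then have ne: "?N \<noteq> {}" by auto
  have "v \<in> \<Union>E" using w0N by (auto simp: nbrs_def)
  then have covE: "?S \<subseteq> \<Union>E" using cov[of E] by auto
  have small: "need c E ?S v \<le> \<theta>"
    by (rule need_le) (use P E st in \<open>auto simp: stage_def\<close>)
  show ?thesis
  proof (cases "even k")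
    case True
    have "need c E ?S v \<le> clip_min c v ?N (msg n c k ?P)"
    proof (rule clip_min_geI[OF finite_nbrs ne])
      fix w assume w: "w \<in> ?N"
      have wE: "{v,w} \<in> E" "w < n" "w \<notin> ?P" using w by (auto simp: nbrs_def)
      let ?E = "E - {{v,w}}"
      have sub: "{e\<in>E. v \<notin> e} \<subseteq> ?E" by auto
      show "need c E ?S v \<le> max 0 (c {v,w} - msg n c k ?P w)"
      proof (cases "c {v,w} < 2 * \<theta>")
        case True
        have "msg n c k ?P w \<le> need c ?E ({..<n} - ?P) w"
          using IH[OF stage_step(1)[OF st w True sub order.refl] stage_step(2)[OF st w True sub order.refl] P'(3)] \<open>even k\<close> by simp
        moreover have "need c E ?S v \<le> max 0 (c {v,w} - need c ?E (?S - {v}) w)"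
          by (rule need_le_edge[OF E(1) wE(1) cov[OF sub]])
        ultimately show ?thesis unfolding S by linarith
      next
        case False
        moreover have "msg n c k ?P w \<le> \<theta>" using msg_le_\<theta>[OF P'(1,2)] wE by auto
        ultimately show ?thesis using small by linarith
      qed
    qed
    then show ?thesis using True by simp
  next
    case False
    define t where "t = clip_min c v ?N (msg n c k ?P)"
    have t\<theta>: "t \<le> \<theta>" unfolding t_def
      using P N by (intro clip_min_le_\<theta>) (auto simp: msg_nonneg finite_nbrs)
    have t0: "0 \<le> t" by (simp add: t_def clip_min_nonneg)
    have "t \<le> need c E ?S v"
    \<comment> \<open>For positive \<open>t\<close> the clipping at 0 is inactive, so
      \<open>t\<close> is at most \<open>c {v,w}\<close> minus the message for every neighbour,
      without \<open>max\<close>; this is the form that \<open>need_geI\<close> asks for.\<close>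
    proof (cases "t = 0")
      case True
      then show ?thesis using need_nonneg[OF E(1) covE] by simp
    next
      case tpos: False
      show ?thesis
      proof (rule need_geI[OF E(1) _ cov[OF order.refl] covE _ t0])
        show "v \<in> ?S" using P by auto
        fix e assume "e \<in> E" "v \<in> e"
        then show "\<exists>w. e = {v,w}" using E complete_edges_star by blast
      next
        fix w E'
        assume wE: "{v,w} \<in> E" and E': "{e\<in>E. v \<notin> e} \<subseteq> E'" "E' \<subseteq> E - {{v,w}}"
        have "{v,w} \<in> complete_edges n" using wE E by blast
        then have w: "w < n" "w \<noteq> v" by (auto simp only: mem_complete_edges)
        show "t \<le> c {v,w} - need c E' (?S - {v}) w"
        proof (cases "w \<in> P")
          case True
          \<comment> \<open>The vertex \<open>w\<close> no longer has to be covered, so its marginal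
            cost vanishes and the edge must be expensive by itself.\<close>
          then have "2 * \<theta> \<le> c {v,w}" using back_edge[OF st _ wE] K by simp
          then show ?thesis using True t\<theta> \<theta> by (simp add: need_notin)
        next
          case False
          then have wN: "w \<in> ?N" using w wE by (auto simp: nbrs_def)
          show ?thesis
          proof (cases "c {v,w} < 2 * \<theta>")
            case True
            have "need c E' ({..<n} - ?P) w \<le> msg n c k ?P w"
              using IH[OF stage_step[OF st wN True E'] P'(3)] \<open>odd k\<close> by simp
            moreover have "t \<le> max 0 (c {v,w} - msg n c k ?P w)"
              unfolding t_def using wN by (intro clip_min_le finite_nbrs)
            ultimately show ?thesis using tpos t0 unfolding S by linarith
          next
            case c: False
            have full: "nsets ({..<n} - ?P) 2 \<subseteq> E'" using base E' by blast
            have "need c E' ({..<n} - ?P) w \<le> \<theta>"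
            proof (rule need_le[OF P'(1,2) w(1)])
              show "finite E'" using E E' finite_subset by (metis finite_Diff)
              show "nsets ({..<n} - insert w ?P) 2 \<subseteq> E'"
                using full nsets_mono[of "{..<n} - insert w ?P" "{..<n} - ?P" 2] by blast
              fix x assume "x \<in> {..<n} - insert w ?P - {r,s}"
              then have "{w,x} \<in> nsets ({..<n} - ?P) 2" using w False by (auto simp: mem_nsets_pair)
              then show "{w,x} \<in> E'" using full by blast
            qed
            then show ?thesis using c t\<theta> unfolding S by linarith
          qed
        qed
      qed
    qed
    then show ?thesis using False by (simp add: t_def)
  qed
qed

text \<open>The assumption that \<open>E\<close> contains every pair outside \<open>P\<close> makes
  all unvisited vertices neighbours of \<open>v\<close>, as in \<open>msg\<close>. It fails at the
  root \<open>r\<close>, where nothing is removed yet but \<open>{r,s}\<close> is missing; the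
  sandwich therefore ends with a separate application of \<open>need_msg_step\<close>.\<close>

lemma need_msg:
  assumes "stage P v E Q" "nsets ({..<n} - P) 2 \<subseteq> E" "card P + k + 3 \<le> K"
  shows "if even k then msg n c k P v \<le> need c E ({..<n} - P) v
         else need c E ({..<n} - P) v \<le> msg n c k P v"
  using assms
proof (induction k arbitrary: P v E Q)
  case 0
  have "P \<subseteq> {..<n}" "v < n" using 0 by (auto simp: stage_def)
  have "finite E" using 0 finite_complete_edges finite_subset by (auto simp: stage_def)
  moreover have "{..<n} - P \<subseteq> \<Union>E"
  proof (rule nsets_2_cover[OF 0(2)])
    have "2 \<le> card ({..<n} - insert v P)" using 0 by (intro card_rest) (auto simp: stage_def)
    also have "\<dots> \<le> card ({..<n} - P)" by (intro card_mono) auto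
    finally show "2 \<le> card ({..<n} - P)" .
  qed
  ultimately show ?case by (simp add: need_nonneg)
next
  case (Suc k)
  have "v < n" "v \<notin> P" using Suc.prems by (auto simp: stage_def)
  then have "{v,w} \<in> E" if "w \<in> {..<n} - insert v P" for w
    using that Suc.prems(2) by (auto simp: mem_nsets_pair subset_iff)
  then have "nbrs P v E = {..<n} - insert v P" by (auto simp: nbrs_def)
  then show ?case using need_msg_step[OF Suc.IH Suc.prems(1,3)] by (auto split: if_splits)
qed

end

section \<open>Edge thresholds versus truncated messages\<close>

text \<open>The truncation of \<open>edge_threshold_eq_need\<close>. The neighbours omit both
  endpoints because the edge \<open>{u,v}\<close> is deleted; the messages avoid only
  \<open>u\<close> in the first summand and both endpoints in the second. One step is applied on top
  of depth \<open>k\<close>, so even \<open>k\<close> gives upper bounds.\<close>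

definition local_threshold :: "nat \<Rightarrow> (nat set \<Rightarrow> real) \<Rightarrow> nat \<Rightarrow> nat \<Rightarrow> nat \<Rightarrow> real" where
  "local_threshold n c k u v = clip_min c u ({..<n} - {u,v}) (msg n c k {u}) +
     clip_min c v ({..<n} - {u,v}) (msg n c k {u,v})"

lemma local_threshold_nonneg: "0 \<le> local_threshold n c k u v"
  by (simp add: local_threshold_def clip_min_nonneg)

lemma local_threshold_le_0:
  assumes "3 \<le> n"
  shows "local_threshold n c k u v \<le> local_threshold n c 0 u v"
proof -
  have ne: "{..<n} - {u,v} \<noteq> {}"
  proof
    assume "{..<n} - {u,v} = {}"
    then have "{..<n} \<subseteq> {u,v}" by blast
    then have "n \<le> card {u,v}" using card_mono[of "{u,v}" "{..<n}"] by simp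
    also have "\<dots> \<le> 2" by (simp add: card_insert_if)
    finally show False using assms by simp
  qed
  show ?thesis unfolding local_threshold_def
    using ne by (intro add_mono clip_min_antimono) (auto simp: msg_nonneg)
qed

lemma complete_edges_minus_cover:
  assumes "4 \<le> n" 
  shows "{..<n} \<subseteq> \<Union>(complete_edges n - {e})"
proof
  fix x assume x: "x \<in> {..<n}"
  have "\<exists>y z. y \<noteq> z \<and> y < n \<and> z < n \<and> x \<noteq> y \<and> x \<noteq> z"
  proof -
    have "\<not> {..<n} - {x} \<subseteq> {y}" for y
    proof
      assume "{..<n} - {x} \<subseteq> {y}"
      then have "card ({..<n} - {x}) \<le> 1" using card_mono[of "{y}"] by simp
      then show False using assms x by simp
    qed
    then have a: "\<exists>z. z \<noteq> y \<and> z < n \<and> x \<noteq> z" for y by blast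
    then obtain y where "y < n" "x \<noteq> y" by blast
    then show ?thesis using a[of y] by metis
  qed
  then obtain y z where yz: "y \<noteq> z" "y < n" "z < n" "x \<noteq> y" "x \<noteq> z" by blast
  then have "{x,y} \<noteq> {x,z}" by (auto simp: doubleton_eq_iff)
  moreover have "{x,y} \<in> complete_edges n" "{x,z} \<in> complete_edges n"
    using x yz by (auto simp: mem_complete_edges)
  ultimately show "x \<in> \<Union>(complete_edges n - {e})" by (cases "e = {x,y}") auto
qed

lemma edge_threshold_nonneg:
  assumes "4 \<le> n"
  shows "0 \<le> edge_threshold c {..<n} (complete_edges n) e"
  unfolding edge_threshold_def
  using min_edge_cover_cost_mono[of "complete_edges n - {e}" "{..<n}" "complete_edges n - {e}" "{..<n} - e" c]
    complete_edges_minus_cover[OF assms] finite_complete_edges by simp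

text \<open>Valid for every cost vector: any single edge to a third vertex bounds the marginal cost
  of an endpoint. This controls the threshold on atypical vectors.\<close>

lemma edge_threshold_le_local_0:
  assumes "4 \<le> n" "u < n" "v < n" "u \<noteq> v"
  shows "edge_threshold c {..<n} (complete_edges n) {u,v} \<le> local_threshold n c 0 u v"
proof -
  let ?H = "complete_edges n - {{u,v}}"
  have fin: "finite ?H" using finite_complete_edges by simp
  have card: "card ({..<n} - {u,v}) = n - 2" using assms by (subst card_Diff_subset) auto
  have "card ({..<n} - {u,v}) \<noteq> 0" unfolding card using assms by simp
  then have ne: "{..<n} - {u,v} \<noteq> {}" by (metis card.empty)
  have cov: "A \<subseteq> \<Union>(?H - {{x,w}})" if w: "w \<notin> {u,v}" and A: "A \<subseteq> {..<n} - {x}" and x: "x \<in> {u,v}" for A x w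
  proof
    fix y assume y: "y \<in> A"
    have "\<exists>z<n. z \<notin> {x,y,u,v} "
    proof (rule ccontr)
      assume "\<not> ?thesis"
      then have "{..<n} \<subseteq> {y,u,v}" using x by auto
      then have "n \<le> card {y,u,v}" using card_mono[of "{y,u,v}" "{..<n}"] by simp
      also have "\<dots> \<le> 3" by (simp add: card_insert_if)
      finally show False using assms by simp
    qed
    then obtain z where z: "z < n" "z \<notin> {x,y,u,v}" by blast
    then have "{y,z} \<in> complete_edges n" "{y,z} \<noteq> {u,v}" "{y,z} \<noteq> {x,w}"
      using y A by (auto simp: mem_complete_edges doubleton_eq_iff subset_iff)
    then show "y \<in> \<Union>(?H - {{x,w}})" by blast
  qed
  have one: "need c ?H S x \<le> clip_min c x ({..<n} - {u,v}) (\<lambda>_. 0)"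
    if x: "x \<in> {u,v}" and S: "S \<subseteq> {..<n}" for S x
  proof (rule clip_min_geI[OF _ ne])
    fix w assume w: "w \<in> {..<n} - {u,v}"
    have "{x,w} \<in> ?H" using x w assms by (auto simp: mem_complete_edges doubleton_eq_iff)
    moreover have cov': "S - {x} \<subseteq> \<Union>(?H - {{x,w}})" using w S x by (intro cov) auto
    ultimately have "need c ?H S x \<le> max 0 (c {x,w} - need c (?H - {{x,w}}) (S - {x}) w)"
      by (intro need_le_edge fin)
    moreover have "0 \<le> need c (?H - {{x,w}}) (S - {x}) w"
      using cov' fin by (intro need_nonneg) auto
    ultimately show "need c ?H S x \<le> max 0 (c {x,w} - 0)" by linarith
  qed auto
  show ?thesis
    using one[of u "{..<n}"] one[of v "{..<n} - {u}"] assms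
    by (auto simp: edge_threshold_eq_need local_threshold_def msg_0)
qed

text \<open>The offset 5 comes from the second root: one vertex is already visited, one step is
  added on top of depth \<open>k\<close>, and \<open>need_msg_step\<close> keeps a reserve of
  3.\<close>

lemma edge_threshold_sandwich:
  assumes "u < n" "v < n" "u \<noteq> v" "0 \<le> \<theta>" "K + 4 \<le> n" "k + 5 \<le> K"
    and "cheap_escape n c \<theta> K" "locally_acyclic n c \<theta> K u v"
  shows "if even k then edge_threshold c {..<n} (complete_edges n) {u,v} \<le> local_threshold n c k u v
         else local_threshold n c k u v \<le> edge_threshold c {..<n} (complete_edges n) {u,v}"
proof -
  interpret exploration n c \<theta> K u v
    using assms by unfold_locales auto
  let ?H = "complete_edges n - {{u,v}}"
  have K: "complete_edges n = nsets {..<n} 2" by (simp add: complete_edges_def complete_vertices_def)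
  have st1: "stage {} u ?H {}"
    using assms unfolding stage_def by (auto simp: mem_complete_edges K nsets_def doubleton_eq_iff card_insert_if)
  have st2: "stage {u} v ?H {}"
    using assms unfolding stage_def by (auto simp: mem_complete_edges K nsets_def doubleton_eq_iff card_insert_if)
  have N1: "nbrs {} u ?H = {..<n} - {u,v}" and N2: "nbrs {u} v ?H = {..<n} - {u,v}"
    using assms by (auto simp: nbrs_def mem_complete_edges doubleton_eq_iff)
  have uv: "insert v {u} = {u,v}" by auto
  show ?thesis
    using need_msg_step[OF need_msg st1, of k] need_msg_step[OF need_msg st2, of k] assms
    unfolding N1 N2 edge_threshold_eq_need[OF \<open>u \<noteq> v\<close>] local_threshold_def uv
    by (auto split: if_splits intro: add_mono)
qed

section \<open>Moments of clipped exponential minima\<close>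

text \<open>This class is closed under sums and products, so integrability and the use of
  Cauchy-Schwarz are settled by introduction rules instead of estimates for each exponent.\<close>

definition all_moments :: "'a measure \<Rightarrow> ('a \<Rightarrow> real) \<Rightarrow> bool" where
  "all_moments M f \<longleftrightarrow> f \<in> borel_measurable M \<and> (\<forall>p::nat. integrable M (\<lambda>x. \<bar>f x\<bar> ^ p))"

lemma all_moments_measurable: "all_moments M f \<Longrightarrow> f \<in> borel_measurable M"
  by (simp add: all_moments_def)

lemma all_moments_integrable: "all_moments M f \<Longrightarrow> integrable M f"
  unfolding all_moments_def
  by (elim conjE allE[of _ 1], rule integrable_abs_cancel) simp_all

lemma all_moments_dominated:
  assumes "all_moments M g" "f \<in> borel_measurable M" "\<And>x. \<bar>f x\<bar> \<le> \<bar>g x\<bar>"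
  shows "all_moments M f"
  unfolding all_moments_def
proof safe
  note [measurable] = assms(2)
  fix p :: nat
  show "integrable M (\<lambda>x. \<bar>f x\<bar> ^ p)"
  proof (rule Bochner_Integration.integrable_bound)
    show "integrable M (\<lambda>x. \<bar>g x\<bar> ^ p)" using assms(1) by (simp add: all_moments_def)
  qed (use assms(3) in \<open>auto intro!: power_mono\<close>)
qed (rule assms)

lemma all_moments_mult:
  assumes "all_moments M f" "all_moments M g"
  shows "all_moments M (\<lambda>x. f x * g x)"
  unfolding all_moments_def
proof safe
  note [measurable] = assms[THEN all_moments_measurable]
  show "(\<lambda>x. f x * g x) \<in> borel_measurable M" by measurable
  fix p :: nat
  show "integrable M (\<lambda>x. \<bar>f x * g x\<bar> ^ p)"
  proof (rule Bochner_Integration.integrable_bound)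
    show "integrable M (\<lambda>x. \<bar>f x\<bar> ^ (2 * p) + \<bar>g x\<bar> ^ (2 * p))"
      using assms by (intro Bochner_Integration.integrable_add) (simp_all only: all_moments_def)
    have "\<bar>a * b\<bar> ^ p \<le> \<bar>a\<bar> ^ (2 * p) + \<bar>b\<bar> ^ (2 * p)" for a b :: real
    proof -
      have "2 * (\<bar>a\<bar> ^ p * \<bar>b\<bar> ^ p) \<le> (\<bar>a\<bar> ^ p)\<^sup>2 + (\<bar>b\<bar> ^ p)\<^sup>2"
        using sum_squares_bound[of "\<bar>a\<bar> ^ p" "\<bar>b\<bar> ^ p"] by simp
      moreover have "0 \<le> \<bar>a\<bar> ^ p * \<bar>b\<bar> ^ p" by simp
      ultimately have "\<bar>a\<bar> ^ p * \<bar>b\<bar> ^ p \<le> (\<bar>a\<bar> ^ p)\<^sup>2 + (\<bar>b\<bar> ^ p)\<^sup>2" by linarith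
      then show ?thesis by (simp only: abs_mult power_mult_distrib power_mult[symmetric] mult.commute)
    qed
    then show "AE x in M. norm (\<bar>f x * g x\<bar> ^ p) \<le> norm (\<bar>f x\<bar> ^ (2 * p) + \<bar>g x\<bar> ^ (2 * p))"
      by (auto intro!: AE_I2)
  qed measurable
qed

lemma all_moments_add:
  assumes "all_moments M f" "all_moments M g"
  shows "all_moments M (\<lambda>x. f x + g x)"
  unfolding all_moments_def
proof safe
  note [measurable] = assms[THEN all_moments_measurable]
  show "(\<lambda>x. f x + g x) \<in> borel_measurable M" by measurable
  fix p :: nat
  show "integrable M (\<lambda>x. \<bar>f x + g x\<bar> ^ p)"
  proof (rule Bochner_Integration.integrable_bound)
    show "integrable M (\<lambda>x. 2 ^ p * (\<bar>f x\<bar> ^ p + \<bar>g x\<bar> ^ p))"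
      using assms by (intro integrable_mult_right Bochner_Integration.integrable_add) (simp_all add: all_moments_def)
    have "\<bar>a + b\<bar> ^ p \<le> 2 ^ p * (\<bar>a\<bar> ^ p + \<bar>b\<bar> ^ p)" for a b :: real
    proof -
      have "\<bar>a + b\<bar> ^ p \<le> (2 * max \<bar>a\<bar> \<bar>b\<bar>) ^ p" by (intro power_mono) auto
      also have "\<dots> \<le> 2 ^ p * (\<bar>a\<bar> ^ p + \<bar>b\<bar> ^ p)" 
        by (auto simp: power_mult_distrib max_def)
      finally show ?thesis .
    qed
    then show "AE x in M. norm (\<bar>f x + g x\<bar> ^ p) \<le> norm (2 ^ p * (\<bar>f x\<bar> ^ p + \<bar>g x\<bar> ^ p))"
      by (auto intro!: AE_I2)
  qed measurable
qed

context prob_space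
begin

lemma all_moments_const: "all_moments M (\<lambda>_. a)"
  by (simp add: all_moments_def)

lemma all_moments_bounded: "f \<in> borel_measurable M \<Longrightarrow> (\<And>x. \<bar>f x\<bar> \<le> B) \<Longrightarrow> all_moments M f"
  by (rule all_moments_dominated[OF all_moments_const[of B]]) (auto intro: order_trans[OF _ abs_ge_self])

lemma all_moments_cmult: "all_moments M f \<Longrightarrow> all_moments M (\<lambda>x. a * f x)"
  by (intro all_moments_mult all_moments_const)

lemma all_moments_diff: "all_moments M f \<Longrightarrow> all_moments M g \<Longrightarrow> all_moments M (\<lambda>x. f x - g x)"
  using all_moments_add[of M f "\<lambda>x. (-1) * g x"] all_moments_cmult[of g "-1"] by simp

lemma all_moments_abs: "all_moments M f \<Longrightarrow> all_moments M (\<lambda>x. \<bar>f x\<bar>)"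
  by (auto simp: all_moments_def)

lemma all_moments_power: "all_moments M f \<Longrightarrow> all_moments M (\<lambda>x. f x ^ p)"
  by (induction p) (auto intro: all_moments_const all_moments_mult)

lemma all_moments_sum: "(\<And>i. i \<in> A \<Longrightarrow> all_moments M (f i)) \<Longrightarrow> all_moments M (\<lambda>x. \<Sum>i\<in>A. f i x)"
  by (induction A rule: infinite_finite_induct) (auto intro: all_moments_const all_moments_add)

lemma all_moments_exp_minus:
  assumes "f \<in> borel_measurable M" "\<And>x. 0 \<le> f x"
  shows "all_moments M (\<lambda>x. exp (- f x))"
  using assms by (intro all_moments_bounded[where B = 1]) auto

lemma expectation_cauchy_schwarz:
  assumes f: "all_moments M f" and g: "all_moments M g"
  shows "expectation (\<lambda>x. \<bar>f x\<bar> * \<bar>g x\<bar>) \<le> sqrt (expectation (\<lambda>x. (f x)\<^sup>2)) * sqrt (expectation (\<lambda>x. (g x)\<^sup>2))"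
proof -
  define a where "a = expectation (\<lambda>x. (f x)\<^sup>2)"
  define b where "b = expectation (\<lambda>x. \<bar>f x\<bar> * \<bar>g x\<bar>)"
  define d where "d = expectation (\<lambda>x. (g x)\<^sup>2)"
  have int: "integrable M (\<lambda>x. (f x)\<^sup>2)" "integrable M (\<lambda>x. (g x)\<^sup>2)" "integrable M (\<lambda>x. \<bar>f x\<bar> * \<bar>g x\<bar>)"
    using f g by (auto intro!: all_moments_integrable all_moments_power all_moments_mult all_moments_abs)
  have nonneg: "0 \<le> a" "0 \<le> b" "0 \<le> d" by (auto simp: a_def b_def d_def)
  have Q: "0 \<le> s\<^sup>2 * a - 2 * s * t * b + t\<^sup>2 * d" for s t
  proof -
    have "0 \<le> expectation (\<lambda>x. (s * \<bar>f x\<bar> - t * \<bar>g x\<bar>)\<^sup>2)" by simp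
    also have "(\<lambda>x. (s * \<bar>f x\<bar> - t * \<bar>g x\<bar>)\<^sup>2) =
        (\<lambda>x. s\<^sup>2 * (f x)\<^sup>2 - 2 * s * t * (\<bar>f x\<bar> * \<bar>g x\<bar>) + t\<^sup>2 * (g x)\<^sup>2)"
      by (auto simp: power2_diff power_mult_distrib fun_eq_iff algebra_simps)
    also have "expectation \<dots> = s\<^sup>2 * a - 2 * s * t * b + t\<^sup>2 * d"
      using int by (simp add: a_def b_def d_def)
    finally show ?thesis .
  qed
  have "b\<^sup>2 \<le> a * d"
  \<comment> \<open>If \<open>a = 0\<close>, the nonnegative form is linear in \<open>s\<close>,
    which forces \<open>b = 0\<close>: the value of \<open>s\<close> chosen below would make it
    negative. Otherwise \<open>s = b\<close>, \<open>t = a\<close> is the minimiser up to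
    scaling.\<close>
  proof (cases "a = 0")
    case True
    have "b = 0"
    proof (rule ccontr)
      assume "b \<noteq> 0"
      then have "0 < b" using nonneg by simp
      have *: "2 * ((d + 1) / b) * b = 2 * (d + 1)" using \<open>0 < b\<close> by simp
      have "2 * ((d + 1) / b) * b \<le> d" using Q[of "(d + 1) / b" 1] True by simp
      then show False using nonneg unfolding * by simp
    qed
    then show ?thesis using nonneg by simp
  next
    case False
    have "0 \<le> b\<^sup>2 * a - 2 * b * a * b + a\<^sup>2 * d" using Q[of b a] .
    then have "0 \<le> a * (a * d - b\<^sup>2)" by (simp add: power2_eq_square algebra_simps)
    then show ?thesis using False nonneg by (simp add: zero_le_mult_iff)
  qed
  then have "b \<le> sqrt (a * d)" using real_le_rsqrt by blast
  then show ?thesis by (simp add: real_sqrt_mult a_def b_def d_def)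
qed

lemma expectation_abs_le_sqrt:
  assumes "all_moments M f"
  shows "expectation (\<lambda>x. \<bar>f x\<bar>) \<le> sqrt (expectation (\<lambda>x. (f x)\<^sup>2))"
  using expectation_cauchy_schwarz[OF assms all_moments_const[of 1]] prob_space by simp

end

section \<open>Products of exponential laws\<close>

text \<open>Stated pointwise and not through a generated sigma-algebra: after a product measure is
  split by \<open>merge\<close> or by an update, such a function can be evaluated directly on the
  part that it depends on.\<close>

definition depends_on :: "'i set \<Rightarrow> (('i \<Rightarrow> real) \<Rightarrow> 'b) \<Rightarrow> bool" where
  "depends_on J f \<longleftrightarrow> (\<forall>c c'. (\<forall>i\<in>J. c i = c' i) \<longrightarrow> f c = f c')"

lemma depends_onD: "depends_on J f \<Longrightarrow> (\<And>i. i \<in> J \<Longrightarrow> c i = c' i) \<Longrightarrow> f c = f c'"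
  by (auto simp: depends_on_def)

definition expo :: "real measure" where
  "expo = density lborel (\<lambda>x. ennreal (exponential_density 1 x))"

lemma sets_expo [simp, measurable_cong]: "sets expo = sets borel"
  by (simp add: expo_def)

lemma space_expo [simp]: "space expo = UNIV"
  by (simp add: expo_def)

interpretation expo: prob_space expo
  unfolding expo_def by (rule prob_space_exponential_density) simp

lemma emeasure_expo_atLeast:
  assumes "0 \<le> t"
  shows "emeasure expo {t..} = ennreal (exp (- t))"
proof -
  have "emeasure expo {..t} = ennreal (1 - exp (- t))"
    using emeasure_erlang_density[of 1 0 t] assms by (simp add: expo_def erlang_CDF_0)
  moreover have "emeasure expo {t} = 0"
    by (simp add: expo_def emeasure_density nn_integral_indicator_singleton)
  moreover have "emeasure expo {t..} = 1 - emeasure expo {..t} + emeasure expo {t}"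
  proof -
    have "emeasure expo {t..} = emeasure expo ({t<..} \<union> {t})" by (rule arg_cong[where f = "emeasure expo"]) auto
    also have "\<dots> = emeasure expo {t<..} + emeasure expo {t}" by (rule plus_emeasure[symmetric]) auto
    also have "emeasure expo {t<..} = emeasure expo (space expo - {..t})"
      by (rule arg_cong[where f = "emeasure expo"]) auto
    also have "\<dots> = 1 - emeasure expo {..t}"
      using emeasure_compl[of "{..t}" expo] expo.emeasure_space_1 expo.emeasure_finite by simp
    finally show ?thesis .
  qed
  ultimately show ?thesis using assms
    by (simp add: ennreal_1[symmetric] ennreal_minus del: ennreal_1)
qed

lemma measure_expo_less:
  assumes "0 \<le> t"
  shows "measure expo {..<t} \<le> t"
proof -
  have "measure expo {t..} = exp (- t)"
    using emeasure_expo_atLeast[OF assms] by (simp add: measure_def)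
  moreover have "measure expo {..<t} = 1 - measure expo {t..}"
    using expo.prob_compl[of "{t..}"] by (simp add: Compl_eq_Diff_UNIV[symmetric])
  ultimately show ?thesis using exp_ge_add_one_self[of "-t"] by linarith
qed

lemma AE_expo_nonneg: "AE x in expo. 0 \<le> x"
  unfolding expo_def by (subst AE_density) (auto simp: erlang_density_def)

definition expo_prod :: "'i set \<Rightarrow> ('i \<Rightarrow> real) measure" where
  "expo_prod I = PiM I (\<lambda>_. expo)"

interpretation expo_PiM: product_prob_space "\<lambda>_. expo" I for I
  by unfold_locales

interpretation expo_prod: prob_space "expo_prod I" for I
  unfolding expo_prod_def by (rule prob_space_PiM) (rule expo.prob_space_axioms)

lemmas all_moments_intros = all_moments_integrable all_moments_mult all_moments_add
  expo_prod.all_moments_const expo_prod.all_moments_cmult expo_prod.all_moments_power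
  expo_prod.all_moments_abs expo_prod.all_moments_diff expo_prod.all_moments_sum

lemma measurable_expo_prod_component: "i \<in> I \<Longrightarrow> (\<lambda>c. c i) \<in> borel_measurable (expo_prod I)"
  unfolding expo_prod_def using measurable_component_singleton[of i I "\<lambda>_. expo"] by simp

text \<open>Layer-cake representation: together with Fubini it turns tail probabilities into
  moments.\<close>

lemma nn_integral_power_tail:
  fixes a :: real
  assumes "0 \<le> a" "0 < p"
  shows "(\<integral>\<^sup>+t. ennreal (real p * t ^ (p - 1)) * indicator {0..a} t \<partial>lborel) = ennreal (a ^ p)"
proof -
  have "(\<integral>\<^sup>+t. ennreal (real p * t ^ (p - 1)) * indicator {0..a} t \<partial>lborel) = ennreal (a ^ p - 0 ^ p)"
  proof (rule nn_integral_FTC_Icc)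
    fix x :: real
    show "DERIV (\<lambda>x. x ^ p) x :> real p * x ^ (p - 1)"
      using DERIV_pow[of p x] by simp
  qed (use assms in auto)
  then show ?thesis using assms by simp
qed

text \<open>The integrand is \<open>fact p / l ^ p\<close> times an Erlang density of shape
  \<open>p\<close>, so the normalisation of that density gives the value.\<close>

lemma nn_integral_power_exp:
  fixes l :: real
  assumes "0 < l" "0 < p"
  shows "(\<integral>\<^sup>+t. ennreal (real p * t ^ (p - 1) * exp (- l * t)) * indicator {0..} t \<partial>lborel) = ennreal (fact p / l ^ p)"
proof -
  have "(\<integral>\<^sup>+t. ennreal (real p * t ^ (p - 1) * exp (- l * t)) * indicator {0..} t \<partial>lborel) =
      (\<integral>\<^sup>+t. ennreal (fact p / l ^ p) * ennreal (erlang_density (p - 1) l t) \<partial>lborel)"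
  proof (intro nn_integral_cong)
    fix t :: real
    have "fact p = real p * fact (p - 1)" using assms by (simp add: fact_reduce)
    then have "real p * t ^ (p - 1) * exp (- l * t) = fact p / l ^ p * erlang_density (p - 1) l t" if "0 \<le> t"
      using that assms by (simp add: erlang_density_def field_simps)
    then show "ennreal (real p * t ^ (p - 1) * exp (- l * t)) * indicator {0..} t =
        ennreal (fact p / l ^ p) * ennreal (erlang_density (p - 1) l t)"
      using assms by (cases "0 \<le> t") (auto simp: ennreal_mult[symmetric] erlang_density_def)
  qed
  also have "\<dots> = ennreal (fact p / l ^ p) * (\<integral>\<^sup>+t. ennreal (erlang_density (p - 1) l t) \<partial>lborel)"
    by (rule nn_integral_cmult) simp
  also have "(\<integral>\<^sup>+t. ennreal (erlang_density (p - 1) l t) \<partial>lborel) = 1"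
    using prob_space.emeasure_space_1[OF prob_space_erlang_density[OF assms(1), of "p - 1"]]
    by (simp add: emeasure_density)
  finally show ?thesis by simp
qed

lemma borel_measurable_clip:
  assumes "finite N" "\<And>w. w \<in> N \<Longrightarrow> f w \<in> borel_measurable M"
  shows "(\<lambda>c. max 0 (MIN w\<in>N. f w c :: real)) \<in> borel_measurable M"
  using assms by (intro borel_measurable_max borel_measurable_Min) auto

lemma borel_measurable_below_graph:
  fixes f :: "'a \<Rightarrow> real"
  assumes [measurable]: "f \<in> borel_measurable M"
  shows "(\<lambda>(z, t). ennreal (real p * t ^ (p - 1)) * indicator {0..f z} t) \<in> borel_measurable (M \<Otimes>\<^sub>M lborel)"
  unfolding indicator_def of_bool_def atLeastAtMost_iff by measurable

lemma borel_measurable_exp_mult: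
  fixes f :: "'a \<Rightarrow> real"
  assumes [measurable]: "f \<in> borel_measurable M" "h \<in> borel_measurable M"
  shows "(\<lambda>z. a * (exp (- f z) * h z :: real)) \<in> borel_measurable M"
  by measurable

lemma borel_measurable_power_mult:
  fixes f :: "'a \<Rightarrow> real"
  assumes [measurable]: "f \<in> borel_measurable M" "h \<in> borel_measurable M"
  shows "(\<lambda>z. f z ^ p * h z :: real) \<in> borel_measurable M"
  by measurable

text \<open>For \<open>t > 0\<close> the clipped minimum is at least \<open>t\<close> exactly if
  every cost is at least \<open>t + x w\<close>. This has probability
  \<open>exp (- m * t - X)\<close> with \<open>m = card N\<close> and \<open>X\<close> the sum of
  all \<open>x w\<close>, so the tail is \<open>exp (- X)\<close> times that of an exponential
  variable of rate \<open>m\<close>, whose \<open>p\<close>-th moment is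
  \<open>fact p / m ^ p\<close>. The clipping puts the remaining mass at 0, where it does not count
  because \<open>p > 0\<close>.\<close>

lemma nn_integral_expo_clip:
  assumes N: "finite N" "N \<noteq> {}" and e: "inj_on e N" and x: "\<And>w. w \<in> N \<Longrightarrow> 0 \<le> x w" and p: "0 < p"
  shows "(\<integral>\<^sup>+z. ennreal (max 0 (MIN w\<in>N. z (e w) - x w) ^ p) \<partial>expo_prod (e ` N)) =
     ennreal (fact p / real (card N) ^ p * exp (- (\<Sum>w\<in>N. x w)))"
proof -
  let ?M = "expo_prod (e ` N)" and ?F = "\<lambda>z. max 0 (MIN w\<in>N. z (e w) - x w)"
  let ?m = "real (card N)" and ?X = "\<Sum>w\<in>N. x w"
  have m: "0 < ?m" using N by (simp add: card_gt_0_iff)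
  have F[measurable]: "?F \<in> borel_measurable ?M"
    using N by (intro borel_measurable_clip borel_measurable_diff measurable_expo_prod_component) auto
  interpret P: pair_sigma_finite ?M lborel
    by (simp add: pair_sigma_finite_def expo_prod.sigma_finite_measure_axioms lborel.sigma_finite_measure_axioms)
  have tail: "emeasure ?M {z\<in>space ?M. t \<le> ?F z} = ennreal (exp (- ?m * t - ?X))" if t: "0 < t" for t
  proof -
    have "{z\<in>space ?M. t \<le> ?F z} = {z\<in>space ?M. \<forall>i\<in>e ` N. z i \<in> {t + x (the_inv_into N e i)..}}"
      using t N e by (auto simp: le_max_iff_disj the_inv_into_f_f algebra_simps)
    also have "emeasure ?M \<dots> = (\<Prod>i\<in>e ` N. emeasure expo {t + x (the_inv_into N e i)..})"
      unfolding expo_prod_def using N by (subst expo_PiM.emeasure_PiM_Collect) auto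
    also have "\<dots> = (\<Prod>w\<in>N. emeasure expo {t + x w..})"
      using e by (simp add: prod.reindex the_inv_into_f_f)
    also have "\<dots> = (\<Prod>w\<in>N. ennreal (exp (- (t + x w))))"
    proof (rule prod.cong[OF refl])
      fix w assume "w \<in> N"
      then have "0 \<le> t + x w" using x[of w] t by simp
      then show "emeasure expo {t + x w..} = ennreal (exp (- (t + x w)))" by (rule emeasure_expo_atLeast)
    qed
    also have "\<dots> = ennreal (\<Prod>w\<in>N. exp (- (t + x w)))" by (rule prod_ennreal) simp
    also have "(\<Prod>w\<in>N. exp (- (t + x w))) = exp (- ?m * t - ?X)"
      using N by (simp add: exp_sum[symmetric] sum_negf sum.distrib sum_subtractf)
    finally show ?thesis .
  qed
  have "(\<integral>\<^sup>+z. ennreal (?F z ^ p) \<partial>?M) =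
      (\<integral>\<^sup>+z. \<integral>\<^sup>+t. ennreal (real p * t ^ (p - 1)) * indicator {0..?F z} t \<partial>lborel \<partial>?M)"
    using p by (intro nn_integral_cong nn_integral_power_tail[symmetric]) auto
  also have "\<dots> = (\<integral>\<^sup>+t. \<integral>\<^sup>+z. ennreal (real p * t ^ (p - 1)) * indicator {0..?F z} t \<partial>?M \<partial>lborel)"
    by (rule P.Fubini'[symmetric], rule borel_measurable_below_graph[OF F])
  also have "\<dots> = (\<integral>\<^sup>+t. ennreal (exp (- ?X)) * (ennreal (real p * t ^ (p - 1) * exp (- ?m * t)) * indicator {0..} t) \<partial>lborel)"
  proof (rule nn_integral_cong_AE)
    show "AE t in lborel. (\<integral>\<^sup>+z. ennreal (real p * t ^ (p - 1)) * indicator {0..?F z} t \<partial>?M) =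
       ennreal (exp (- ?X)) * (ennreal (real p * t ^ (p - 1) * exp (- ?m * t)) * indicator {0..} t)"
      using AE_lborel_singleton[of "0::real"]
    proof eventually_elim
      case (elim t)
      show ?case
      proof (cases "0 < t")
        case False
        then show ?thesis using elim by (auto simp: indicator_def)
      next
        case True
        have "(\<integral>\<^sup>+z. ennreal (real p * t ^ (p - 1)) * indicator {0..?F z} t \<partial>?M) =
            (\<integral>\<^sup>+z. ennreal (real p * t ^ (p - 1)) * indicator {z\<in>space ?M. t \<le> ?F z} z \<partial>?M)"
          using True by (intro nn_integral_cong) (auto simp: indicator_def)
        also have "\<dots> = ennreal (real p * t ^ (p - 1)) * emeasure ?M {z\<in>space ?M. t \<le> ?F z}"
          by (subst nn_integral_cmult_indicator) auto
        finally show ?thesis unfolding tail[OF True] using True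
          by (simp add: ennreal_mult[symmetric] exp_diff exp_minus field_simps)
      qed
    qed
  qed
  also have "\<dots> = ennreal (exp (- ?X)) * ennreal (fact p / ?m ^ p)"
    by (subst nn_integral_cmult) (use nn_integral_power_exp[OF m p] in auto)
  finally show ?thesis by (simp add: ennreal_mult[symmetric] mult.commute)
qed

text \<open>Integrating out the edges at a vertex replaces powers of a clipped minimum by
  exponentials of the messages that enter it.\<close>

lemma nn_integral_clip:
  fixes h :: "('i \<Rightarrow> real) \<Rightarrow> real"
  assumes I: "finite I" and N: "finite N" "N \<noteq> {}" and e: "inj_on e N" "e ` N \<subseteq> I" and p: "0 < p"
    and x: "\<And>w. w \<in> N \<Longrightarrow> x w \<in> borel_measurable (expo_prod I)" "\<And>w c. w \<in> N \<Longrightarrow> 0 \<le> x w c"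
      "\<And>w. w \<in> N \<Longrightarrow> depends_on (I - e ` N) (x w)"
    and h: "h \<in> borel_measurable (expo_prod I)" "\<And>c. 0 \<le> h c" "depends_on (I - e ` N) h"
  shows "(\<integral>\<^sup>+c. ennreal (max 0 (MIN w\<in>N. c (e w) - x w c) ^ p * h c) \<partial>expo_prod I) =
     (\<integral>\<^sup>+c. ennreal (fact p / real (card N) ^ p * (exp (- (\<Sum>w\<in>N. x w c)) * h c)) \<partial>expo_prod I)"
proof -
  let ?A = "e ` N" and ?J = "I - e ` N"
  let ?F = "\<lambda>c. max 0 (MIN w\<in>N. c (e w) - x w c)"
  let ?g = "\<lambda>c. fact p / real (card N) ^ p * (exp (- (\<Sum>w\<in>N. x w c)) * h c)"
  have IJ: "?J \<union> ?A = I" "?J \<inter> ?A = {}" "finite ?J" "finite ?A" using I N e by auto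
  have F: "?F \<in> borel_measurable (expo_prod I)"
    using N e by (intro borel_measurable_clip borel_measurable_diff measurable_expo_prod_component x) auto
  \<comment> \<open>Fubini: the costs of the edges indexed by \<open>N\<close> form the inner
    integral, while the messages and \<open>h\<close> depend only on the outer coordinates.\<close>
  have split: "(\<integral>\<^sup>+c. f c \<partial>expo_prod I) = (\<integral>\<^sup>+y. \<integral>\<^sup>+z. f (merge ?J ?A (y, z)) \<partial>expo_prod ?A \<partial>expo_prod ?J)"
    if "f \<in> borel_measurable (expo_prod I)" for f
    using expo_PiM.product_nn_integral_fold[of ?J ?A f] IJ that by (simp add: expo_prod_def)
  have dep: "x w (merge ?J ?A (y, z)) = x w y" if "w \<in> N" for w y z
    by (rule depends_onD[OF x(3)[OF that]]) (simp add: merge_def)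
  have deph: "h (merge ?J ?A (y, z)) = h y" for y z
    by (rule depends_onD[OF h(3)]) (simp add: merge_def)
  have g: "?g \<in> borel_measurable (expo_prod I)"
    by (rule borel_measurable_exp_mult[OF borel_measurable_sum[OF x(1)] h(1)])
  have "(\<integral>\<^sup>+c. ennreal (?F c ^ p * h c) \<partial>expo_prod I) =
     (\<integral>\<^sup>+y. \<integral>\<^sup>+z. ennreal (?F (merge ?J ?A (y, z)) ^ p * h (merge ?J ?A (y, z))) \<partial>expo_prod ?A \<partial>expo_prod ?J)"
    by (rule split) (rule measurable_compose[OF borel_measurable_power_mult[OF F h(1)] measurable_ennreal])
  also have "\<dots> = (\<integral>\<^sup>+y. \<integral>\<^sup>+z. ennreal (?g (merge ?J ?A (y, z))) \<partial>expo_prod ?A \<partial>expo_prod ?J)"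
  proof (rule nn_integral_cong)
    fix y
    have F': "?F (merge ?J ?A (y, z)) = max 0 (MIN w\<in>N. z (e w) - x w y)" for z
    proof -
      have "(\<lambda>w. merge ?J ?A (y, z) (e w) - x w (merge ?J ?A (y, z))) ` N = (\<lambda>w. z (e w) - x w y) ` N"
      proof (rule image_cong[OF refl])
        fix w assume "w \<in> N"
        moreover from this have "merge ?J ?A (y, z) (e w) = z (e w)" by (simp add: merge_def)
        ultimately show "merge ?J ?A (y, z) (e w) - x w (merge ?J ?A (y, z)) = z (e w) - x w y"
          by (simp add: dep)
      qed
      then show ?thesis by simp
    qed
    have "(\<integral>\<^sup>+z. ennreal (?F (merge ?J ?A (y, z)) ^ p * h (merge ?J ?A (y, z))) \<partial>expo_prod ?A) =
        (\<integral>\<^sup>+z. ennreal (max 0 (MIN w\<in>N. z (e w) - x w y) ^ p) * ennreal (h y) \<partial>expo_prod ?A)"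
      unfolding F' deph using h(2) by (intro nn_integral_cong ennreal_mult) auto
    also have "\<dots> = ennreal (fact p / real (card N) ^ p * exp (- (\<Sum>w\<in>N. x w y))) * ennreal (h y)"
      using x(2) N e(1) p
      by (subst nn_integral_multc, simp_all add: nn_integral_expo_clip)
        (intro measurable_compose[OF _ measurable_ennreal] borel_measurable_power borel_measurable_clip
          borel_measurable_diff measurable_expo_prod_component, auto)
    also have "\<dots> = (\<integral>\<^sup>+z. ennreal (?g (merge ?J ?A (y, z))) \<partial>expo_prod ?A)"
    proof -
      have eq: "?g (merge ?J ?A (y, z)) = ?g y" for z
        by (simp only: deph dep cong: sum.cong)
      show ?thesis unfolding eq
        by (simp add: expo_prod.emeasure_space_1 ennreal_mult[symmetric] h(2) mult.assoc)
    qed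
    finally show "(\<integral>\<^sup>+z. ennreal (?F (merge ?J ?A (y, z)) ^ p * h (merge ?J ?A (y, z))) \<partial>expo_prod ?A) =
      (\<integral>\<^sup>+z. ennreal (?g (merge ?J ?A (y, z))) \<partial>expo_prod ?A)" .
  qed
  also have "\<dots> = (\<integral>\<^sup>+c. ennreal (?g c) \<partial>expo_prod I)"
    by (rule split[symmetric]) (rule measurable_compose[OF g measurable_ennreal])
  finally show ?thesis .
qed

lemma integral_clip:
  fixes h :: "('i \<Rightarrow> real) \<Rightarrow> real"
  assumes I: "finite I" and N: "finite N" "N \<noteq> {}" and e: "inj_on e N" "e ` N \<subseteq> I" and p: "0 < p"
    and x: "\<And>w. w \<in> N \<Longrightarrow> x w \<in> borel_measurable (expo_prod I)" "\<And>w c. w \<in> N \<Longrightarrow> 0 \<le> x w c"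
      "\<And>w. w \<in> N \<Longrightarrow> depends_on (I - e ` N) (x w)"
    and h: "h \<in> borel_measurable (expo_prod I)" "\<And>c. 0 \<le> h c" "depends_on (I - e ` N) h"
  shows "expo_prod.expectation I (\<lambda>c. max 0 (MIN w\<in>N. c (e w) - x w c) ^ p * h c) =
     fact p / real (card N) ^ p * expo_prod.expectation I (\<lambda>c. exp (- (\<Sum>w\<in>N. x w c)) * h c)"
proof -
  have F[measurable]: "(\<lambda>c. max 0 (MIN w\<in>N. c (e w) - x w c)) \<in> borel_measurable (expo_prod I)"
    using N e by (intro borel_measurable_clip borel_measurable_diff measurable_expo_prod_component x) auto
  have "expo_prod.expectation I (\<lambda>c. max 0 (MIN w\<in>N. c (e w) - x w c) ^ p * h c) =
      enn2real (\<integral>\<^sup>+c. ennreal (max 0 (MIN w\<in>N. c (e w) - x w c) ^ p * h c) \<partial>expo_prod I)"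
    by (rule integral_eq_nn_integral[OF borel_measurable_power_mult[OF F h(1)]]) (simp add: h(2))
  also have "\<dots> = enn2real (\<integral>\<^sup>+c. ennreal (fact p / real (card N) ^ p * (exp (- (\<Sum>w\<in>N. x w c)) * h c)) \<partial>expo_prod I)"
    by (subst nn_integral_clip[OF assms]) (rule refl | assumption)+
  also have "\<dots> = expo_prod.expectation I (\<lambda>c. fact p / real (card N) ^ p * (exp (- (\<Sum>w\<in>N. x w c)) * h c))"
    by (rule integral_eq_nn_integral[OF borel_measurable_exp_mult[OF borel_measurable_sum[OF x(1)] h(1)], symmetric])
      (simp_all add: h(2))
  finally show ?thesis by simp
qed

text \<open>With all messages replaced by 0 the clipped minimum only grows, and there
  \<open>nn_integral_clip\<close> gives every moment explicitly.\<close>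

lemma all_moments_clip:
  assumes I: "finite I" and N: "finite N" "N \<noteq> {}" and e: "inj_on e N" "e ` N \<subseteq> I"
    and x: "\<And>w. w \<in> N \<Longrightarrow> x w \<in> borel_measurable (expo_prod I)" "\<And>w c. w \<in> N \<Longrightarrow> 0 \<le> x w c"
  shows "all_moments (expo_prod I) (\<lambda>c. max 0 (MIN w\<in>N. c (e w) - x w c))"
proof -
  have F: "(\<lambda>c. max 0 (MIN w\<in>N. c (e w) - x w c)) \<in> borel_measurable (expo_prod I)"
    using N e by (intro borel_measurable_clip borel_measurable_diff measurable_expo_prod_component x) auto
  have G: "(\<lambda>c. max 0 (MIN w\<in>N. c (e w) - 0)) \<in> borel_measurable (expo_prod I)"
    using N e by (intro borel_measurable_clip borel_measurable_diff measurable_expo_prod_component) auto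
  have "all_moments (expo_prod I) (\<lambda>c. max 0 (MIN w\<in>N. c (e w) - 0))"
    unfolding all_moments_def
  proof safe
    fix p :: nat
    have "integrable (expo_prod I) (\<lambda>c. (max 0 (MIN w\<in>N. c (e w) - 0)) ^ p)" (is "integrable _ ?f")
    proof (cases "p = 0")
      case False
      show ?thesis
      proof (rule integrableI_nonneg)
        have "(\<integral>\<^sup>+c. ennreal (max 0 (MIN w\<in>N. c (e w) - 0) ^ p * 1) \<partial>expo_prod I) =
           (\<integral>\<^sup>+c. ennreal (fact p / real (card N) ^ p * (exp (- (\<Sum>w\<in>N. 0)) * 1)) \<partial>expo_prod I)"
          using False by (intro nn_integral_clip[OF I N e]) (auto simp: depends_on_def)
        then show "(\<integral>\<^sup>+c. ennreal (?f c) \<partial>expo_prod I) < \<infinity>"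
          by (simp add: expo_prod.emeasure_space_1)
      qed (use G in auto)
    qed simp
    then show "integrable (expo_prod I) (\<lambda>c. \<bar>max 0 (MIN w\<in>N. c (e w) - 0)\<bar> ^ p)" by simp
  qed (rule G)
  then show ?thesis
  proof (rule all_moments_dominated[OF _ F])
    fix c
    have "(MIN w\<in>N. c (e w) - x w c) \<le> (MIN w\<in>N. c (e w) - 0)"
    proof (rule Min.boundedI)
      fix a assume "a \<in> (\<lambda>w. c (e w) - 0) ` N"
      then obtain w where w: "w \<in> N" "a = c (e w)" by auto
      have "(MIN w\<in>N. c (e w) - x w c) \<le> c (e w) - x w c" using N w by (intro Min_le) auto
      then show "(MIN w\<in>N. c (e w) - x w c) \<le> a" using x(2)[OF w(1), of c] w by linarith
    qed (use N in auto)
    then show "\<bar>max 0 (MIN w\<in>N. c (e w) - x w c)\<bar> \<le> \<bar>max 0 (MIN w\<in>N. c (e w) - 0)\<bar>" by simp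
  qed
qed

lemma AE_expo_prod_nonneg:
  assumes "finite I"
  shows "AE c in expo_prod I. \<forall>i\<in>I. 0 \<le> c i"
proof -
  have "AE c in expo_prod I. 0 \<le> c i" if "i \<in> I" for i
    using AE_PiM_component[of I "\<lambda>_. expo" i] that AE_expo_nonneg expo.prob_space_axioms
    unfolding expo_prod_def by blast
  then show ?thesis using assms by (subst AE_finite_all) auto
qed

section \<open>Messages under exponential edge costs\<close>

abbreviation edge_costs :: "nat \<Rightarrow> (nat set \<Rightarrow> real) measure" where
  "edge_costs n \<equiv> expo_prod (complete_edges n)"

abbreviation edges_off :: "nat \<Rightarrow> nat \<Rightarrow> nat set set" where
  "edges_off n v \<equiv> {e\<in>complete_edges n. v \<notin> e}"

lemma depends_on_mono: "depends_on J f \<Longrightarrow> J \<subseteq> J' \<Longrightarrow> depends_on J' f"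
  unfolding depends_on_def by (meson subsetD)

lemma inj_on_star: "inj_on (\<lambda>w. {v,w}) N"
  by (auto simp: inj_on_def doubleton_eq_iff)

lemma all_moments_clip_min:
  assumes "N \<subseteq> {..<n}" "v < n" "v \<notin> N"
    and "\<And>w. w \<in> N \<Longrightarrow> x w \<in> borel_measurable (edge_costs n)" "\<And>w c. w \<in> N \<Longrightarrow> 0 \<le> x w c"
  shows "all_moments (edge_costs n) (\<lambda>c. clip_min c v N (\<lambda>w. x w c))"
proof (cases "N = {}")
  case True
  then show ?thesis unfolding clip_min_def by (simp add: expo_prod.all_moments_const)
next
  case False
  show ?thesis unfolding clip_min_def
  proof (rule all_moments_clip)
    show "finite N" using assms finite_subset by blast
    show "(\<lambda>w. {v,w}) ` N \<subseteq> complete_edges n" using assms by (auto simp: mem_complete_edges)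
    show "inj_on (\<lambda>w. {v,w}) N" by (rule inj_on_star)
  qed (use assms False finite_complete_edges in auto)
qed

lemma integral_clip_min:
  fixes h :: "(nat set \<Rightarrow> real) \<Rightarrow> real"
  assumes N: "N \<subseteq> {..<n}" "N \<noteq> {}" "v < n" "v \<notin> N" and p: "0 < p"
    and x: "\<And>w. w \<in> N \<Longrightarrow> x w \<in> borel_measurable (edge_costs n)" "\<And>w c. w \<in> N \<Longrightarrow> 0 \<le> x w c"
      "\<And>w. w \<in> N \<Longrightarrow> depends_on (edges_off n v) (x w)"
    and h: "h \<in> borel_measurable (edge_costs n)" "\<And>c. 0 \<le> h c" "depends_on (edges_off n v) h"
  shows "(\<integral>c. clip_min c v N (\<lambda>w. x w c) ^ p * h c \<partial>edge_costs n) =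
     fact p / real (card N) ^ p * (\<integral>c. exp (- (\<Sum>w\<in>N. x w c)) * h c \<partial>edge_costs n)"
proof -
  have sub: "edges_off n v \<subseteq> complete_edges n - (\<lambda>w. {v,w}) ` N" by auto
  show ?thesis unfolding clip_min_def
  proof (rule integral_clip[OF finite_complete_edges])
    show "finite N" using N finite_subset by blast
    show "(\<lambda>w. {v,w}) ` N \<subseteq> complete_edges n" using N by (auto simp: mem_complete_edges)
    show "inj_on (\<lambda>w. {v,w}) N" by (rule inj_on_star)
    show "depends_on (complete_edges n - (\<lambda>w. {v,w}) ` N) (x w)" if "w \<in> N" for w
      by (rule depends_on_mono[OF x(3)[OF that] sub])
    show "depends_on (complete_edges n - (\<lambda>w. {v,w}) ` N) h"
      by (rule depends_on_mono[OF h(3) sub])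
  qed (use N p x h in auto)
qed

lemma integral_clip_min_power:
  assumes N: "N \<subseteq> {..<n}" "N \<noteq> {}" "v < n" "v \<notin> N" and p: "0 < p"
    and x: "\<And>w. w \<in> N \<Longrightarrow> x w \<in> borel_measurable (edge_costs n)" "\<And>w c. w \<in> N \<Longrightarrow> 0 \<le> x w c"
      "\<And>w. w \<in> N \<Longrightarrow> depends_on (edges_off n v) (x w)"
  shows "(\<integral>c. clip_min c v N (\<lambda>w. x w c) ^ p \<partial>edge_costs n) =
     fact p / real (card N) ^ p * (\<integral>c. exp (- (\<Sum>w\<in>N. x w c)) \<partial>edge_costs n)"
  using integral_clip_min[OF assms, where h = "\<lambda>_. 1"] by (simp add: depends_on_def)

lemma all_moments_msg: "v < n \<Longrightarrow> v \<notin> P \<Longrightarrow> all_moments (edge_costs n) (\<lambda>c. msg n c k P v)"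
proof (induction k arbitrary: P v)
  case 0
  show ?case by (simp add: expo_prod.all_moments_const)
next
  case (Suc k)
  show ?case unfolding msg.simps
    by (rule all_moments_clip_min) (use Suc in \<open>auto intro: all_moments_measurable msg_nonneg\<close>)
qed

lemma depends_on_msg:
  "v < n \<Longrightarrow> v \<notin> P \<Longrightarrow> depends_on {e\<in>complete_edges n. e \<inter> P = {}} (\<lambda>c. msg n c k P v)"
  unfolding depends_on_def by (auto intro!: msg_cong)

lemma depends_on_msg':
  "v < n \<Longrightarrow> v \<notin> P \<Longrightarrow> u \<in> P \<Longrightarrow> depends_on (edges_off n u) (\<lambda>c. msg n c k P v)"
  by (rule depends_on_mono[OF depends_on_msg]) auto

definition total_msg :: "nat \<Rightarrow> (nat set \<Rightarrow> real) \<Rightarrow> nat \<Rightarrow> nat set \<Rightarrow> real" where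
  "total_msg n c k P = (\<Sum>w\<in>{..<n} - P. msg n c k P w)"

lemma total_msg_nonneg: "0 \<le> total_msg n c k P"
  by (simp add: total_msg_def sum_nonneg msg_nonneg)

lemma all_moments_total_msg: "all_moments (edge_costs n) (\<lambda>c. total_msg n c k P)"
  unfolding total_msg_def by (intro expo_prod.all_moments_sum all_moments_msg) auto

lemma card_rest_insert:
  assumes "P \<subseteq> {..<n}" "v < n" "v \<notin> P"
  shows "card ({..<n} - insert v P) = n - card P - 1"
proof -
  have "finite P" using assms finite_subset by blast
  then show ?thesis using assms by (subst card_Diff_subset) auto
qed

text \<open>All messages entering \<open>v\<close> avoid \<open>v\<close>, so they and
  \<open>h\<close> are independent of the star of \<open>v\<close>, which is integrated out. The
  weight \<open>h\<close> will be a second message whose removed set contains \<open>v\<close>; this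
  gives mixed moments.\<close>

lemma integral_msg_Suc:
  fixes h :: "(nat set \<Rightarrow> real) \<Rightarrow> real"
  assumes P: "P \<subseteq> {..<n}" "v < n" "v \<notin> P" "card P + 2 \<le> n" and p: "0 < p"
    and h: "h \<in> borel_measurable (edge_costs n)" "\<And>c. 0 \<le> h c" "depends_on (edges_off n v) h"
  shows "(\<integral>c. msg n c (Suc k) P v ^ p * h c \<partial>edge_costs n) =
     fact p / real (n - card P - 1) ^ p * (\<integral>c. exp (- total_msg n c k (insert v P)) * h c \<partial>edge_costs n)"
proof -
  have "card ({..<n} - insert v P) \<noteq> 0" using card_rest_insert[OF P(1-3)] P(4) by simp
  then have ne: "{..<n} - insert v P \<noteq> {}" by (metis card.empty)
  show ?thesis unfolding msg.simps card_rest_insert[OF P(1-3), symmetric] total_msg_def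
    by (rule integral_clip_min)
      (use P p h ne in \<open>auto intro: all_moments_measurable all_moments_msg msg_nonneg depends_on_msg'\<close>)
qed

lemma integral_msg_power:
  assumes P: "P \<subseteq> {..<n}" "v < n" "v \<notin> P" "card P + 2 \<le> n" and p: "0 < p"
  shows "(\<integral>c. msg n c (Suc k) P v ^ p \<partial>edge_costs n) =
     fact p / real (n - card P - 1) ^ p * (\<integral>c. exp (- total_msg n c k (insert v P)) \<partial>edge_costs n)"
  using integral_msg_Suc[OF assms, of "\<lambda>_. 1" k] by (simp add: depends_on_def)

lemma integral_exp_minus_le_1:
  fixes f :: "(nat set \<Rightarrow> real) \<Rightarrow> real"
  assumes "f \<in> borel_measurable (edge_costs n)" "\<And>c. 0 \<le> f c"
  shows "(\<integral>c. exp (- f c) \<partial>edge_costs n) \<le> 1"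
proof -
  have "(\<integral>c. exp (- f c) \<partial>edge_costs n) \<le> (\<integral>c. 1 \<partial>edge_costs n)"
    using assms by (intro integral_mono all_moments_integrable expo_prod.all_moments_exp_minus expo_prod.all_moments_const) auto
  then show ?thesis by (simp add: expo_prod.prob_space)
qed

lemma integral_msg_power_le:
  assumes P: "P \<subseteq> {..<n}" "v < n" "v \<notin> P" "card P + 2 \<le> n" and p: "0 < p"
  shows "(\<integral>c. msg n c k P v ^ p \<partial>edge_costs n) \<le> fact p / real (n - card P - 1) ^ p"
proof (cases k)
  case 0
  then show ?thesis using p by (simp add: zero_power)
next
  case (Suc j)
  have "(\<integral>c. exp (- total_msg n c j (insert v P)) \<partial>edge_costs n) \<le> 1"
    by (intro integral_exp_minus_le_1 all_moments_measurable all_moments_total_msg total_msg_nonneg)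
  then show ?thesis unfolding Suc integral_msg_power[OF assms]
    using mult_left_mono[of _ 1 "fact p / real (n - card P - 1) ^ p"] by auto
qed

section \<open>Stability of clipped minima\<close>

lemma power_add_le:
  fixes a b :: real
  assumes "0 \<le> a" "0 \<le> b" "0 < p"
  shows "a ^ p + b ^ p \<le> (a + b) ^ p"
  using assms(3)
proof (induction p rule: nat_induct_non_zero)
  case (Suc p)
  have "a ^ Suc p + b ^ Suc p \<le> (a + b) * (a ^ p + b ^ p)"
    using assms by (simp add: algebra_simps)
  also have "\<dots> \<le> (a + b) * (a + b) ^ p" using Suc assms by (intro mult_left_mono) auto
  finally show ?case by simp
qed simp

text \<open>A moment of a difference is replaced by a difference of moments, and for the latter
  there are exact formulas.\<close>

lemma abs_diff_power_le:
  fixes a b :: real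
  assumes "B \<le> a" "a \<le> A" "B \<le> b" "b \<le> A" "0 \<le> B" "0 < p"
  shows "\<bar>a - b\<bar> ^ p \<le> A ^ p - B ^ p"
proof -
  have "\<bar>a - b\<bar> ^ p \<le> (A - B) ^ p" using assms by (intro power_mono) auto
  also have "\<dots> \<le> A ^ p - B ^ p" using power_add_le[of "A - B" B p] assms by simp
  finally show ?thesis .
qed

lemma exp_minus_diff_le:
  fixes a b :: real
  assumes "0 \<le> a" "a \<le> b"
  shows "exp (- a) - exp (- b) \<le> b - a"
proof -
  have "exp (- b) = exp (- a) * exp (- (b - a))" by (simp add: exp_add[symmetric])
  then have "exp (- a) - exp (- b) = exp (- a) * (1 - exp (- (b - a)))" by (simp add: algebra_simps)
  also have "\<dots> \<le> 1 * (b - a)"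
  proof (rule mult_mono)
    show "1 - exp (- (b - a)) \<le> b - a" using exp_ge_add_one_self[of "- (b - a)"] by linarith
  qed (use assms in auto)
  finally show ?thesis by simp
qed

lemma abs_exp_minus_diff_le:
  fixes a b :: real
  assumes "0 \<le> a" "0 \<le> b"
  shows "\<bar>exp (- a) - exp (- b)\<bar> \<le> \<bar>a - b\<bar>"
  using exp_minus_diff_le[of a b] exp_minus_diff_le[of b a] assms
  by (cases "a \<le> b") (auto simp: abs_if)

text \<open>The difference is squeezed between the minima for the pointwise minimum and maximum
  of the two message families.\<close>

lemma integral_clip_min_diff:
  assumes N: "N \<subseteq> {..<n}" "N \<noteq> {}" "v < n" "v \<notin> N" and p: "0 < p"
    and x: "\<And>w. w \<in> N \<Longrightarrow> all_moments (edge_costs n) (x w)" "\<And>w c. w \<in> N \<Longrightarrow> 0 \<le> x w c"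
      "\<And>w. w \<in> N \<Longrightarrow> depends_on (edges_off n v) (x w)"
    and y: "\<And>w. w \<in> N \<Longrightarrow> all_moments (edge_costs n) (y w)" "\<And>w c. w \<in> N \<Longrightarrow> 0 \<le> y w c"
      "\<And>w. w \<in> N \<Longrightarrow> depends_on (edges_off n v) (y w)"
  shows "(\<integral>c. \<bar>clip_min c v N (\<lambda>w. x w c) - clip_min c v N (\<lambda>w. y w c)\<bar> ^ p \<partial>edge_costs n) \<le>
     fact p / real (card N) ^ p * (\<Sum>w\<in>N. \<integral>c. \<bar>x w c - y w c\<bar> \<partial>edge_costs n)"
proof -
  let ?lo = "\<lambda>w c. min (x w c) (y w c)" and ?hi = "\<lambda>w c. max (x w c) (y w c)"
  let ?C = "\<lambda>x c. clip_min c v N (\<lambda>w. x w c)"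
  let ?S = "\<lambda>x c. \<Sum>w\<in>N. x w c :: real"
  have finN: "finite N" using N finite_subset by blast
  have meas: "x w \<in> borel_measurable (edge_costs n)" "y w \<in> borel_measurable (edge_costs n)" if "w \<in> N" for w
    using that x y by (auto intro: all_moments_measurable)
  have meas': "?lo w \<in> borel_measurable (edge_costs n)" "?hi w \<in> borel_measurable (edge_costs n)" if "w \<in> N" for w
    using meas[OF that] by measurable
  have am: "all_moments (edge_costs n) (?C z)" if "z \<in> {x, y, ?lo, ?hi}" for z
    using that N x(2) y(2) meas meas' by (intro all_moments_clip_min) (auto simp: le_max_iff_disj)
  have dep: "depends_on (edges_off n v) (?lo w)" "depends_on (edges_off n v) (?hi w)" if "w \<in> N" for w
  proof -
    have 1: "x w c = x w c' \<and> y w c = y w c'" if "\<forall>i\<in>edges_off n v. c i = c' i" for c c'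
      using that x(3)[OF \<open>w \<in> N\<close>] y(3)[OF \<open>w \<in> N\<close>] unfolding depends_on_def by blast
    show "depends_on (edges_off n v) (?lo w)" "depends_on (edges_off n v) (?hi w)"
      unfolding depends_on_def by (intro allI impI, drule 1, simp)+
  qed
  have int_p: "integrable (edge_costs n) (\<lambda>c. ?C z c ^ p)" if "z \<in> {x, y, ?lo, ?hi}" for z
    by (rule all_moments_integrable[OF expo_prod.all_moments_power[OF am[OF that]]])
  have int_S: "integrable (edge_costs n) (\<lambda>c. \<bar>x w c - y w c\<bar>)" if "w \<in> N" for w
    using that x y by (intro all_moments_intros) auto
  have int_e: "integrable (edge_costs n) (\<lambda>c. exp (- ?S z c))" if "z \<in> {?lo, ?hi}" for z
    using that meas' x(2) y(2)
    by (intro all_moments_integrable expo_prod.all_moments_exp_minus borel_measurable_sum)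
       (auto intro!: sum_nonneg simp: le_max_iff_disj)
  have "(\<integral>c. \<bar>?C x c - ?C y c\<bar> ^ p \<partial>edge_costs n) \<le> (\<integral>c. ?C ?lo c ^ p - ?C ?hi c ^ p \<partial>edge_costs n)"
  proof (rule integral_mono)
    show "integrable (edge_costs n) (\<lambda>c. \<bar>?C x c - ?C y c\<bar> ^ p)"
      by (intro all_moments_intros am) auto
    show "integrable (edge_costs n) (\<lambda>c. ?C ?lo c ^ p - ?C ?hi c ^ p)"
      by (intro Bochner_Integration.integrable_diff int_p) auto
    fix c
    show "\<bar>?C x c - ?C y c\<bar> ^ p \<le> ?C ?lo c ^ p - ?C ?hi c ^ p"
      using finN N(2) p by (intro abs_diff_power_le clip_min_antimono clip_min_nonneg) auto
  qed
  also have "\<dots> = (\<integral>c. ?C ?lo c ^ p \<partial>edge_costs n) - (\<integral>c. ?C ?hi c ^ p \<partial>edge_costs n)"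
    by (intro Bochner_Integration.integral_diff int_p) auto
  also have "(\<integral>c. ?C ?lo c ^ p \<partial>edge_costs n) = fact p / real (card N) ^ p * (\<integral>c. exp (- ?S ?lo c) \<partial>edge_costs n)"
    by (rule integral_clip_min_power[OF N p]) (use meas' x(2) y(2) dep in auto)
  also have "(\<integral>c. ?C ?hi c ^ p \<partial>edge_costs n) = fact p / real (card N) ^ p * (\<integral>c. exp (- ?S ?hi c) \<partial>edge_costs n)"
    by (rule integral_clip_min_power[OF N p]) (use meas' x(2) y(2) dep in \<open>auto simp: le_max_iff_disj\<close>)
  also have "fact p / real (card N) ^ p * (\<integral>c. exp (- ?S ?lo c) \<partial>edge_costs n) -
      fact p / real (card N) ^ p * (\<integral>c. exp (- ?S ?hi c) \<partial>edge_costs n) =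
      fact p / real (card N) ^ p * (\<integral>c. exp (- ?S ?lo c) - exp (- ?S ?hi c) \<partial>edge_costs n)"
    by (subst Bochner_Integration.integral_diff) (use int_e in \<open>auto simp: algebra_simps\<close>)
  also have "\<dots> \<le> fact p / real (card N) ^ p * (\<integral>c. (\<Sum>w\<in>N. \<bar>x w c - y w c\<bar>) \<partial>edge_costs n)"
  proof (intro mult_left_mono integral_mono)
    fix c
    have "exp (- ?S ?lo c) - exp (- ?S ?hi c) \<le> ?S ?hi c - ?S ?lo c"
      using x(2) y(2) by (intro exp_minus_diff_le sum_nonneg sum_mono) auto
    also have "\<dots> = (\<Sum>w\<in>N. \<bar>x w c - y w c\<bar>)"
      unfolding sum_subtractf[symmetric] by (intro sum.cong) auto
    finally show "exp (- ?S ?lo c) - exp (- ?S ?hi c) \<le> (\<Sum>w\<in>N. \<bar>x w c - y w c\<bar>)" .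
  qed (use int_e int_S in auto)
  also have "(\<integral>c. (\<Sum>w\<in>N. \<bar>x w c - y w c\<bar>) \<partial>edge_costs n) = (\<Sum>w\<in>N. \<integral>c. \<bar>x w c - y w c\<bar> \<partial>edge_costs n)"
    by (rule Bochner_Integration.integral_sum) (rule int_S)
  finally show ?thesis .
qed

text \<open>Dropping a neighbour raises the minimum, so again a difference of exact moments remains.
  One part of it is the change from \<open>card N\<close> to \<open>card N - 1\<close> competitors,
  the other the disappearance of the message of \<open>b\<close> from the exponent.\<close>

lemma integral_clip_min_remove:
  assumes N: "N \<subseteq> {..<n}" "2 \<le> card N" "v < n" "v \<notin> N" and b: "b \<in> N" and p: "0 < p"
    and x: "\<And>w. w \<in> N \<Longrightarrow> all_moments (edge_costs n) (x w)" "\<And>w c. w \<in> N \<Longrightarrow> 0 \<le> x w c"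
      "\<And>w. w \<in> N \<Longrightarrow> depends_on (edges_off n v) (x w)"
  shows "(\<integral>c. \<bar>clip_min c v N (\<lambda>w. x w c) - clip_min c v (N - {b}) (\<lambda>w. x w c)\<bar> ^ p \<partial>edge_costs n) \<le>
     fact p * (1 / (real (card N) - 1) ^ p - 1 / real (card N) ^ p +
       (\<integral>c. x b c \<partial>edge_costs n) / real (card N) ^ p)"
proof -
  let ?C = "\<lambda>N c. clip_min c v N (\<lambda>w. x w c)" and ?m = "real (card N)"
  let ?N = "N - {b}"
  have finN: "finite N" using N finite_subset by blast
  have card': "real (card ?N) = ?m - 1" using finN b N(2) by (simp add: of_nat_diff)
  have "card ?N \<noteq> 0" using finN b N(2) by simp
  then have "?N \<noteq> {}" by (metis card.empty)
  then have ne: "?N \<noteq> {}" "N \<noteq> {}" by auto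
  have meas: "x w \<in> borel_measurable (edge_costs n)" if "w \<in> N" for w
    using that x by (auto intro: all_moments_measurable)
  have am: "all_moments (edge_costs n) (?C A)" if "A \<subseteq> N" for A
    using that N meas x by (intro all_moments_clip_min) auto
  have int_e: "integrable (edge_costs n) (\<lambda>c. exp (- (\<Sum>w\<in>A. x w c)))" if "A \<subseteq> N" for A
    using that meas x(2)
    by (intro all_moments_integrable expo_prod.all_moments_exp_minus borel_measurable_sum)
       (auto intro!: sum_nonneg)
  have int_b: "integrable (edge_costs n) (x b)" using x b by (intro all_moments_integrable) auto
  have int_p: "integrable (edge_costs n) (\<lambda>c. ?C A c ^ p)" if "A \<subseteq> N" for A
    by (rule all_moments_integrable[OF expo_prod.all_moments_power[OF am[OF that]]])
  have "(\<integral>c. \<bar>?C N c - ?C ?N c\<bar> ^ p \<partial>edge_costs n) \<le> (\<integral>c. ?C ?N c ^ p - ?C N c ^ p \<partial>edge_costs n)"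
  proof (rule integral_mono)
    show "integrable (edge_costs n) (\<lambda>c. \<bar>?C N c - ?C ?N c\<bar> ^ p)"
      by (intro all_moments_intros am) auto
    show "integrable (edge_costs n) (\<lambda>c. ?C ?N c ^ p - ?C N c ^ p)"
      by (intro Bochner_Integration.integrable_diff int_p) auto
    fix c
    have "?C N c \<le> ?C ?N c" using finN ne by (intro clip_min_subset) auto
    then show "\<bar>?C N c - ?C ?N c\<bar> ^ p \<le> ?C ?N c ^ p - ?C N c ^ p"
      using p by (intro abs_diff_power_le clip_min_nonneg) auto
  qed
  also have "\<dots> = (\<integral>c. ?C ?N c ^ p \<partial>edge_costs n) - (\<integral>c. ?C N c ^ p \<partial>edge_costs n)"
    by (intro Bochner_Integration.integral_diff int_p) auto
  also have "(\<integral>c. ?C ?N c ^ p \<partial>edge_costs n) =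
      fact p / (?m - 1) ^ p * (\<integral>c. exp (- (\<Sum>w\<in>?N. x w c)) \<partial>edge_costs n)"
    unfolding card'[symmetric] by (rule integral_clip_min_power[OF _ ne(1) _ _ p]) (use N meas x in auto)
  also have "(\<integral>c. ?C N c ^ p \<partial>edge_costs n) =
      fact p / ?m ^ p * (\<integral>c. exp (- (\<Sum>w\<in>N. x w c)) \<partial>edge_costs n)"
    by (rule integral_clip_min_power[OF _ ne(2) _ _ p]) (use N meas x in auto)
  also have "fact p / (?m - 1) ^ p * (\<integral>c. exp (- (\<Sum>w\<in>?N. x w c)) \<partial>edge_costs n) -
      fact p / ?m ^ p * (\<integral>c. exp (- (\<Sum>w\<in>N. x w c)) \<partial>edge_costs n) =
      (\<integral>c. fact p / (?m - 1) ^ p * exp (- (\<Sum>w\<in>?N. x w c)) - fact p / ?m ^ p * exp (- (\<Sum>w\<in>N. x w c)) \<partial>edge_costs n)"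
    using int_e by (subst Bochner_Integration.integral_diff) auto
  also have "\<dots> \<le> (\<integral>c. fact p * (1 / (?m - 1) ^ p - 1 / ?m ^ p) + fact p / ?m ^ p * x b c \<partial>edge_costs n)"
  proof (rule integral_mono)
    fix c
    define s where "s = (\<Sum>w\<in>?N. x w c)"
    have s: "0 \<le> s" unfolding s_def using x(2) by (intro sum_nonneg) auto
    have S: "(\<Sum>w\<in>N. x w c) = x b c + s" unfolding s_def using finN b by (rule sum.remove)
    have xb: "0 \<le> x b c" using x(2) b by auto
    have m: "2 \<le> ?m" using N(2) by simp
    have "1 / ?m ^ p \<le> 1 / (?m - 1) ^ p" using m by (intro divide_left_mono power_mono) auto
    then have "exp (- s) * (1 / (?m - 1) ^ p - 1 / ?m ^ p) \<le> 1 * (1 / (?m - 1) ^ p - 1 / ?m ^ p)"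
      using s by (intro mult_right_mono) auto
    moreover have "(exp (- s) - exp (- (x b c + s))) / ?m ^ p \<le> x b c / ?m ^ p"
      using exp_minus_diff_le[of s "x b c + s"] s xb by (intro divide_right_mono) auto
    ultimately have "exp (- s) / (?m - 1) ^ p - exp (- (x b c + s)) / ?m ^ p \<le>
        (1 / (?m - 1) ^ p - 1 / ?m ^ p) + x b c / ?m ^ p"
      by (simp add: algebra_simps diff_divide_distrib)
    then have "fact p * (exp (- s) / (?m - 1) ^ p - exp (- (x b c + s)) / ?m ^ p) \<le>
        fact p * ((1 / (?m - 1) ^ p - 1 / ?m ^ p) + x b c / ?m ^ p)"
      by (intro mult_left_mono) auto
    then show "fact p / (?m - 1) ^ p * exp (- (\<Sum>w\<in>?N. x w c)) - fact p / ?m ^ p * exp (- (\<Sum>w\<in>N. x w c))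
       \<le> fact p * (1 / (?m - 1) ^ p - 1 / ?m ^ p) + fact p / ?m ^ p * x b c"
      unfolding S s_def[symmetric] by (simp add: algebra_simps)
  qed (use int_e int_b in \<open>auto intro!: Bochner_Integration.integrable_diff Bochner_Integration.integrable_add\<close>)
  also have "\<dots> = fact p * (1 / (?m - 1) ^ p - 1 / ?m ^ p) + fact p / ?m ^ p * (\<integral>c. x b c \<partial>edge_costs n)"
    using int_b by (simp add: expo_prod.prob_space)
  finally show ?thesis by (simp add: algebra_simps)
qed

section \<open>Concentration of messages\<close>

text \<open>Removing one more vertex \<open>b\<close> has two effects at \<open>v\<close>:
  \<open>b\<close> is no longer a neighbour (the part \<open>f\<close>), and the messages of the
  other neighbours change (the part \<open>g\<close>). For every \<open>p\<close>, the part
  \<open>g\<close> is bounded by first moments of message changes one level down. Here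
  \<open>m\<close> is the number of neighbours of \<open>v\<close>.\<close>

lemma integral_msg_insert_diff_parts:
  assumes P: "P \<subseteq> {..<n}" and v: "v < n" "v \<notin> P" and b: "b < n" "b \<notin> P" "v \<noteq> b"
    and n: "card P + 4 \<le> n" and p: "0 < p" and m: "m = real n - real (card P) - 1"
    and I: "\<And>w. w \<in> {..<n} - insert v P - {b} \<Longrightarrow>
       (\<integral>c. \<bar>msg n c k (insert v P) w - msg n c k (insert b (insert v P)) w\<bar> \<partial>edge_costs n) \<le> d"
  obtains f g where "\<And>c. msg n c (Suc k) P v - msg n c (Suc k) (insert b P) v = f c + g c"
    "all_moments (edge_costs n) f" "all_moments (edge_costs n) g"
    "(\<integral>c. \<bar>f c\<bar> ^ p \<partial>edge_costs n) \<le> fact p * (1 / (m - 1) ^ p - 1 / m ^ p + 1 / (m - 1) / m ^ p)"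
    "(\<integral>c. \<bar>g c\<bar> ^ p \<partial>edge_costs n) \<le> fact p / (m - 1) ^ p * ((m - 1) * d)"
proof -
  define N where "N = {..<n} - insert v P"
  define x where "x = (\<lambda>w c. msg n c k (insert v P) w)"
  define y where "y = (\<lambda>w c. msg n c k (insert b (insert v P)) w)"
  define f where "f = (\<lambda>c. clip_min c v N (\<lambda>w. x w c) - clip_min c v (N - {b}) (\<lambda>w. x w c))"
  define g where "g = (\<lambda>c. clip_min c v (N - {b}) (\<lambda>w. x w c) - clip_min c v (N - {b}) (\<lambda>w. y w c))"
  have finP: "finite P" using P finite_subset by blast
  have cardN: "card N = n - card P - 1" unfolding N_def by (rule card_rest_insert[OF P v])
  then have rN: "real (card N) = m" using n m by (simp add: of_nat_diff)
  have bN: "b \<in> N" using b by (auto simp: N_def)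
  have rN': "real (card (N - {b})) = m - 1"
    using bN cardN n m by (simp add: N_def of_nat_diff)
  have N2: "2 \<le> card N" using cardN n by simp
  have "card (N - {b}) \<noteq> 0" using bN N2 by (simp add: N_def)
  then have ne: "N - {b} \<noteq> {}" by (metis card.empty)
  have "N - {b} = {..<n} - insert v (insert b P)" by (auto simp: N_def)
  then have eq: "msg n c (Suc k) P v - msg n c (Suc k) (insert b P) v = f c + g c" for c
    by (simp add: f_def g_def N_def x_def y_def insert_commute)
  have x: "all_moments (edge_costs n) (x w)" "0 \<le> x w c" "depends_on (edges_off n v) (x w)"
    if "w \<in> N" for w c
    using that by (auto simp: N_def x_def intro!: all_moments_msg msg_nonneg depends_on_msg')
  have y: "all_moments (edge_costs n) (y w)" "0 \<le> y w c" "depends_on (edges_off n v) (y w)"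
    if "w \<in> N - {b}" for w c
    using that by (auto simp: N_def y_def intro!: all_moments_msg msg_nonneg depends_on_msg')
  have N: "N \<subseteq> {..<n}" "v \<notin> N" by (auto simp: N_def)
  have amx: "all_moments (edge_costs n) (\<lambda>c. clip_min c v A (\<lambda>w. x w c))" if "A \<subseteq> N" for A
    using that N v x by (intro all_moments_clip_min all_moments_measurable) auto
  have amy: "all_moments (edge_costs n) (\<lambda>c. clip_min c v (N - {b}) (\<lambda>w. y w c))"
    using N v y by (intro all_moments_clip_min all_moments_measurable) auto
  have m2: "2 \<le> m" using n m by linarith
  have xb: "(\<integral>c. x b c \<partial>edge_costs n) \<le> 1 / (m - 1)"
  proof -
    have "(\<integral>c. x b c ^ 1 \<partial>edge_costs n) \<le> fact 1 / real (n - card (insert v P) - 1) ^ 1"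
      unfolding x_def using P v b n finP by (intro integral_msg_power_le) auto
    also have "real (n - card (insert v P) - 1) = m - 1" using v n finP m by (simp add: of_nat_diff)
    finally show ?thesis by simp
  qed
  have "(\<integral>c. \<bar>f c\<bar> ^ p \<partial>edge_costs n) \<le>
      fact p * (1 / (m - 1) ^ p - 1 / m ^ p + (\<integral>c. x b c \<partial>edge_costs n) / m ^ p)"
    unfolding f_def rN[symmetric]
    by (rule integral_clip_min_remove[OF N(1) N2 v(1) N(2) bN p]) (use x in auto)
  also have "\<dots> \<le> fact p * (1 / (m - 1) ^ p - 1 / m ^ p + 1 / (m - 1) / m ^ p)"
    using xb m2 by (intro mult_left_mono add_left_mono divide_right_mono) auto
  finally have F: "(\<integral>c. \<bar>f c\<bar> ^ p \<partial>edge_costs n) \<le> fact p * (1 / (m - 1) ^ p - 1 / m ^ p + 1 / (m - 1) / m ^ p)" .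
  have "(\<integral>c. \<bar>g c\<bar> ^ p \<partial>edge_costs n) \<le>
     fact p / (m - 1) ^ p * (\<Sum>w\<in>N - {b}. \<integral>c. \<bar>x w c - y w c\<bar> \<partial>edge_costs n)"
    unfolding g_def rN'[symmetric]
    by (rule integral_clip_min_diff[OF _ ne v(1) _ p]) (use N x y in auto)
  also have "\<dots> \<le> fact p / (m - 1) ^ p * (\<Sum>w\<in>N - {b}. d)"
    using m2 I by (intro mult_left_mono sum_mono) (auto simp: x_def y_def N_def)
  also have "(\<Sum>w\<in>N - {b}. d) = (m - 1) * d" by (simp add: rN')
  finally have G: "(\<integral>c. \<bar>g c\<bar> ^ p \<partial>edge_costs n) \<le> fact p / (m - 1) ^ p * ((m - 1) * d)" .
  show ?thesis
  proof (rule that[OF eq _ _ F G])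
    show "all_moments (edge_costs n) f" unfolding f_def by (intro expo_prod.all_moments_diff amx) auto
    show "all_moments (edge_costs n) g" unfolding g_def by (intro expo_prod.all_moments_diff amx amy) auto
  qed
qed

text \<open>Errors accumulate additively: \<open>g\<close> passes on the bound of the previous level
  with factor 1, since \<open>m - 1\<close> neighbours share the prefactor
  \<open>1 / (m - 1)\<close>, and \<open>f\<close> adds \<open>2 / ((m - 1) * m)\<close>, at most
  8/n^2. A message has mean of order at most 1/n, so its change is of lower order.\<close>

lemma integral_msg_insert_diff:
  assumes "P \<subseteq> {..<n}" "v < n" "v \<notin> P" "b < n" "b \<notin> P" "v \<noteq> b" "2 * (card P + k) + 6 \<le> n"
  shows "(\<integral>c. \<bar>msg n c k P v - msg n c k (insert b P) v\<bar> \<partial>edge_costs n) \<le> 8 * real k / real n ^ 2"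
  using assms
proof (induction k arbitrary: P v)
  case 0
  then show ?case by simp
next
  case (Suc k)
  have finP: "finite P" using Suc.prems finite_subset by blast
  define m where "m = real n - real (card P) - 1"
  have n: "0 < real n" "real n / 2 \<le> m - 1" using Suc.prems(7) by (auto simp: m_def)
  have "(\<integral>c. \<bar>msg n c k (insert v P) w - msg n c k (insert b (insert v P)) w\<bar> \<partial>edge_costs n) \<le> 8 * real k / real n ^ 2"
    if "w \<in> {..<n} - insert v P - {b}" for w
    using that Suc.prems finP by (intro Suc.IH) auto
  then obtain f g where fg: "\<And>c. msg n c (Suc k) P v - msg n c (Suc k) (insert b P) v = f c + g c"
    "all_moments (edge_costs n) f" "all_moments (edge_costs n) g"
    "(\<integral>c. \<bar>f c\<bar> ^ 1 \<partial>edge_costs n) \<le> fact 1 * (1 / (m - 1) ^ 1 - 1 / m ^ 1 + 1 / (m - 1) / m ^ 1)"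
    "(\<integral>c. \<bar>g c\<bar> ^ 1 \<partial>edge_costs n) \<le> fact 1 / (m - 1) ^ 1 * ((m - 1) * (8 * real k / real n ^ 2))"
    using integral_msg_insert_diff_parts[OF Suc.prems(1-6) _ zero_less_one m_def, of k "8 * real k / real n ^ 2"] Suc.prems(7)
    by auto
  have "(\<integral>c. \<bar>f c + g c\<bar> \<partial>edge_costs n) \<le> (\<integral>c. \<bar>f c\<bar> + \<bar>g c\<bar> \<partial>edge_costs n)"
    using fg by (intro integral_mono all_moments_intros) auto
  also have "\<dots> = (\<integral>c. \<bar>f c\<bar> \<partial>edge_costs n) + (\<integral>c. \<bar>g c\<bar> \<partial>edge_costs n)"
    using fg by (intro Bochner_Integration.integral_add all_moments_intros)
  also have "\<dots> \<le> (1 / (m - 1) - 1 / m + 1 / (m - 1) / m) + 8 * real k / real n ^ 2"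
  proof -
    have "m \<noteq> 1" using n by auto
    then show ?thesis using fg(4,5) by simp
  qed
  also have "1 / (m - 1) - 1 / m + 1 / (m - 1) / m = 2 / ((m - 1) * m)" using n by (simp add: field_simps)
  also have "\<dots> \<le> 2 / ((real n / 2) * (real n / 2))"
    using n by (intro divide_left_mono mult_mono) auto
  also have "\<dots> + 8 * real k / real n ^ 2 = 8 * real (Suc k) / real n ^ 2"
    using n by (simp add: field_simps power2_eq_square)
  finally show ?case unfolding fg(1) by simp
qed

text \<open>No second induction: the splitting bounds the second moment of the change by the first
  moment one level down and gains another factor 1/n. With \<open>k = Suc j\<close> the parts
  contribute 48/n^3 and 32 j/n^3, and squaring a sum of two doubles them.\<close>

lemma integral_msg_insert_diff_sq:
  assumes "P \<subseteq> {..<n}" "v < n" "v \<notin> P" "b < n" "b \<notin> P" "v \<noteq> b" "2 * (card P + k) + 6 \<le> n"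
  shows "(\<integral>c. (msg n c k P v - msg n c k (insert b P) v)\<^sup>2 \<partial>edge_costs n) \<le> 96 * real k / real n ^ 3"
proof (cases k)
  case 0
  then show ?thesis by simp
next
  case (Suc j)
  have finP: "finite P" using assms finite_subset by blast
  define m where "m = real n - real (card P) - 1"
  have n: "0 < real n" "real n / 2 \<le> m - 1" "real n / 2 \<le> m" using assms(7) Suc by (auto simp: m_def)
  have "(\<integral>c. \<bar>msg n c j (insert v P) w - msg n c j (insert b (insert v P)) w\<bar> \<partial>edge_costs n) \<le> 8 * real j / real n ^ 2"
    if "w \<in> {..<n} - insert v P - {b}" for w
    using that assms finP Suc by (intro integral_msg_insert_diff) auto
  then obtain f g where fg: "\<And>c. msg n c (Suc j) P v - msg n c (Suc j) (insert b P) v = f c + g c"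
    "all_moments (edge_costs n) f" "all_moments (edge_costs n) g"
    "(\<integral>c. \<bar>f c\<bar> ^ 2 \<partial>edge_costs n) \<le> fact 2 * (1 / (m - 1) ^ 2 - 1 / m ^ 2 + 1 / (m - 1) / m ^ 2)"
    "(\<integral>c. \<bar>g c\<bar> ^ 2 \<partial>edge_costs n) \<le> fact 2 / (m - 1) ^ 2 * ((m - 1) * (8 * real j / real n ^ 2))"
    using integral_msg_insert_diff_parts[OF assms(1-6) _ pos2 m_def, of j "8 * real j / real n ^ 2"] assms(7) Suc
    by auto
  have pw: "(real n / 2) ^ 3 \<le> (m - 1)\<^sup>2 * m" "(real n / 2) ^ 3 \<le> (m - 1) * m\<^sup>2"
  proof -
    have "(real n / 2)\<^sup>2 * (real n / 2) \<le> (m - 1)\<^sup>2 * m"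
      using n by (intro mult_mono power_mono) auto
    then show "(real n / 2) ^ 3 \<le> (m - 1)\<^sup>2 * m" by (simp add: power2_eq_square power3_eq_cube)
    have "(real n / 2) * (real n / 2)\<^sup>2 \<le> (m - 1) * m\<^sup>2"
      using n by (intro mult_mono power_mono) auto
    then show "(real n / 2) ^ 3 \<le> (m - 1) * m\<^sup>2" by (simp add: power2_eq_square power3_eq_cube)
  qed
  have n3: "0 < (real n / 2) ^ 3" using n by simp
  have "1 / (m - 1) ^ 2 - 1 / m ^ 2 = (2 * m - 1) / ((m - 1)\<^sup>2 * m\<^sup>2)"
  proof -
    have "1 / (m - 1) ^ 2 - 1 / m ^ 2 = (m\<^sup>2 - (m - 1)\<^sup>2) / ((m - 1)\<^sup>2 * m\<^sup>2)"
      using n by (simp add: diff_frac_eq)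
    also have "m\<^sup>2 - (m - 1)\<^sup>2 = 2 * m - 1" by (simp add: power2_eq_square algebra_simps)
    finally show ?thesis .
  qed
  also have "\<dots> \<le> (2 * m) / ((m - 1)\<^sup>2 * m\<^sup>2)" by (intro divide_right_mono) auto
  also have "\<dots> = 2 / ((m - 1)\<^sup>2 * m)"
  proof -
    have "(2 * m) / (A * m\<^sup>2) = 2 / (A * m)" for A using n by (simp add: power2_eq_square)
    then show ?thesis .
  qed
  also have "\<dots> \<le> 2 / (real n / 2) ^ 3"
    by (rule frac_le[OF _ _ n3 pw(1)]) auto
  finally have 1: "1 / (m - 1) ^ 2 - 1 / m ^ 2 \<le> 16 / real n ^ 3" by (simp add: power_divide)
  have "1 / (m - 1) / m ^ 2 \<le> 1 / (real n / 2) ^ 3"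
    unfolding divide_divide_eq_left by (rule frac_le[OF _ _ n3 pw(2)]) auto
  then have 2: "1 / (m - 1) / m ^ 2 \<le> 8 / real n ^ 3" by (simp add: power_divide)
  have F: "(\<integral>c. (f c)\<^sup>2 \<partial>edge_costs n) \<le> 48 / real n ^ 3"
    using fg(4) 1 2 by (simp add: power2_abs)
  have "fact 2 / (m - 1) ^ 2 * ((m - 1) * (8 * real j / real n ^ 2)) = 16 * real j / real n ^ 2 / (m - 1)"
  proof -
    have "2 / a ^ 2 * (a * x) = 2 * x / a" if "a \<noteq> 0" for a x :: real
      using that by (simp add: power2_eq_square)
    then have "2 / (m - 1) ^ 2 * ((m - 1) * (8 * real j / real n ^ 2)) = 2 * (8 * real j / real n ^ 2) / (m - 1)"
      using n by (metis diff_gt_0_iff_gt half_gt_zero_iff less_irrefl less_le_trans)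
    also have "\<dots> = 16 * real j / real n ^ 2 / (m - 1)" by simp
    finally show ?thesis by (simp only: fact_2)
  qed
  also have "\<dots> \<le> 16 * real j / real n ^ 2 / (real n / 2)"
    using n by (intro divide_left_mono) auto
  also have "\<dots> = 32 * real j / real n ^ 3" by (simp add: power2_eq_square power3_eq_cube)
  finally have G: "(\<integral>c. (g c)\<^sup>2 \<partial>edge_costs n) \<le> 32 * real j / real n ^ 3"
    using fg(5) by (simp add: power2_abs)
  have "(\<integral>c. (f c + g c)\<^sup>2 \<partial>edge_costs n) \<le> (\<integral>c. 2 * (f c)\<^sup>2 + 2 * (g c)\<^sup>2 \<partial>edge_costs n)"
  proof (rule integral_mono)
    fix c
    show "(f c + g c)\<^sup>2 \<le> 2 * (f c)\<^sup>2 + 2 * (g c)\<^sup>2"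
      using sum_squares_bound[of "f c" "g c"] by (simp add: power2_sum)
  qed (intro all_moments_intros fg)+
  also have "\<dots> = 2 * (\<integral>c. (f c)\<^sup>2 \<partial>edge_costs n) + 2 * (\<integral>c. (g c)\<^sup>2 \<partial>edge_costs n)"
    by (subst Bochner_Integration.integral_add)
      (intro all_moments_intros fg | simp)+
  also have "\<dots> \<le> 2 * (48 / real n ^ 3) + 2 * (32 * real j / real n ^ 3)"
    using F G by linarith
  also have "\<dots> \<le> 96 * real k / real n ^ 3"
    using n by (simp add: Suc field_simps)
  finally show ?thesis unfolding Suc fg(1) .
qed

section \<open>Second moment of the total message\<close>

fun mean_msg :: "nat \<Rightarrow> real" where
  "mean_msg 0 = 0"
| "mean_msg (Suc k) = exp (- mean_msg k)"

lemma mean_msg_nonneg: "0 \<le> mean_msg k"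
  by (cases k) auto

lemma mean_msg_le_1: "mean_msg k \<le> 1"
  by (cases k) (auto simp: mean_msg_nonneg)

text \<open>Bounds the mean square deviation of \<open>total_msg\<close> from
  \<open>mean_msg\<close>. The square root appears because depth \<open>k + 1\<close> feels depth
  \<open>k\<close> through expectations that involve \<open>exp (- total_msg)\<close>, whose error
  is a root mean square; the constants are those collected at the end of
  \<open>integral_total_msg_var\<close>.\<close>

fun var_bound :: "nat \<Rightarrow> nat \<Rightarrow> real" where
  "var_bound 0 n = 0"
| "var_bound (Suc k) n = 20 * (real k + 2) / sqrt (real n) + 10 * sqrt (var_bound k n)"

lemma var_bound_nonneg: "0 \<le> var_bound k n"
  by (induction k) auto

lemma var_bound_tendsto_0: "(\<lambda>n. var_bound k n) \<longlonglongrightarrow> 0"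
proof (induction k)
  case (Suc k)
  have "(\<lambda>n. 20 * (real k + 2) / sqrt (real n)) \<longlonglongrightarrow> 0"
    by real_asymp
  moreover have "(\<lambda>n. 10 * sqrt (var_bound k n)) \<longlonglongrightarrow> 10 * sqrt 0"
    using Suc by (intro tendsto_intros)
  ultimately have "(\<lambda>n. 20 * (real k + 2) / sqrt (real n) + 10 * sqrt (var_bound k n)) \<longlonglongrightarrow> 0 + 10 * sqrt 0"
    by (rule tendsto_add)
  then show ?case by simp
qed simp

text \<open>The function exp(-x) is 1-Lipschitz on the nonnegative reals, so it inherits the mean
  square deviation; the first claim follows from the second by Cauchy-Schwarz.\<close>

lemma integral_exp_minus_diff:
  assumes am: "all_moments (edge_costs n) f" and f: "\<And>c. 0 \<le> f c" and a: "0 \<le> a"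
    and V: "(\<integral>c. (f c - a)\<^sup>2 \<partial>edge_costs n) \<le> V"
  shows "\<bar>(\<integral>c. exp (- f c) \<partial>edge_costs n) - exp (- a)\<bar> \<le> sqrt V"
    and "(\<integral>c. (exp (- f c) - exp (- a))\<^sup>2 \<partial>edge_costs n) \<le> V"
proof -
  have ame: "all_moments (edge_costs n) (\<lambda>c. exp (- f c))"
    by (rule expo_prod.all_moments_exp_minus[OF all_moments_measurable[OF am] f])
  have amd: "all_moments (edge_costs n) (\<lambda>c. exp (- f c) - exp (- a))"
    by (intro all_moments_intros ame)
  have am': "all_moments (edge_costs n) (\<lambda>c. f c - a)"
    by (intro all_moments_intros am)
  have "(\<integral>c. (exp (- f c) - exp (- a))\<^sup>2 \<partial>edge_costs n) \<le> (\<integral>c. (f c - a)\<^sup>2 \<partial>edge_costs n)"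
  proof (rule integral_mono)
    fix c
    have "\<bar>exp (- f c) - exp (- a)\<bar> \<le> \<bar>f c - a\<bar>" by (rule abs_exp_minus_diff_le[OF f a])
    then show "(exp (- f c) - exp (- a))\<^sup>2 \<le> (f c - a)\<^sup>2" by (simp add: abs_le_square_iff)
  qed (intro all_moments_intros amd am')+
  then show V': "(\<integral>c. (exp (- f c) - exp (- a))\<^sup>2 \<partial>edge_costs n) \<le> V" using V by linarith
  have "(\<integral>c. exp (- f c) \<partial>edge_costs n) - exp (- a) = (\<integral>c. exp (- f c) - exp (- a) \<partial>edge_costs n)"
    using all_moments_integrable[OF ame] by (simp add: expo_prod.prob_space)
  then have "\<bar>(\<integral>c. exp (- f c) \<partial>edge_costs n) - exp (- a)\<bar> \<le> (\<integral>c. \<bar>exp (- f c) - exp (- a)\<bar> \<partial>edge_costs n)"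
    by simp
  also have "\<dots> \<le> sqrt (\<integral>c. (exp (- f c) - exp (- a))\<^sup>2 \<partial>edge_costs n)"
    by (rule expo_prod.expectation_abs_le_sqrt[OF amd])
  also have "\<dots> \<le> sqrt V" using V' by simp
  finally show "\<bar>(\<integral>c. exp (- f c) \<partial>edge_costs n) - exp (- a)\<bar> \<le> sqrt V" .
qed

lemma integral_total_msg_diff:
  assumes "(\<integral>c. (total_msg n c k P - mean_msg k)\<^sup>2 \<partial>edge_costs n) \<le> V"
  shows "\<bar>(\<integral>c. exp (- total_msg n c k P) \<partial>edge_costs n) - mean_msg (Suc k)\<bar> \<le> sqrt V"
    and "(\<integral>c. (exp (- total_msg n c k P) - mean_msg (Suc k))\<^sup>2 \<partial>edge_costs n) \<le> V"
  using integral_exp_minus_diff[OF all_moments_total_msg total_msg_nonneg mean_msg_nonneg assms] by simp_all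

text \<open>Second moment method. The diagonal terms sum to O(1/n). For \<open>a \<noteq> b\<close>
  the message of \<open>b\<close> is replaced by one that also avoids \<open>a\<close>; then the
  star of \<open>a\<close> can be integrated out and leaves \<open>exp (- total_msg)\<close> times a
  single message, both known by induction. The replacement costs O(n^(-5/2)) per pair, hence
  O(n^(-1/2)) in all. Each level enlarges the removed set by up to two vertices, which the term
  \<open>4 * k\<close> in the size hypothesis pays for.\<close>

lemma integral_total_msg_var:
  assumes "P \<subseteq> {..<n}" "2 * card P + 4 * k + 8 \<le> n"
  shows "(\<integral>c. (total_msg n c k P - mean_msg k)\<^sup>2 \<partial>edge_costs n) \<le> var_bound k n"
  using assms
proof (induction k arbitrary: P)
  case 0
  then show ?case by (simp add: total_msg_def)
next
  case (Suc k)
  note P = Suc.prems(1)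
  have finP: "finite P" using P finite_subset by blast
  define m where "m = real n - real (card P) - 1"
  define D where "D = sqrt (var_bound k n)"
  define \<mu> where "\<mu> = mean_msg (Suc k)"
  define f where "f = (\<lambda>a c. msg n c (Suc k) P a)"
  let ?A = "{..<n} - P" and ?E = "\<lambda>f. integral\<^sup>L (edge_costs n) f"
  have \<mu>: "0 \<le> \<mu>" "\<mu> \<le> 1" unfolding \<mu>_def by (rule mean_msg_nonneg mean_msg_le_1)+
  have D: "0 \<le> D" "D\<^sup>2 = var_bound k n" by (auto simp: D_def var_bound_nonneg)
  have nn: "2 * real (card P) + 4 * real k + 12 \<le> real n"
  proof -
    have "real (2 * card P + 4 * Suc k + 8) \<le> real n" using Suc.prems(2) of_nat_le_iff by blast
    then show ?thesis by simp
  qed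
  have n: "0 < real n" "real n / 2 \<le> m - 1" "m + 1 \<le> real n" "4 \<le> m" "12 \<le> real n"
    using nn by (auto simp: m_def)
  have cardA: "real (card ?A) = m + 1"
    using P finP n(4) by (subst card_Diff_subset) (auto simp: m_def of_nat_diff)
  have m1: "real (n - card P - 1) = m" using Suc.prems(2) by (simp add: m_def of_nat_diff)
  have am: "all_moments (edge_costs n) (f a)" if "a \<in> ?A" for a
    using that unfolding f_def by (intro all_moments_msg) auto
  have IH: "?E (\<lambda>c. (total_msg n c k Q - mean_msg k)\<^sup>2) \<le> var_bound k n"
    if "Q \<subseteq> {..<n}" "card Q \<le> card P + 2" for Q
    using that Suc.prems(2) by (intro Suc.IH) auto
  have f1: "\<bar>m * ?E (f a) - \<mu>\<bar> \<le> D" if a: "a \<in> ?A" for a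
  proof -
    have "?E (\<lambda>c. msg n c (Suc k) P a ^ 1) = fact 1 / m ^ 1 * ?E (\<lambda>c. exp (- total_msg n c k (insert a P)))"
      unfolding m1[symmetric] by (rule integral_msg_power) (use P a Suc.prems(2) in auto)
    then have "m * ?E (f a) = ?E (\<lambda>c. exp (- total_msg n c k (insert a P)))"
      using n by (simp add: f_def)
    then show ?thesis
      using integral_total_msg_diff(1)[OF IH[of "insert a P"]] P a finP by (simp add: D_def \<mu>_def)
  qed
  have f2: "?E (\<lambda>c. (f a c)\<^sup>2) \<le> 2 / m\<^sup>2" if a: "a \<in> ?A" for a
    using integral_msg_power_le[OF P, of a 2 "Suc k"] a Suc.prems(2) unfolding m1 f_def by simp
  have fab: "?E (\<lambda>c. f a c * f b c) \<le> (\<mu>\<^sup>2 + 3 * D) / (m * (m - 1)) + 14 * (real k + 2) / (m * (real n * sqrt (real n)))"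
    if a: "a \<in> ?A" and b: "b \<in> ?A" and ab: "a \<noteq> b" for a b
  proof -
    define Q where "Q = insert a P"
    define g where "g = (\<lambda>c. msg n c (Suc k) Q b)"
    define e where "e = (\<lambda>c. exp (- total_msg n c k Q))"
    have Q: "Q \<subseteq> {..<n}" "b < n" "b \<notin> Q" "card Q + 2 \<le> n" "card Q = card P + 1"
      using P a b ab finP Suc.prems(2) by (auto simp: Q_def)
    have m1': "real (n - card Q - 1) = m - 1" using Q Suc.prems(2) by (simp add: m_def of_nat_diff)
    have amg: "all_moments (edge_costs n) g" unfolding g_def using Q by (intro all_moments_msg)
    have ame: "all_moments (edge_costs n) e" unfolding e_def
      by (intro expo_prod.all_moments_exp_minus all_moments_measurable[OF all_moments_total_msg] total_msg_nonneg)
    have g0: "0 \<le> g c" for c unfolding g_def by (rule msg_nonneg)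
    have f0: "0 \<le> f a c" for c unfolding f_def by (rule msg_nonneg)
    have gd: "depends_on (edges_off n a) g"
      unfolding g_def by (rule depends_on_msg') (use Q in \<open>auto simp: Q_def\<close>)
    have g1: "?E g \<le> (\<mu> + D) / (m - 1)"
    proof -
      have "?E (\<lambda>c. g c ^ 1) = fact 1 / (m - 1) ^ 1 * ?E (\<lambda>c. exp (- total_msg n c k (insert b Q)))"
        unfolding m1'[symmetric] g_def by (rule integral_msg_power) (use Q in auto)
      then have eq: "?E g = ?E (\<lambda>c. exp (- total_msg n c k (insert b Q))) / (m - 1)"
        by simp
      have "\<bar>?E (\<lambda>c. exp (- total_msg n c k (insert b Q))) - \<mu>\<bar> \<le> D"
        using integral_total_msg_diff(1)[OF IH[of "insert b Q"]] Q finite_subset[OF Q(1)] by (simp add: D_def \<mu>_def)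
      then show ?thesis unfolding eq using n by (intro divide_right_mono) auto
    qed
    have g2: "?E (\<lambda>c. (g c)\<^sup>2) \<le> 2 / (m - 1)\<^sup>2"
      using integral_msg_power_le[OF Q(1-4), of 2 "Suc k"] unfolding m1' g_def by simp
    have "?E (\<lambda>c. f a c * g c) = ?E (\<lambda>c. msg n c (Suc k) P a ^ 1 * g c)" by (simp add: f_def)
    also have "\<dots> = fact 1 / m ^ 1 * ?E (\<lambda>c. exp (- total_msg n c k (insert a P)) * g c)"
      unfolding m1[symmetric]
      by (rule integral_msg_Suc) (use P a Suc.prems(2) g0 gd all_moments_measurable[OF amg] in auto)
    also have "\<dots> = ?E (\<lambda>c. e c * g c) / m" by (simp add: e_def Q_def)
    finally have fg: "?E (\<lambda>c. f a c * g c) = ?E (\<lambda>c. e c * g c) / m" .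
    \<comment> \<open>In mean square \<open>e\<close> is close to the constant \<mu>, so up to a
      Cauchy-Schwarz error it factors out of the mixed moment.\<close>
    have "?E (\<lambda>c. e c * g c) \<le> ?E (\<lambda>c. \<mu> * g c + \<bar>e c - \<mu>\<bar> * \<bar>g c\<bar>)"
    proof (rule integral_mono)
      fix c
      have "(e c - \<mu>) * g c \<le> \<bar>e c - \<mu>\<bar> * \<bar>g c\<bar>" by (simp only: abs_mult[symmetric] abs_ge_self)
      then show "e c * g c \<le> \<mu> * g c + \<bar>e c - \<mu>\<bar> * \<bar>g c\<bar>" by (simp add: algebra_simps)
    qed (intro all_moments_intros ame amg)+
    also have "\<dots> = \<mu> * ?E g + ?E (\<lambda>c. \<bar>e c - \<mu>\<bar> * \<bar>g c\<bar>)"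
      by (subst Bochner_Integration.integral_add)
        (intro all_moments_intros ame amg | simp)+
    also have "?E (\<lambda>c. \<bar>e c - \<mu>\<bar> * \<bar>g c\<bar>) \<le> sqrt (?E (\<lambda>c. (e c - \<mu>)\<^sup>2)) * sqrt (?E (\<lambda>c. (g c)\<^sup>2))"
      by (intro expo_prod.expectation_cauchy_schwarz all_moments_intros ame amg)
    also have "\<dots> \<le> D * (2 / (m - 1))"
    proof (rule mult_mono)
      have "card Q \<le> card P + 2" using Q by simp
      then show "sqrt (?E (\<lambda>c. (e c - \<mu>)\<^sup>2)) \<le> D"
        using integral_total_msg_diff(2)[OF IH[OF Q(1)]] unfolding e_def \<mu>_def D_def by (intro real_sqrt_le_mono)
      have "?E (\<lambda>c. (g c)\<^sup>2) \<le> (2 / (m - 1))\<^sup>2"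
        using g2 by (rule order_trans) (simp add: power_divide divide_right_mono)
      then show "sqrt (?E (\<lambda>c. (g c)\<^sup>2)) \<le> 2 / (m - 1)"
        using n by (intro real_le_lsqrt) auto
    qed (use D in auto)
    also have "\<mu> * ?E g \<le> \<mu> * ((\<mu> + D) / (m - 1))" using g1 \<mu> by (intro mult_left_mono)
    also have "\<mu> * ((\<mu> + D) / (m - 1)) + D * (2 / (m - 1)) \<le> (\<mu>\<^sup>2 + 3 * D) / (m - 1)"
    proof -
      have "\<mu> * D \<le> 1 * D" using \<mu> D by (intro mult_right_mono)
      then have "\<mu> * (\<mu> + D) + D * 2 \<le> \<mu>\<^sup>2 + 3 * D" by (simp add: power2_eq_square algebra_simps)
      then show ?thesis using n by (simp add: add_divide_distrib[symmetric] divide_right_mono)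
    qed
    finally have "?E (\<lambda>c. e c * g c) \<le> (\<mu>\<^sup>2 + 3 * D) / (m - 1)" by simp
    then have "?E (\<lambda>c. f a c * g c) \<le> (\<mu>\<^sup>2 + 3 * D) / (m - 1) / m"
      unfolding fg using n by (intro divide_right_mono) auto
    then have 1: "?E (\<lambda>c. f a c * g c) \<le> (\<mu>\<^sup>2 + 3 * D) / (m * (m - 1))"
      by (simp add: mult.commute)
    have d: "?E (\<lambda>c. (f b c - g c)\<^sup>2) \<le> 96 * real (Suc k) / real n ^ 3"
      unfolding f_def g_def Q_def using P a b ab Suc.prems(2) by (intro integral_msg_insert_diff_sq) auto
    have "?E (\<lambda>c. \<bar>f a c\<bar> * \<bar>f b c - g c\<bar>) \<le> sqrt (?E (\<lambda>c. (f a c)\<^sup>2)) * sqrt (?E (\<lambda>c. (f b c - g c)\<^sup>2))"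
      by (intro expo_prod.expectation_cauchy_schwarz expo_prod.all_moments_diff am amg a b)
    also have "\<dots> \<le> sqrt (2 / m\<^sup>2) * sqrt (96 * real (Suc k) / real n ^ 3)"
      using f2[OF a] d by (intro mult_mono real_sqrt_le_mono) auto
    also have "\<dots> = sqrt (192 * real (Suc k)) / (m * (real n * sqrt (real n)))"
    proof -
      have "sqrt (real n ^ 3) = real n * sqrt (real n)" by (simp add: power3_eq_cube real_sqrt_mult)
      then show ?thesis using n by (simp add: real_sqrt_mult[symmetric] real_sqrt_divide)
    qed
    also have "\<dots> \<le> 14 * (real k + 2) / (m * (real n * sqrt (real n)))"
    proof (rule divide_right_mono)
      \<comment> \<open>Here 192 = 2 * 96 comes from the two second moments, and 14 is chosen since
        14^2 = 196.\<close>
      have "192 * real (Suc k) \<le> (14 * (real k + 2))\<^sup>2"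
        by (simp add: power2_eq_square algebra_simps)
      then show "sqrt (192 * real (Suc k)) \<le> 14 * (real k + 2)" by (intro real_le_lsqrt) auto
    qed (use n in auto)
    finally have 2: "?E (\<lambda>c. \<bar>f a c\<bar> * \<bar>f b c - g c\<bar>) \<le> 14 * (real k + 2) / (m * (real n * sqrt (real n)))" .
    have "?E (\<lambda>c. f a c * f b c) \<le> ?E (\<lambda>c. f a c * g c + \<bar>f a c\<bar> * \<bar>f b c - g c\<bar>)"
    proof (rule integral_mono)
      fix c
      have "f a c * (f b c - g c) \<le> \<bar>f a c\<bar> * \<bar>f b c - g c\<bar>" by (simp only: abs_mult[symmetric] abs_ge_self)
      then show "f a c * f b c \<le> f a c * g c + \<bar>f a c\<bar> * \<bar>f b c - g c\<bar>" by (simp add: algebra_simps)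
    qed (intro all_moments_intros am a b amg)+
    also have "\<dots> = ?E (\<lambda>c. f a c * g c) + ?E (\<lambda>c. \<bar>f a c\<bar> * \<bar>f b c - g c\<bar>)"
      by (intro Bochner_Integration.integral_add all_moments_intros am a b amg)
    finally show ?thesis using 1 2 by linarith
  qed
  have T: "total_msg n c (Suc k) P = (\<Sum>a\<in>?A. f a c)" for c by (simp add: total_msg_def f_def)
  \<comment> \<open>A lower bound suffices, because the mean enters the expanded square with the
    coefficient -2 \<mu>.\<close>
  have ET: "\<mu> - 2 * D \<le> ?E (\<lambda>c. total_msg n c (Suc k) P)"
  proof -
    have "?E (\<lambda>c. total_msg n c (Suc k) P) = (\<Sum>a\<in>?A. ?E (f a))"
      unfolding T by (intro Bochner_Integration.integral_sum all_moments_integrable am)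
    also have "\<dots> \<ge> (\<Sum>a\<in>?A. (\<mu> - D) / m)"
    proof (rule sum_mono)
      fix a assume "a \<in> ?A"
      then show "(\<mu> - D) / m \<le> ?E (f a)" using f1[of a] n by (simp add: field_simps abs_le_iff)
    qed
    also have "(\<Sum>a\<in>?A. (\<mu> - D) / m) = (m + 1) / m * (\<mu> - D)" by (simp add: cardA)
    also have "(m + 1) / m * (\<mu> - D) = \<mu> + \<mu> / m - (m + 1) / m * D" using n by (simp add: field_simps)
    also have "\<dots> \<ge> \<mu> - 2 * D"
    proof -
      have "(m + 1) / m \<le> 2" using n by (simp add: field_simps)
      then have "(m + 1) / m * D \<le> 2 * D" using D by (intro mult_right_mono) auto
      moreover have "0 \<le> \<mu> / m" using \<mu> n by auto
      ultimately show ?thesis by linarith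
    qed
    finally show ?thesis .
  qed
  have ET2: "?E (\<lambda>c. (total_msg n c (Suc k) P)\<^sup>2) \<le> \<mu>\<^sup>2 + 6 * D + (12 + 14 * (real k + 2)) / sqrt (real n)"
  proof -
    have "?E (\<lambda>c. (total_msg n c (Suc k) P)\<^sup>2) = ?E (\<lambda>c. \<Sum>a\<in>?A. \<Sum>b\<in>?A. f a c * f b c)"
      unfolding T power2_eq_square by (simp add: sum_product)
    also have "\<dots> = (\<Sum>a\<in>?A. \<Sum>b\<in>?A. ?E (\<lambda>c. f a c * f b c))"
      by (subst Bochner_Integration.integral_sum, (intro all_moments_intros am, assumption+)[1])
        (intro sum.cong refl Bochner_Integration.integral_sum all_moments_intros am)
    also have "\<dots> \<le> (\<Sum>a\<in>?A. 2 / m\<^sup>2 + m * ((\<mu>\<^sup>2 + 3 * D) / (m * (m - 1)) + 14 * (real k + 2) / (m * (real n * sqrt (real n)))))"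
    proof (rule sum_mono)
      fix a assume a: "a \<in> ?A"
      have "card ?A = Suc (card (?A - {a}))" using a by (intro card.remove) auto
      then have "real (card (?A - {a})) = m" using cardA by linarith
      then have c: "(\<Sum>b\<in>?A - {a}. x) = m * x" for x :: real by simp
      have "(\<Sum>b\<in>?A. ?E (\<lambda>c. f a c * f b c)) = ?E (\<lambda>c. f a c * f a c) + (\<Sum>b\<in>?A - {a}. ?E (\<lambda>c. f a c * f b c))"
        using a by (intro sum.remove) auto
      also have "\<dots> \<le> 2 / m\<^sup>2 + (\<Sum>b\<in>?A - {a}. (\<mu>\<^sup>2 + 3 * D) / (m * (m - 1)) + 14 * (real k + 2) / (m * (real n * sqrt (real n))))"
        using f2[OF a] a by (intro add_mono sum_mono fab) (auto simp: power2_eq_square)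
      finally show "(\<Sum>b\<in>?A. ?E (\<lambda>c. f a c * f b c)) \<le>
          2 / m\<^sup>2 + m * ((\<mu>\<^sup>2 + 3 * D) / (m * (m - 1)) + 14 * (real k + 2) / (m * (real n * sqrt (real n))))" unfolding c .
    qed
    also have "\<dots> = (m + 1) * (2 / m\<^sup>2) + (m + 1) * (m * ((\<mu>\<^sup>2 + 3 * D) / (m * (m - 1)))) +
        (m + 1) * (m * (14 * (real k + 2) / (m * (real n * sqrt (real n)))))"
      by (simp only: sum_constant cardA distrib_left add.assoc)
    also have "m * ((\<mu>\<^sup>2 + 3 * D) / (m * (m - 1))) = (\<mu>\<^sup>2 + 3 * D) / (m - 1)" using n by simp
    also have "m * (14 * (real k + 2) / (m * (real n * sqrt (real n)))) = 14 * (real k + 2) / (real n * sqrt (real n))" using n by simp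
    also have "(m + 1) * (2 / m\<^sup>2) \<le> 8 / sqrt (real n)"
    proof -
      have "(m + 1) * (2 / m\<^sup>2) \<le> (2 * m) * (2 / m\<^sup>2)" using n by (intro mult_right_mono) auto
      also have "\<dots> = 4 / m" using n by (simp add: power2_eq_square)
      also have "\<dots> \<le> 4 / (real n / 2)" using n by (intro divide_left_mono) auto
      also have "\<dots> = 8 / real n" by simp
      also have "\<dots> \<le> 8 / sqrt (real n)"
      proof (rule divide_left_mono)
        show "sqrt (real n) \<le> real n" using n by (intro real_le_lsqrt) (auto simp: power2_eq_square)
      qed (use n in auto)
      finally show ?thesis .
    qed
    also have "(m + 1) * ((\<mu>\<^sup>2 + 3 * D) / (m - 1)) \<le> \<mu>\<^sup>2 + 6 * D + 4 / sqrt (real n)"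
    proof -
      have "(m + 1) * ((\<mu>\<^sup>2 + 3 * D) / (m - 1)) = \<mu>\<^sup>2 + 2 / (m - 1) * \<mu>\<^sup>2 + (m + 1) / (m - 1) * (3 * D)"
      proof -
        have "(m + 1) / (m - 1) = 1 + 2 / (m - 1)" using n by (simp add: field_simps)
        then have "(m + 1) / (m - 1) * \<mu>\<^sup>2 = \<mu>\<^sup>2 + 2 / (m - 1) * \<mu>\<^sup>2"
          by (simp only: distrib_right mult_1)
        moreover have "(m + 1) * ((\<mu>\<^sup>2 + 3 * D) / (m - 1)) =
            (m + 1) / (m - 1) * \<mu>\<^sup>2 + (m + 1) / (m - 1) * (3 * D)"
          by (simp only: distrib_left[symmetric]) simp
        ultimately show ?thesis by (simp only:)
      qed
      also have "(m + 1) / (m - 1) * (3 * D) \<le> 2 * (3 * D)"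
        using n D by (intro mult_right_mono) (auto simp: field_simps)
      also have "2 / (m - 1) * \<mu>\<^sup>2 \<le> 4 / real n * 1"
      proof (rule mult_mono)
        have "2 / (m - 1) \<le> 2 / (real n / 2)" using n by (intro divide_left_mono) auto
        then show "2 / (m - 1) \<le> 4 / real n" by simp
        show "\<mu>\<^sup>2 \<le> 1" using \<mu> by (simp add: power_le_one)
      qed auto
      also have "4 / real n * 1 \<le> 4 / sqrt (real n)"
      proof -
        have "sqrt (real n) \<le> real n" using n by (intro real_le_lsqrt) (auto simp: power2_eq_square)
        then have "4 / real n \<le> 4 / sqrt (real n)" using n by (intro divide_left_mono) auto
        then show ?thesis by simp
      qed
      finally show ?thesis by simp
    qed
    also have "(m + 1) * (14 * (real k + 2) / (real n * sqrt (real n))) \<le> real n * (14 * (real k + 2) / (real n * sqrt (real n)))"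
      using n by (intro mult_right_mono) auto
    also have "\<dots> = 14 * (real k + 2) / sqrt (real n)" using n by simp
    finally show ?thesis by (simp add: add_divide_distrib)
  qed
  have amT: "all_moments (edge_costs n) (\<lambda>c. total_msg n c (Suc k) P)" by (rule all_moments_total_msg)
  have "?E (\<lambda>c. (total_msg n c (Suc k) P - \<mu>)\<^sup>2) =
     ?E (\<lambda>c. (total_msg n c (Suc k) P)\<^sup>2 + (\<mu>\<^sup>2 - (2 * \<mu>) * total_msg n c (Suc k) P))"
    by (intro Bochner_Integration.integral_cong refl) (simp add: power2_diff)
  also have "\<dots> = ?E (\<lambda>c. (total_msg n c (Suc k) P)\<^sup>2) + (\<mu>\<^sup>2 - (2 * \<mu>) * ?E (\<lambda>c. total_msg n c (Suc k) P))"
    using all_moments_integrable[OF amT] all_moments_integrable[OF expo_prod.all_moments_power[OF amT]]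
    by (simp add: expo_prod.prob_space)
  also have "\<dots> \<le> (\<mu>\<^sup>2 + 6 * D + (12 + 14 * (real k + 2)) / sqrt (real n)) + (\<mu>\<^sup>2 - (2 * \<mu>) * (\<mu> - 2 * D))"
    using ET2 ET \<mu> by (intro add_mono diff_mono mult_left_mono) auto
  \<comment> \<open>The leading terms \<mu>^2 + \<mu>^2 - 2 \<mu>^2 cancel and only errors
    remain.\<close>
  also have "\<dots> = 6 * D + 4 * (\<mu> * D) + (12 + 14 * (real k + 2)) / sqrt (real n)"
    by (simp add: power2_eq_square algebra_simps)
  also have "\<dots> \<le> 10 * D + 20 * (real k + 2) / sqrt (real n)"
  proof (rule add_mono)
    have "\<mu> * D \<le> 1 * D" using \<mu> D by (intro mult_right_mono)
    then show "6 * D + 4 * (\<mu> * D) \<le> 10 * D" by simp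
    show "(12 + 14 * (real k + 2)) / sqrt (real n) \<le> 20 * (real k + 2) / sqrt (real n)"
      by (intro divide_right_mono) auto
  qed
  finally show ?case by (simp add: \<mu>_def D_def)
qed

section \<open>Thresholds and typical cost vectors\<close>

text \<open>In \<open>local_threshold\<close> the total at \<open>u\<close> lacks one message, that
  of \<open>v\<close>; the inner factor 2 and the term 4/(n - 2)^2 account for it through (x - y)^2
  \<le> 2 x^2 + 2 y^2. The factor 10 adds up the errors of the two squares and the mixed
  term.\<close>

definition threshold_error :: "nat \<Rightarrow> nat \<Rightarrow> real" where
  "threshold_error k n = 10 * sqrt (2 * var_bound k n + 4 / (real n - 2)\<^sup>2)"

lemma threshold_error_tendsto_0: "(\<lambda>n. threshold_error k n) \<longlonglongrightarrow> 0"
proof -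
  have "(\<lambda>n. 4 / (real n - 2)\<^sup>2) \<longlonglongrightarrow> 0" by real_asymp
  then have "(\<lambda>n. 10 * sqrt (2 * var_bound k n + 4 / (real n - 2)\<^sup>2)) \<longlonglongrightarrow> 10 * sqrt (2 * 0 + 0)"
    using var_bound_tendsto_0 by (intro tendsto_intros)
  then show ?thesis by (simp add: threshold_error_def)
qed

lemma card_rest_pair:
  assumes "u < n" "v < n" "u \<noteq> v"
  shows "real (card ({..<n} - {u,v})) = real n - 2"
proof -
  have "card {u,v} \<le> card {..<n}" using assms by (intro card_mono) auto
  then have "2 \<le> n" using assms by simp
  then show ?thesis using assms by (subst card_Diff_subset) (auto simp: of_nat_diff)
qed

lemma rest_pair_nonempty:
  fixes n :: nat
  assumes "u < n" "v < n" "u \<noteq> v" "3 \<le> n"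
  shows "{..<n} - {u,v} \<noteq> {}"
proof
  assume "{..<n} - {u,v} = {}"
  then have "real (card ({..<n} - {u,v})) = 0" by (simp only: card.empty of_nat_0)
  then show False using card_rest_pair[OF assms(1-3)] assms(4) by linarith
qed

lemma all_moments_local_threshold:
  assumes "u < n" "v < n"
  shows "all_moments (edge_costs n) (\<lambda>c. local_threshold n c k u v)"
  unfolding local_threshold_def using assms
  by (intro all_moments_add all_moments_clip_min all_moments_measurable all_moments_msg msg_nonneg) auto

text \<open>Each summand of the threshold has second moment about 2 \<mu>/m^2. In the mixed term the
  star of \<open>u\<close> is integrated out first, which is possible because the summand at
  \<open>v\<close> avoids \<open>u\<close>; the factor \<open>exp (- S c)\<close> left behind is
  nearly \<mu>, so the mixed moment is about \<mu>^2/m^2.\<close>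

lemma integral_local_threshold_sq:
  assumes uv: "u < n" "v < n" "u \<noteq> v" and n: "4 * k + 12 \<le> n"
  shows "\<bar>(real n - 2)\<^sup>2 * (\<integral>c. (local_threshold n c k u v)\<^sup>2 \<partial>edge_costs n) -
     (4 * mean_msg (Suc k) + 2 * (mean_msg (Suc k))\<^sup>2)\<bar> \<le> threshold_error k n"
proof -
  let ?N = "{..<n} - {u,v}" and ?E = "\<lambda>f. integral\<^sup>L (edge_costs n) f"
  define m where "m = real n - 2"
  define \<mu> where "\<mu> = mean_msg (Suc k)"
  define a where "a = (\<lambda>c. clip_min c u ?N (\<lambda>w. msg n c k {u} w))"
  define b where "b = (\<lambda>c. clip_min c v ?N (\<lambda>w. msg n c k {u,v} w))"
  define S where "S = (\<lambda>c. \<Sum>w\<in>?N. msg n c k {u} w)"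
  define V where "V = 2 * var_bound k n + 4 / m\<^sup>2"
  have m: "10 \<le> m" using n by (simp add: m_def)
  have cardN: "real (card ?N) = m" unfolding m_def by (rule card_rest_pair[OF uv])
  have ne: "?N \<noteq> {}" using uv n by (intro rest_pair_nonempty) auto
  have b_msg: "b c = msg n c (Suc k) {u} v" for c
    by (simp add: b_def insert_commute)
  have ama: "all_moments (edge_costs n) a" unfolding a_def
    using uv by (intro all_moments_clip_min all_moments_measurable all_moments_msg msg_nonneg) auto
  have amb: "all_moments (edge_costs n) b" unfolding b_msg
    using uv by (intro all_moments_msg) auto
  have amS: "all_moments (edge_costs n) S" unfolding S_def
    using uv by (intro expo_prod.all_moments_sum all_moments_msg) auto
  have S0: "0 \<le> S c" and b0: "0 \<le> b c" for c
    by (auto simp: S_def b_def intro!: sum_nonneg msg_nonneg clip_min_nonneg)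
  have ame: "all_moments (edge_costs n) (\<lambda>c. exp (- S c))"
    by (rule expo_prod.all_moments_exp_minus[OF all_moments_measurable[OF amS] S0])
  have msgdep: "depends_on (edges_off n u) (\<lambda>c. msg n c k {u} w)" if "w \<in> ?N" for w
    using that by (intro depends_on_msg') auto
  have msgm: "(\<lambda>c. msg n c k {u} w) \<in> borel_measurable (edge_costs n)" if "w \<in> ?N" for w
    using that by (intro all_moments_measurable all_moments_msg) auto
  have msgm2: "(\<lambda>c. msg n c k {u,v} w) \<in> borel_measurable (edge_costs n)" if "w \<in> ?N" for w
    using that by (intro all_moments_measurable all_moments_msg) auto
  have \<mu>: "0 \<le> \<mu>" "\<mu> \<le> 1" unfolding \<mu>_def by (rule mean_msg_nonneg mean_msg_le_1)+
  have \<mu>_eq: "\<mu> = exp (- mean_msg k)" by (simp add: \<mu>_def)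
  have D: "0 \<le> sqrt V" using var_bound_nonneg by (simp add: V_def)
  have "var_bound k n \<le> V" using var_bound_nonneg[of k n] by (simp add: V_def)
  then have D1: "sqrt (var_bound k n) \<le> sqrt V" by simp
  have varS: "?E (\<lambda>c. (S c - mean_msg k)\<^sup>2) \<le> V"
  proof -
    have T: "total_msg n c k {u} = msg n c k {u} v + S c" for c
    proof -
      have "{..<n} - {u} = insert v ?N" using uv by auto
      then show ?thesis by (simp add: total_msg_def S_def)
    qed
    have am1: "all_moments (edge_costs n) (\<lambda>c. msg n c k {u} v)" using uv by (intro all_moments_msg) auto
    have "?E (\<lambda>c. (S c - mean_msg k)\<^sup>2) \<le> ?E (\<lambda>c. 2 * (total_msg n c k {u} - mean_msg k)\<^sup>2 + 2 * (msg n c k {u} v)\<^sup>2)"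
    proof (rule integral_mono)
      fix c
      have "(x - y)\<^sup>2 \<le> 2 * x\<^sup>2 + 2 * y\<^sup>2" for x y :: real
        using sum_squares_bound[of x "- y"] by (simp add: power2_diff)
      from this[of "total_msg n c k {u} - mean_msg k" "msg n c k {u} v"]
      show "(S c - mean_msg k)\<^sup>2 \<le> 2 * (total_msg n c k {u} - mean_msg k)\<^sup>2 + 2 * (msg n c k {u} v)\<^sup>2"
        by (simp add: T algebra_simps)
    qed (intro all_moments_intros amS am1 all_moments_total_msg)+
    also have "\<dots> = 2 * ?E (\<lambda>c. (total_msg n c k {u} - mean_msg k)\<^sup>2) + 2 * ?E (\<lambda>c. (msg n c k {u} v)\<^sup>2)"
      by (subst Bochner_Integration.integral_add)
        (intro all_moments_intros am1 all_moments_total_msg | simp)+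
    also have "\<dots> \<le> 2 * var_bound k n + 2 * (2 / m\<^sup>2)"
    proof (intro add_mono mult_left_mono)
      show "?E (\<lambda>c. (total_msg n c k {u} - mean_msg k)\<^sup>2) \<le> var_bound k n"
        using uv n by (intro integral_total_msg_var) auto
      have "real (n - card {u} - 1) = m" using n by (simp add: m_def of_nat_diff)
      then show "?E (\<lambda>c. (msg n c k {u} v)\<^sup>2) \<le> 2 / m\<^sup>2"
        using integral_msg_power_le[of "{u}" n v 2 k] uv n by simp
    qed auto
    finally show ?thesis by (simp add: V_def)
  qed
  note eS = integral_exp_minus_diff[OF amS S0 mean_msg_nonneg varS, folded \<mu>_eq]
  have varT: "?E (\<lambda>c. (total_msg n c k {u,v} - mean_msg k)\<^sup>2) \<le> var_bound k n"
    using uv n by (intro integral_total_msg_var) auto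
  have eT: "\<bar>?E (\<lambda>c. exp (- total_msg n c k {u,v})) - \<mu>\<bar> \<le> sqrt V"
    using integral_total_msg_diff(1)[OF varT] D1 unfolding \<mu>_def by linarith
  have a2: "m\<^sup>2 * ?E (\<lambda>c. (a c)\<^sup>2) = 2 * ?E (\<lambda>c. exp (- S c))"
  proof -
    have "?E (\<lambda>c. a c ^ 2) = fact 2 / m ^ 2 * ?E (\<lambda>c. exp (- S c))"
      unfolding a_def S_def cardN[symmetric]
      by (rule integral_clip_min_power) (use uv ne msgm msgdep msg_nonneg in auto)
    then show ?thesis using m by simp
  qed
  have b_int: "?E (\<lambda>c. b c ^ p) = fact p / m ^ p * ?E (\<lambda>c. exp (- total_msg n c k {u,v}))" if "0 < p" for p
  proof -
    have "real (n - card {u} - 1) = m" using n by (simp add: m_def of_nat_diff)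
    then show ?thesis using integral_msg_power[of "{u}" n v p k] that uv n
      by (simp add: b_msg insert_commute del: msg.simps)
  qed
  have b2: "m\<^sup>2 * ?E (\<lambda>c. (b c)\<^sup>2) = 2 * ?E (\<lambda>c. exp (- total_msg n c k {u,v}))"
    using b_int[of 2] m by simp
  have b1: "m * ?E b = ?E (\<lambda>c. exp (- total_msg n c k {u,v}))"
    using b_int[of 1] m by simp
  have ab: "m * ?E (\<lambda>c. a c * b c) = ?E (\<lambda>c. exp (- S c) * b c)"
  proof -
    have "depends_on (edges_off n u) b"
      unfolding b_msg using uv by (intro depends_on_msg') auto
    then have "?E (\<lambda>c. a c ^ 1 * b c) = fact 1 / m ^ 1 * ?E (\<lambda>c. exp (- S c) * b c)"
      unfolding a_def S_def cardN[symmetric]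
      by (intro integral_clip_min) (use uv ne msgm msgdep msg_nonneg b0 all_moments_measurable[OF amb] in auto)
    then show ?thesis using m by simp
  qed
  have sqb: "sqrt (?E (\<lambda>c. (b c)\<^sup>2)) \<le> 2 / m"
  proof (rule real_le_lsqrt)
    have "?E (\<lambda>c. exp (- total_msg n c k {u,v})) \<le> 1"
      by (intro integral_exp_minus_le_1 all_moments_measurable[OF all_moments_total_msg] total_msg_nonneg)
    then have "m\<^sup>2 * ?E (\<lambda>c. (b c)\<^sup>2) \<le> 4" using b2 by simp
    then show "?E (\<lambda>c. (b c)\<^sup>2) \<le> (2 / m)\<^sup>2" using m by (simp add: power_divide field_simps)
  qed (use m in auto)
  have err: "\<bar>?E (\<lambda>c. exp (- S c) * b c) - \<mu> * ?E b\<bar> \<le> sqrt V * (2 / m)"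
  proof -
    have "?E (\<lambda>c. exp (- S c) * b c) - \<mu> * ?E b = ?E (\<lambda>c. (exp (- S c) - \<mu>) * b c)"
    proof -
      have "?E (\<lambda>c. (exp (- S c) - \<mu>) * b c) = ?E (\<lambda>c. exp (- S c) * b c - \<mu> * b c)"
        by (simp only: left_diff_distrib)
      also have "\<dots> = ?E (\<lambda>c. exp (- S c) * b c) - \<mu> * ?E b"
        by (subst Bochner_Integration.integral_diff)
          (intro all_moments_intros ame amb | simp)+
      finally show ?thesis ..
    qed
    also have "\<bar>\<dots>\<bar> \<le> ?E (\<lambda>c. \<bar>(exp (- S c) - \<mu>) * b c\<bar>)" by simp
    also have "\<dots> \<le> sqrt (?E (\<lambda>c. (exp (- S c) - \<mu>)\<^sup>2)) * sqrt (?E (\<lambda>c. (b c)\<^sup>2))"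
      unfolding abs_mult
      by (intro expo_prod.expectation_cauchy_schwarz expo_prod.all_moments_diff ame amb expo_prod.all_moments_const)
    also have "\<dots> \<le> sqrt V * (2 / m)"
      using eS(2) sqb D m by (intro mult_mono real_sqrt_le_mono) auto
    finally show ?thesis .
  qed
  have mab: "\<bar>m\<^sup>2 * ?E (\<lambda>c. a c * b c) - \<mu>\<^sup>2\<bar> \<le> 3 * sqrt V"
  proof -
    have "m\<^sup>2 * ?E (\<lambda>c. a c * b c) = m * ?E (\<lambda>c. exp (- S c) * b c)"
      using ab by (simp add: power2_eq_square)
    moreover have "\<bar>m * ?E (\<lambda>c. exp (- S c) * b c) - \<mu> * (m * ?E b)\<bar> \<le> 2 * sqrt V"
    proof -
      have "\<bar>m * ?E (\<lambda>c. exp (- S c) * b c) - \<mu> * (m * ?E b)\<bar> = m * \<bar>?E (\<lambda>c. exp (- S c) * b c) - \<mu> * ?E b\<bar>"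
      proof -
        have "m * ?E (\<lambda>c. exp (- S c) * b c) - \<mu> * (m * ?E b) = m * (?E (\<lambda>c. exp (- S c) * b c) - \<mu> * ?E b)"
          by (simp add: algebra_simps)
        then show ?thesis using m by (simp add: abs_mult)
      qed
      also have "\<dots> \<le> m * (sqrt V * (2 / m))" using err m by (intro mult_left_mono) auto
      finally show ?thesis using m by simp
    qed
    moreover have "\<bar>\<mu> * (m * ?E b) - \<mu>\<^sup>2\<bar> \<le> sqrt V"
    proof -
      have "\<bar>\<mu> * (m * ?E b) - \<mu>\<^sup>2\<bar> = \<mu> * \<bar>m * ?E b - \<mu>\<bar>"
      proof -
        have "\<mu> * (m * ?E b) - \<mu>\<^sup>2 = \<mu> * (m * ?E b - \<mu>)" by (simp add: algebra_simps power2_eq_square)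
        then show ?thesis using \<mu> by (simp add: abs_mult)
      qed
      also have "\<dots> \<le> 1 * sqrt V" using eT \<mu> D unfolding b1 by (intro mult_mono) auto
      finally show ?thesis by simp
    qed
    ultimately show ?thesis by linarith
  qed
  have "?E (\<lambda>c. (local_threshold n c k u v)\<^sup>2) = ?E (\<lambda>c. (a c)\<^sup>2 + (2 * (a c * b c) + (b c)\<^sup>2))"
    by (intro Bochner_Integration.integral_cong refl) (simp add: local_threshold_def a_def b_def power2_sum)
  also have "\<dots> = ?E (\<lambda>c. (a c)\<^sup>2) + (2 * ?E (\<lambda>c. a c * b c) + ?E (\<lambda>c. (b c)\<^sup>2))"
  proof -
    have "integrable (edge_costs n) (\<lambda>c. (a c)\<^sup>2)" "integrable (edge_costs n) (\<lambda>c. a c * b c)"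
      "integrable (edge_costs n) (\<lambda>c. (b c)\<^sup>2)"
      by (intro all_moments_intros ama amb)+
    then show ?thesis by simp
  qed
  finally have "m\<^sup>2 * ?E (\<lambda>c. (local_threshold n c k u v)\<^sup>2) =
      2 * ?E (\<lambda>c. exp (- S c)) + 2 * (m\<^sup>2 * ?E (\<lambda>c. a c * b c)) + 2 * ?E (\<lambda>c. exp (- total_msg n c k {u,v}))"
    using a2 b2 by (simp add: algebra_simps)
  \<comment> \<open>10 = 2 + 2 * 3 + 2, from the square at \<open>u\<close>, the mixed term and the
    square at \<open>v\<close>.\<close>
  then have "\<bar>m\<^sup>2 * ?E (\<lambda>c. (local_threshold n c k u v)\<^sup>2) - (4 * \<mu> + 2 * \<mu>\<^sup>2)\<bar> \<le> 10 * sqrt V"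
    using eS(1) eT mab by linarith
  then show ?thesis by (simp add: m_def \<mu>_def V_def threshold_error_def)
qed

lemma integral_local_threshold_0_power:
  assumes uv: "u < n" "v < n" "u \<noteq> v" and n: "3 \<le> n" and p: "0 < p"
  shows "(\<integral>c. local_threshold n c 0 u v ^ p \<partial>edge_costs n) \<le> 2 ^ (p + 1) * fact p / (real n - 2) ^ p"
proof -
  let ?N = "{..<n} - {u,v}" and ?E = "\<lambda>f. integral\<^sup>L (edge_costs n) f"
  define a where "a = (\<lambda>x c. clip_min c x ?N (\<lambda>w. 0))"
  have a_int: "?E (\<lambda>c. a x c ^ p) = fact p / (real n - 2) ^ p" if "x \<in> {u,v}" for x
  proof -
    have "?E (\<lambda>c. a x c ^ p) = fact p / real (card ?N) ^ p * ?E (\<lambda>c. exp (- (\<Sum>w\<in>?N. 0)))"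
      unfolding a_def by (rule integral_clip_min_power[where x = "\<lambda>_ _. 0"])
        (use that uv p rest_pair_nonempty[OF uv n] in \<open>auto simp: depends_on_def\<close>)
    then show ?thesis using card_rest_pair[OF uv] by (simp add: expo_prod.prob_space)
  qed
  have am: "all_moments (edge_costs n) (a x)" if "x \<in> {u,v}" for x
    unfolding a_def using that uv by (intro all_moments_clip_min) auto
  have L: "local_threshold n c 0 u v = a u c + a v c" for c
    by (simp add: local_threshold_def a_def msg_0)
  have "?E (\<lambda>c. local_threshold n c 0 u v ^ p) \<le> ?E (\<lambda>c. 2 ^ p * (a u c ^ p + a v c ^ p))"
  proof (rule integral_mono)
    fix c
    have nn: "0 \<le> a u c" "0 \<le> a v c" by (auto simp: a_def clip_min_nonneg)
    have "(a u c + a v c) ^ p \<le> (2 * max (a u c) (a v c)) ^ p" using nn by (intro power_mono) auto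
    also have "\<dots> \<le> 2 ^ p * (a u c ^ p + a v c ^ p)"
      using nn by (auto simp: power_mult_distrib max_def)
    finally show "local_threshold n c 0 u v ^ p \<le> 2 ^ p * (a u c ^ p + a v c ^ p)" unfolding L .
  next
    show "integrable (edge_costs n) (\<lambda>c. local_threshold n c 0 u v ^ p)"
      by (intro all_moments_intros all_moments_local_threshold uv)
    show "integrable (edge_costs n) (\<lambda>c. 2 ^ p * (a u c ^ p + a v c ^ p))"
      by (intro all_moments_intros am) auto
  qed
  also have "\<dots> = 2 ^ p * (?E (\<lambda>c. a u c ^ p) + ?E (\<lambda>c. a v c ^ p))"
    by (subst integral_mult_right_zero, subst Bochner_Integration.integral_add)
      (intro all_moments_intros am | simp)+
  also have "\<dots> = 2 ^ (p + 1) * fact p / (real n - 2) ^ p"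
    using a_int by simp
  finally show ?thesis .
qed

section \<open>Probability of atypical cost vectors\<close>

lemma edge_box:
  assumes "Q \<subseteq> complete_edges n" "A \<in> sets borel"
  shows "{c \<in> space (edge_costs n). \<forall>e\<in>Q. c e \<in> A} \<in> sets (edge_costs n)"
    and "measure (edge_costs n) {c \<in> space (edge_costs n). \<forall>e\<in>Q. c e \<in> A} = measure expo A ^ card Q"
proof -
  have finQ: "finite Q" using assms finite_complete_edges finite_subset by blast
  show "{c \<in> space (edge_costs n). \<forall>e\<in>Q. c e \<in> A} \<in> sets (edge_costs n)"
  proof (rule sets.sets_Collect_finite_All[OF _ finQ])
    fix e assume "e \<in> Q"
    then have "(\<lambda>c. c e) -` A \<inter> space (edge_costs n) \<in> sets (edge_costs n)"
      using assms by (intro measurable_sets[OF measurable_expo_prod_component]) auto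
    also have "(\<lambda>c. c e) -` A \<inter> space (edge_costs n) = {c \<in> space (edge_costs n). c e \<in> A}" by auto
    finally show "{c \<in> space (edge_costs n). c e \<in> A} \<in> sets (edge_costs n)" .
  qed
  have "emeasure (edge_costs n) {c \<in> space (edge_costs n). \<forall>e\<in>Q. c e \<in> A} = (\<Prod>e\<in>Q. emeasure expo A)"
    unfolding expo_prod_def using assms finQ by (intro expo_PiM.emeasure_PiM_Collect) auto
  also have "\<dots> = ennreal (measure expo A ^ card Q)"
    by (simp add: expo.emeasure_eq_measure ennreal_power)
  finally show "measure (edge_costs n) {c \<in> space (edge_costs n). \<forall>e\<in>Q. c e \<in> A} = measure expo A ^ card Q"
    unfolding measure_def[of "edge_costs n"] by simp
qed

lemma (in prob_space) prob_UN_le: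
  assumes "finite I" "\<And>i. i \<in> I \<Longrightarrow> A i \<in> events" "\<And>i. i \<in> I \<Longrightarrow> prob (A i) \<le> b" "real (card I) \<le> k" "0 \<le> b"
  shows "prob (\<Union>i\<in>I. A i) \<le> k * b"
proof -
  have "prob (\<Union>i\<in>I. A i) \<le> (\<Sum>i\<in>I. prob (A i))"
    using assms by (intro finite_measure_subadditive_finite) auto
  also have "\<dots> \<le> (\<Sum>i\<in>I. b)" using assms by (intro sum_mono)
  also have "\<dots> \<le> k * b" using assms by (simp add: mult_right_mono)
  finally show ?thesis .
qed

text \<open>Two union bounds. In the first there are at most \<open>n ^ (K + 1)\<close> pairs of a
  vertex and a forbidden set per set size. In the second \<open>r\<close> and \<open>s\<close> are
  fixed, so \<open>W\<close> has \<open>j = card W - 2\<close> free vertices, but at least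
  \<open>j + 1\<close> edges must cost less than 2 \<theta>; this surplus of one edge yields
  \<open>n ^ j * (2 * \<theta>) ^ (j + 1) = (2 * \<theta> * n) ^ (j + 1) / n\<close>. The power of 2
  bounds the number of choices of \<open>Q\<close>.\<close>

definition bad_bound :: "nat \<Rightarrow> real \<Rightarrow> nat \<Rightarrow> real" where
  "bad_bound n \<theta> K = (real K + 1) * (real n ^ (K + 1) * exp (- \<theta> * (real n - real K - 1))) +
     (real K + 1) * (2 ^ (K + 2)\<^sup>2 * ((2 * \<theta> * real n) ^ (K + 1) / real n))"

lemma card_subsets_le:
  "real (card {A. A \<subseteq> {..<n} \<and> card A = j}) \<le> real n ^ j"
proof -
  have "card {A. A \<subseteq> {..<n} \<and> card A = j} = n choose j" using n_subsets[of "{..<n}" j] by simp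
  also have "\<dots> \<le> n ^ j" by (cases "j \<le> n") (auto simp: binomial_le_pow binomial_eq_0)
  finally show ?thesis by (simp add: of_nat_power[symmetric] del: of_nat_power)
qed

text \<open>The atypical vectors are enclosed in a finite union \<open>B\<close> of boxes, which is
  measurable by construction and open to a union bound.\<close>

lemma not_cheap_escape_prob:
  assumes \<theta>: "0 \<le> \<theta>" and K: "K + 2 \<le> n"
  obtains B where "B \<in> sets (edge_costs n)" "{c \<in> space (edge_costs n). \<not> cheap_escape n c \<theta> K} \<subseteq> B"
    "measure (edge_costs n) B \<le> (real K + 1) * (real n ^ (K + 1) * exp (- \<theta> * (real n - real K - 1)))"
proof -
  define ev where "ev = (\<lambda>x S. {c \<in> space (edge_costs n). \<forall>e\<in>(\<lambda>w. {x,w}) ` ({..<n} - insert x S). c e \<in> {\<theta>..}})"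
  define q where "q = exp (- \<theta> * (real n - real K - 1))"
  have ev: "ev x S \<in> sets (edge_costs n)" "measure (edge_costs n) (ev x S) \<le> q"
    if "x < n" "S \<subseteq> {..<n}" "card S \<le> K" for x S
  proof -
    have sub: "(\<lambda>w. {x,w}) ` ({..<n} - insert x S) \<subseteq> complete_edges n"
      using that by (auto simp: mem_complete_edges)
    show "ev x S \<in> sets (edge_costs n)" unfolding ev_def by (rule edge_box(1)[OF sub]) simp
    have finS: "finite S" using that finite_subset by blast
    have c1: "real n - real K - 1 \<le> real (card ({..<n} - insert x S))"
    proof -
      have "card (insert x S) \<le> K + 1" using that finS by (simp add: card_insert_if)
      moreover have "n - card (insert x S) \<le> card ({..<n} - insert x S)"
        using diff_card_le_card_Diff[of "insert x S" "{..<n}"] finS by simp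
      ultimately show ?thesis by linarith
    qed
    have "card ((\<lambda>w. {x,w}) ` ({..<n} - insert x S)) = card ({..<n} - insert x S)"
      by (rule card_image[OF inj_on_star])
    then have "measure (edge_costs n) (ev x S) = measure expo {\<theta>..} ^ card ({..<n} - insert x S)"
      unfolding ev_def by (subst edge_box(2)[OF sub]) auto
    also have "measure expo {\<theta>..} = exp (- \<theta>)"
      using emeasure_expo_atLeast[OF \<theta>] by (simp add: measure_def)
    also have "exp (- \<theta>) ^ card ({..<n} - insert x S) = exp (- \<theta> * real (card ({..<n} - insert x S)))"
      by (simp add: exp_of_nat_mult[symmetric] mult.commute)
    also have "\<dots> \<le> q" unfolding q_def using c1 \<theta> by (simp add: mult_left_mono)
    finally show "measure (edge_costs n) (ev x S) \<le> q" .
  qed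
  have q0: "0 \<le> q" by (simp add: q_def)
  define B1 where "B1 = (\<lambda>j x. \<Union>S\<in>{S. S \<subseteq> {..<n} \<and> card S = j}. ev x S)"
  define B2 where "B2 = (\<lambda>j. \<Union>x\<in>{..<n}. B1 j x)"
  define B where "B = (\<Union>j\<in>{..K}. B2 j)"
  have fin: "finite {S. S \<subseteq> {..<n} \<and> card S = j}" for j
    by (rule finite_subset[of _ "Pow {..<n}"]) auto
  have B1: "B1 j x \<in> sets (edge_costs n)" "measure (edge_costs n) (B1 j x) \<le> real n ^ K * q"
    if "x < n" "j \<le> K" for j x
  proof -
    show "B1 j x \<in> sets (edge_costs n)" unfolding B1_def using fin ev that by (intro sets.finite_UN) auto
    show "measure (edge_costs n) (B1 j x) \<le> real n ^ K * q" unfolding B1_def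
    proof (rule expo_prod.prob_UN_le[OF fin _ _ _ q0])
      have "real n ^ j \<le> real n ^ K" using that K by (intro power_increasing) auto
      then show "real (card {S. S \<subseteq> {..<n} \<and> card S = j}) \<le> real n ^ K"
        using card_subsets_le[of n j] by linarith
    qed (use ev that in auto)
  qed
  have B2: "B2 j \<in> sets (edge_costs n)" "measure (edge_costs n) (B2 j) \<le> real n * (real n ^ K * q)"
    if "j \<le> K" for j
  proof -
    show "B2 j \<in> sets (edge_costs n)" unfolding B2_def using B1 that by (intro sets.finite_UN) auto
    show "measure (edge_costs n) (B2 j) \<le> real n * (real n ^ K * q)" unfolding B2_def
      by (rule expo_prod.prob_UN_le) (use B1 that q0 in auto)
  qed
  show ?thesis
  proof (rule that[of B])
    show "B \<in> sets (edge_costs n)" unfolding B_def using B2 by (intro sets.finite_UN) auto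
    have "measure (edge_costs n) B \<le> (real K + 1) * (real n * (real n ^ K * q))" unfolding B_def
      by (rule expo_prod.prob_UN_le) (use B2 q0 in auto)
    then show "measure (edge_costs n) B \<le> (real K + 1) * (real n ^ (K + 1) * exp (- \<theta> * (real n - real K - 1)))"
      by (simp add: q_def mult.assoc)
    show "{c \<in> space (edge_costs n). \<not> cheap_escape n c \<theta> K} \<subseteq> B"
    proof
      fix c assume "c \<in> {c \<in> space (edge_costs n). \<not> cheap_escape n c \<theta> K}"
      then obtain x S where c: "c \<in> space (edge_costs n)" "x < n" "S \<subseteq> {..<n}" "card S \<le> K"
        "\<forall>w\<in>{..<n} - insert x S. \<not> c {x,w} \<le> \<theta>" by (auto simp: cheap_escape_def)
      then have "\<forall>w\<in>{..<n} - insert x S. \<theta> \<le> c {x,w}" by (meson linear)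
      then have "c \<in> ev x S" using c(1) by (simp add: ev_def)
      then show "c \<in> B" using c unfolding B_def B2_def B1_def by blast
    qed
  qed
qed

lemma not_locally_acyclic_prob:
  assumes \<theta>: "0 \<le> \<theta>" "2 * \<theta> \<le> 1" "1 \<le> 2 * \<theta> * real n" and rs: "r < n" "s < n" "r \<noteq> s"
  obtains B where "B \<in> sets (edge_costs n)" "{c \<in> space (edge_costs n). \<not> locally_acyclic n c \<theta> K r s} \<subseteq> B"
    "measure (edge_costs n) B \<le> (real K + 1) * (2 ^ (K + 2)\<^sup>2 * ((2 * \<theta> * real n) ^ (K + 1) / real n))"
proof -
  define ev where "ev = (\<lambda>Q. {c \<in> space (edge_costs n). \<forall>e\<in>Q. c e \<in> {..<2 * \<theta>}})"
  \<comment> \<open>With \<open>W = A \<union> {r,s}\<close> and \<open>card A = j\<close>, the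
    condition \<open>j + 1 \<le> card Q\<close> is \<open>card W \<le> card Q + 1\<close>.\<close>
  define QQ where "QQ = (\<lambda>j A. {Q. Q \<subseteq> nsets (A \<union> {r,s}) 2 \<and> j + 1 \<le> card Q})"
  define B1 where "B1 = (\<lambda>j A. \<Union>Q\<in>QQ j A. ev Q)"
  define B2 where "B2 = (\<lambda>j. \<Union>A\<in>{A. A \<subseteq> {..<n} \<and> card A = j}. B1 j A)"
  define B where "B = (\<Union>j\<in>{..K}. B2 j)"
  define L where "L = (2::real) ^ (K + 2)\<^sup>2"
  define y where "y = 2 * \<theta> * real n"
  have n: "0 < real n" using rs by simp
  have y: "2 * \<theta> = y / real n" "1 \<le> y" using n \<theta> by (auto simp: y_def)
  have fin: "finite {A. A \<subseteq> {..<n} \<and> card A = j}" for j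
    by (rule finite_subset[of _ "Pow {..<n}"]) auto
  have ev: "ev Q \<in> sets (edge_costs n)" "measure (edge_costs n) (ev Q) \<le> (2 * \<theta>) ^ (j + 1)"
    if "Q \<in> QQ j A" "A \<subseteq> {..<n}" for Q j A
  proof -
    have "nsets (A \<union> {r,s}) 2 \<subseteq> complete_edges n"
      unfolding complete_edges_def complete_vertices_def using that rs by (intro nsets_mono) auto
    then have sub: "Q \<subseteq> complete_edges n" using that by (auto simp: QQ_def)
    show "ev Q \<in> sets (edge_costs n)" unfolding ev_def by (rule edge_box(1)[OF sub]) simp
    have "measure (edge_costs n) (ev Q) = measure expo {..<2 * \<theta>} ^ card Q"
      unfolding ev_def by (subst edge_box(2)[OF sub]) auto
    also have "\<dots> \<le> (2 * \<theta>) ^ card Q" using measure_expo_less[of "2 * \<theta>"] \<theta> by (intro power_mono) auto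
    also have "\<dots> \<le> (2 * \<theta>) ^ (j + 1)" using that \<theta> by (intro power_decreasing) (auto simp: QQ_def)
    finally show "measure (edge_costs n) (ev Q) \<le> (2 * \<theta>) ^ (j + 1)" .
  qed
  have B1: "B1 j A \<in> sets (edge_costs n)" "measure (edge_costs n) (B1 j A) \<le> L * (2 * \<theta>) ^ (j + 1)"
    if A: "A \<subseteq> {..<n}" "card A = j" and j: "j \<le> K" for j A
  proof -
    have finA: "finite (A \<union> {r,s})" using A finite_subset by blast
    have finN: "finite (nsets (A \<union> {r,s}) 2)" by (rule finite_imp_finite_nsets[OF finA])
    have finQ: "finite (QQ j A)" unfolding QQ_def
      by (rule finite_subset[OF _ iffD2[OF finite_Pow_iff finN]]) blast
    have "card (QQ j A) \<le> card (Pow (nsets (A \<union> {r,s}) 2))"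
      unfolding QQ_def by (rule card_mono[OF iffD2[OF finite_Pow_iff finN]]) blast
    also have "\<dots> = 2 ^ (card (A \<union> {r,s}) choose 2)" using finN finA by (simp add: card_Pow card_nsets)
    also have "\<dots> \<le> 2 ^ ((K + 2)\<^sup>2)"
    proof (rule power_increasing)
      have "card (A \<union> {r,s}) \<le> K + 2" using card_Un_le[of A "{r,s}"] A j rs by simp
      moreover have "x choose 2 \<le> x\<^sup>2" for x by (cases "2 \<le> x") (auto simp: binomial_le_pow binomial_eq_0)
      ultimately show "card (A \<union> {r,s}) choose 2 \<le> (K + 2)\<^sup>2"
        by (meson order_trans power_mono zero_le)
    qed simp
    finally have "real (card (QQ j A)) \<le> L"
      unfolding L_def by (metis of_nat_le_iff of_nat_numeral of_nat_power)
    show "B1 j A \<in> sets (edge_costs n)" unfolding B1_def using finQ ev A by (intro sets.finite_UN) auto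
    show "measure (edge_costs n) (B1 j A) \<le> L * (2 * \<theta>) ^ (j + 1)" unfolding B1_def
      using finQ ev A \<open>real (card (QQ j A)) \<le> L\<close> \<theta> by (intro expo_prod.prob_UN_le) auto
  qed
  have B2: "B2 j \<in> sets (edge_costs n)" "measure (edge_costs n) (B2 j) \<le> L * (y ^ (K + 1) / real n)"
    if j: "j \<le> K" for j
  proof -
    show "B2 j \<in> sets (edge_costs n)" unfolding B2_def using fin B1 j by (intro sets.finite_UN) auto
    have "measure (edge_costs n) (B2 j) \<le> real n ^ j * (L * (2 * \<theta>) ^ (j + 1))" unfolding B2_def
      by (rule expo_prod.prob_UN_le[OF fin]) (use B1 j card_subsets_le \<theta> in \<open>auto simp: L_def\<close>)
    also have "\<dots> = L * (y ^ (j + 1) / real n)" using n by (simp add: y(1) power_divide)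
    also have "\<dots> \<le> L * (y ^ (K + 1) / real n)"
      using y j n by (intro mult_left_mono divide_right_mono power_increasing) (auto simp: L_def)
    finally show "measure (edge_costs n) (B2 j) \<le> L * (y ^ (K + 1) / real n)" .
  qed
  show ?thesis
  proof (rule that[of B])
    show "B \<in> sets (edge_costs n)" unfolding B_def using B2 by (intro sets.finite_UN) auto
    have "measure (edge_costs n) B \<le> (real K + 1) * (L * (y ^ (K + 1) / real n))" unfolding B_def
      by (rule expo_prod.prob_UN_le) (use B2 y n in \<open>auto simp: L_def\<close>)
    then show "measure (edge_costs n) B \<le> (real K + 1) * (2 ^ (K + 2)\<^sup>2 * ((2 * \<theta> * real n) ^ (K + 1) / real n))"
      by (simp add: L_def y_def)
    show "{c \<in> space (edge_costs n). \<not> locally_acyclic n c \<theta> K r s} \<subseteq> B"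
    proof
      fix c assume "c \<in> {c \<in> space (edge_costs n). \<not> locally_acyclic n c \<theta> K r s}"
      then obtain W Q where c: "c \<in> space (edge_costs n)" and W: "{r,s} \<subseteq> W" "W \<subseteq> {..<n}" "card W \<le> K"
        and Q: "Q \<subseteq> nsets W 2 - {{r,s}}" "card W \<le> card Q + 1" "\<forall>e\<in>Q. \<not> 2 * \<theta> \<le> c e"
        unfolding locally_acyclic_def by (auto simp del: insert_subset)
      define A where "A = W - {r,s}"
      have finW: "finite W" using W finite_subset by blast
      have WA: "W = A \<union> {r,s}" using W by (auto simp: A_def)
      have "card W = card A + card {r,s}" unfolding WA using finW rs by (intro card_Un_disjoint) (auto simp: A_def)
      then have cardA: "card W = card A + 2" using rs by simp
      have "Q \<in> QQ (card A) A" using Q(1,2) cardA unfolding QQ_def WA[symmetric] by auto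
      moreover have "c \<in> ev Q" using c Q(3) by (simp add: ev_def not_le)
      ultimately have "c \<in> B1 (card A) A" unfolding B1_def by (rule UN_I)
      moreover have A: "A \<subseteq> {..<n}" "card A \<le> K" using W cardA by (auto simp: A_def)
      ultimately have "c \<in> B2 (card A)" unfolding B2_def by (intro UN_I[of A]) simp_all
      then show "c \<in> B" unfolding B_def using A(2) by (intro UN_I[of "card A"]) simp_all
    qed
  qed
qed

section \<open>Mean cost as a sum over edges\<close>

text \<open>The mean of an exponential cost restricted to the event that it is below
  \<open>d\<close>, that is the integral of \<open>y * exp (- y)\<close> from 0 to
  \<open>d\<close>.\<close>

definition partial_mean :: "real \<Rightarrow> real" where
  "partial_mean d = 1 - (1 + d) * exp (- d)"

lemma borel_measurable_partial_mean [measurable]: "partial_mean \<in> borel_measurable borel"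
  unfolding partial_mean_def[abs_def] by measurable

lemma nn_integral_expo_below:
  assumes "0 \<le> d"
  shows "(\<integral>\<^sup>+y. ennreal (if y \<le> d then y else 0) \<partial>expo) = ennreal (partial_mean d)"
    and "(\<integral>\<^sup>+y. ennreal (if y < d then y else 0) \<partial>expo) = ennreal (partial_mean d)"
proof -
  have "(\<integral>\<^sup>+y. ennreal (if y \<le> d then y else 0) \<partial>expo) =
      (\<integral>\<^sup>+y. ennreal (exponential_density 1 y) * ennreal (if y \<le> d then y else 0) \<partial>lborel)"
    unfolding expo_def by (rule nn_integral_density) auto
  also have "\<dots> = (\<integral>\<^sup>+y. ennreal (y * exp (- y)) * indicator {0..d} y \<partial>lborel)"
    by (intro nn_integral_cong) (auto simp: erlang_density_def ennreal_mult[symmetric] mult.commute split: split_indicator)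
  also have "\<dots> = ennreal (- (1 + d) * exp (- d) - (- (1 + 0) * exp (- 0)))"
  proof (rule nn_integral_FTC_Icc)
    fix x :: real
    show "((\<lambda>y. - (1 + y) * exp (- y)) has_real_derivative x * exp (- x)) (at x)"
      by (auto intro!: derivative_eq_intros simp: algebra_simps)
  qed (use assms in auto)
  also have "\<dots> = ennreal (partial_mean d)" by (simp add: partial_mean_def algebra_simps)
  finally show 1: "(\<integral>\<^sup>+y. ennreal (if y \<le> d then y else 0) \<partial>expo) = ennreal (partial_mean d)" .
  have "AE y in expo. y \<noteq> d"
    unfolding expo_def by (subst AE_density) (auto intro: AE_mp[OF AE_lborel_singleton[of d]])
  then have "(\<integral>\<^sup>+y. ennreal (if y < d then y else 0) \<partial>expo) = (\<integral>\<^sup>+y. ennreal (if y \<le> d then y else 0) \<partial>expo)"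
    by (intro nn_integral_cong_AE) (auto elim!: eventually_mono)
  then show "(\<integral>\<^sup>+y. ennreal (if y < d then y else 0) \<partial>expo) = ennreal (partial_mean d)" using 1 by simp
qed

lemma partial_mean_le:
  assumes "0 \<le> d"
  shows "partial_mean d \<le> d\<^sup>2 / 2"
proof -
  have "(\<lambda>y. y\<^sup>2 / 2 - partial_mean y) 0 \<le> (\<lambda>y. y\<^sup>2 / 2 - partial_mean y) d"
  proof (rule DERIV_nonneg_imp_nondecreasing[OF assms])
    fix x :: real assume x: "0 \<le> x" "x \<le> d"
    have "((\<lambda>y. y\<^sup>2 / 2 - partial_mean y) has_real_derivative x - x * exp (- x)) (at x)"
      unfolding partial_mean_def by (auto intro!: derivative_eq_intros simp: algebra_simps)
    moreover have "0 \<le> x - x * exp (- x)" using x by (simp add: mult_left_le)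
    ultimately show "\<exists>y. ((\<lambda>y. y\<^sup>2 / 2 - partial_mean y) has_real_derivative y) (at x) \<and> 0 \<le> y" by blast
  qed
  then show ?thesis by (simp add: partial_mean_def)
qed

text \<open>The derivatives compare by exp(-x) \<ge> 1 - x. The cubic error is harmless: third
  moments of thresholds are O(1/n^3), and there are about n^2/2 edges.\<close>

lemma partial_mean_ge:
  assumes "0 \<le> d"
  shows "d\<^sup>2 / 2 - d ^ 3 / 3 \<le> partial_mean d"
proof -
  have "(\<lambda>y. partial_mean y - y\<^sup>2 / 2 + y ^ 3 / 3) 0 \<le> (\<lambda>y. partial_mean y - y\<^sup>2 / 2 + y ^ 3 / 3) d"
  proof (rule DERIV_nonneg_imp_nondecreasing[OF assms])
    fix x :: real assume x: "0 \<le> x" "x \<le> d"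
    have "((\<lambda>y. partial_mean y - y\<^sup>2 / 2 + y ^ 3 / 3) has_real_derivative x * exp (- x) - x + x\<^sup>2) (at x)"
      unfolding partial_mean_def by (auto intro!: derivative_eq_intros simp: algebra_simps)
    moreover have "0 \<le> x * exp (- x) - x + x\<^sup>2"
    proof -
      have "x * (1 - x) \<le> x * exp (- x)" using x exp_ge_add_one_self[of "- x"] by (intro mult_left_mono) auto
      then show ?thesis by (simp add: power2_eq_square algebra_simps)
    qed
    ultimately show "\<exists>y'. ((\<lambda>y. partial_mean y - y\<^sup>2 / 2 + y ^ 3 / 3) has_real_derivative y') (at x) \<and> 0 \<le> y'" by blast
  qed
  then show ?thesis by (simp add: partial_mean_def)
qed

lemma partial_mean_nonneg:
  assumes "0 \<le> d"
  shows "0 \<le> partial_mean d"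
proof -
  have "(1 + d) * exp (- d) \<le> exp d * exp (- d)"
    using exp_ge_add_one_self[of d] by (intro mult_right_mono) auto
  then show ?thesis by (simp add: partial_mean_def exp_minus)
qed

text \<open>The threshold ignores the cost of \<open>e\<close>, so that coordinate is integrated
  first with the threshold as a constant. The two versions agree because ties have probability
  0.\<close>

lemma nn_integral_below_threshold:
  assumes I: "finite I" "e \<in> I" and D: "D \<in> borel_measurable (expo_prod I)" "\<And>c. 0 \<le> D c"
      "depends_on (I - {e}) D"
  shows "(\<integral>\<^sup>+c. ennreal (if c e \<le> D c then c e else 0) \<partial>expo_prod I) = (\<integral>\<^sup>+c. ennreal (partial_mean (D c)) \<partial>expo_prod I)"
    and "(\<integral>\<^sup>+c. ennreal (if c e < D c then c e else 0) \<partial>expo_prod I) = (\<integral>\<^sup>+c. ennreal (partial_mean (D c)) \<partial>expo_prod I)"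
proof -
  have ins: "insert e (I - {e}) = I" using I by auto
  have split: "(\<integral>\<^sup>+c. f c \<partial>expo_prod I) = (\<integral>\<^sup>+x. \<integral>\<^sup>+y. f (x(e := y)) \<partial>expo \<partial>expo_prod (I - {e}))"
    if "f \<in> borel_measurable (expo_prod I)" for f
    using expo_PiM.product_nn_integral_insert[of "I - {e}" e f] I that unfolding ins expo_prod_def by simp
  note [measurable] = D(1) measurable_expo_prod_component[OF I(2)]
  have dep: "D (x(e := y)) = D x" for x y by (rule depends_onD[OF D(3)]) simp
  have "(\<integral>\<^sup>+c. ennreal (partial_mean (D c)) \<partial>expo_prod I) = (\<integral>\<^sup>+x. ennreal (partial_mean (D x)) \<partial>expo_prod (I - {e}))"
    using expo.emeasure_space_1 by (subst split) (simp_all add: dep)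
  moreover have "(\<integral>\<^sup>+c. ennreal (if c e \<le> D c then c e else 0) \<partial>expo_prod I) =
      (\<integral>\<^sup>+x. ennreal (partial_mean (D x)) \<partial>expo_prod (I - {e}))"
    by (subst split) (simp_all add: dep nn_integral_expo_below(1) D(2) cong: if_cong)
  moreover have "(\<integral>\<^sup>+c. ennreal (if c e < D c then c e else 0) \<partial>expo_prod I) =
      (\<integral>\<^sup>+x. ennreal (partial_mean (D x)) \<partial>expo_prod (I - {e}))"
    by (subst split) (simp_all add: dep nn_integral_expo_below(2) D(2) cong: if_cong)
  ultimately show "(\<integral>\<^sup>+c. ennreal (if c e \<le> D c then c e else 0) \<partial>expo_prod I) = (\<integral>\<^sup>+c. ennreal (partial_mean (D c)) \<partial>expo_prod I)"
    "(\<integral>\<^sup>+c. ennreal (if c e < D c then c e else 0) \<partial>expo_prod I) = (\<integral>\<^sup>+c. ennreal (partial_mean (D c)) \<partial>expo_prod I)"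
    by simp_all
qed

lemma borel_measurable_min_edge_cover_cost:
  assumes "E \<subseteq> complete_edges n"
  shows "(\<lambda>c. min_edge_cover_cost S E c) \<in> borel_measurable (edge_costs n)"
  unfolding min_edge_cover_cost_def
proof (rule borel_measurable_Min)
  show "finite {F. edge_cover S E F}"
    using assms finite_complete_edges finite_subset by (intro finite_edge_covers) blast
  fix F assume "F \<in> {F. edge_cover S E F}"
  then show "(\<lambda>c. sum c F) \<in> borel_measurable (edge_costs n)"
    using assms by (intro borel_measurable_sum measurable_expo_prod_component) (auto simp: edge_cover_def)
qed

lemma min_edge_cover_cost_cong:
  assumes "\<And>e. e \<in> E \<Longrightarrow> c e = c' e"
  shows "min_edge_cover_cost S E c = min_edge_cover_cost S E c'"
  unfolding min_edge_cover_cost_def using assms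
  by (intro arg_cong[where f = Min] image_cong refl sum.cong) (auto simp: edge_cover_def)

lemma borel_measurable_edge_threshold:
  "(\<lambda>c. edge_threshold c S (complete_edges n) e) \<in> borel_measurable (edge_costs n)"
  unfolding edge_threshold_def
  by (intro borel_measurable_diff borel_measurable_min_edge_cover_cost) auto

lemma depends_on_edge_threshold:
  "depends_on (complete_edges n - {e}) (\<lambda>c. edge_threshold c S (complete_edges n) e)"
  unfolding depends_on_def edge_threshold_def
  by (intro allI impI arg_cong2[where f = "(-)"] min_edge_cover_cost_cong) auto

text \<open>The two sums of \<open>min_edge_cover_cost_between\<close> have equal means, which
  squeezes the mean cost to an identity. The argument runs through extended nonnegative integrals,
  where integrability is not an issue.\<close>

lemma integral_min_edge_cover_cost:
  assumes n: "4 \<le> n"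
  shows "(\<integral>c. min_edge_cover_cost {..<n} (complete_edges n) c \<partial>edge_costs n) =
     (\<Sum>e\<in>complete_edges n. \<integral>c. partial_mean (edge_threshold c {..<n} (complete_edges n) e) \<partial>edge_costs n)"
proof -
  let ?E = "complete_edges n" and ?C = "\<lambda>c. min_edge_cover_cost {..<n} (complete_edges n) c"
  let ?D = "\<lambda>e c. edge_threshold c {..<n} (complete_edges n) e"
  have "{0,1} \<in> ?E" using n by (auto simp: mem_complete_edges)
  then have ne: "?E \<noteq> {}" by auto
  have D0: "0 \<le> ?D e c" for e c by (rule edge_threshold_nonneg[OF n])
  note [measurable] = borel_measurable_edge_threshold borel_measurable_min_edge_cover_cost[OF order.refl]
  have PM: "(\<lambda>c. partial_mean (?D e c)) \<in> borel_measurable (edge_costs n)" for e by measurable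
  have between: "AE c in edge_costs n. (\<Sum>e\<in>?E. if c e < ?D e c then c e else 0) \<le> ?C c \<and>
      ?C c \<le> (\<Sum>e\<in>?E. if c e \<le> ?D e c then c e else 0) \<and> (\<forall>e\<in>?E. 0 \<le> c e)"
    using AE_expo_prod_nonneg[OF finite_complete_edges, of n]
  proof eventually_elim
    case (elim c)
    then show ?case
      using min_edge_cover_cost_between[OF finite_complete_edges complete_edges_minus_cover[OF n] ne, of c] by blast
  qed
  have C0: "AE c in edge_costs n. 0 \<le> ?C c"
    using between
  proof eventually_elim
    case (elim c)
    have "0 \<le> (\<Sum>e\<in>?E. if c e < ?D e c then c e else 0)" using elim by (intro sum_nonneg) auto
    then show ?case using elim by linarith
  qed
  have int: "(\<integral>\<^sup>+c. ennreal (\<Sum>e\<in>?E. if R (c e) (?D e c) then c e else 0) \<partial>edge_costs n) =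
      (\<Sum>e\<in>?E. \<integral>\<^sup>+c. ennreal (partial_mean (?D e c)) \<partial>edge_costs n)"
    if R: "R = (<) \<or> R = (\<le>)" for R
  proof -
    let ?f = "\<lambda>e c. ennreal (if R (c e) (?D e c) then c e else 0)"
    have meas: "?f e \<in> borel_measurable (edge_costs n)" if "e \<in> ?E" for e
      using R measurable_expo_prod_component[OF that] by (elim disjE) simp_all
    have "(\<integral>\<^sup>+c. ennreal (\<Sum>e\<in>?E. if R (c e) (?D e c) then c e else 0) \<partial>edge_costs n) =
        (\<integral>\<^sup>+c. (\<Sum>e\<in>?E. ?f e c) \<partial>edge_costs n)"
    proof (rule nn_integral_cong_AE)
      show "AE c in edge_costs n. ennreal (\<Sum>e\<in>?E. if R (c e) (?D e c) then c e else 0) = (\<Sum>e\<in>?E. ?f e c)"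
        using between by eventually_elim (auto intro!: sum_ennreal[symmetric])
    qed
    also have "\<dots> = (\<Sum>e\<in>?E. \<integral>\<^sup>+c. ?f e c \<partial>edge_costs n)" using meas by (rule nn_integral_sum)
    also have "\<dots> = (\<Sum>e\<in>?E. \<integral>\<^sup>+c. ennreal (partial_mean (?D e c)) \<partial>edge_costs n)"
      using R nn_integral_below_threshold[OF finite_complete_edges _ borel_measurable_edge_threshold D0
          depends_on_edge_threshold] by (intro sum.cong refl) auto
    finally show ?thesis .
  qed
  have lo: "(\<Sum>e\<in>?E. \<integral>\<^sup>+c. ennreal (partial_mean (?D e c)) \<partial>edge_costs n) \<le> (\<integral>\<^sup>+c. ennreal (?C c) \<partial>edge_costs n)"
    unfolding int[of "(<)", OF disjI1[OF refl], symmetric] using between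
    by (intro nn_integral_mono_AE) (auto intro: ennreal_leI elim: eventually_mono)
  have hi: "(\<integral>\<^sup>+c. ennreal (?C c) \<partial>edge_costs n) \<le> (\<Sum>e\<in>?E. \<integral>\<^sup>+c. ennreal (partial_mean (?D e c)) \<partial>edge_costs n)"
    unfolding int[of "(\<le>)", OF disjI2[OF refl], symmetric] using between
    by (intro nn_integral_mono_AE) (auto intro: ennreal_leI elim: eventually_mono)
  have g: "\<bar>partial_mean (?D e c)\<bar> \<le> 1" for e c
    using partial_mean_nonneg[OF D0[of c e]] D0[of c e] by (auto simp: partial_mean_def)
  have nn: "(\<integral>\<^sup>+c. ennreal (partial_mean (?D e c)) \<partial>edge_costs n) =
      ennreal (\<integral>c. partial_mean (?D e c) \<partial>edge_costs n)" for e
    using PM g by (intro nn_integral_eq_integral all_moments_integrable expo_prod.all_moments_bounded)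
      (auto simp: partial_mean_nonneg D0)
  have "(\<integral>c. ?C c \<partial>edge_costs n) = enn2real (\<integral>\<^sup>+c. ennreal (?C c) \<partial>edge_costs n)"
    using C0 by (intro integral_eq_nn_integral) auto
  also have "(\<integral>\<^sup>+c. ennreal (?C c) \<partial>edge_costs n) = (\<Sum>e\<in>?E. \<integral>\<^sup>+c. ennreal (partial_mean (?D e c)) \<partial>edge_costs n)"
    using lo hi by (rule antisym[rotated])
  also have "\<dots> = ennreal (\<Sum>e\<in>?E. \<integral>c. partial_mean (?D e c) \<partial>edge_costs n)"
    unfolding nn by (intro sum_ennreal integral_nonneg_AE) (auto simp: partial_mean_nonneg D0)
  also have "enn2real \<dots> = (\<Sum>e\<in>?E. \<integral>c. partial_mean (?D e c) \<partial>edge_costs n)"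
    by (intro enn2real_ennreal sum_nonneg integral_nonneg_AE) (auto simp: partial_mean_nonneg D0)
  finally show ?thesis .
qed

text \<open>Outside the atypical set \<open>B\<close> the sandwich replaces the threshold by its
  truncation \<open>Y k\<close>; inside \<open>B\<close> everything is dominated by
  \<open>Y 0\<close>, whose contribution is split off by Cauchy-Schwarz. The factor (n - 2)^2 is the
  scale on which a single edge has a limit.\<close>

lemma integral_partial_mean_bounds:
  assumes uv: "u < n" "v < n" "u \<noteq> v" and n: "4 * k + 12 \<le> n"
    and \<theta>: "0 \<le> \<theta>" "2 * \<theta> \<le> 1" "1 \<le> 2 * \<theta> * real n"
  defines "l \<equiv> 4 * mean_msg (Suc k) + 2 * (mean_msg (Suc k))\<^sup>2"
    and "s \<equiv> 14 * sqrt (bad_bound n \<theta> (k + 5))"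
    and "D \<equiv> \<lambda>c. edge_threshold c {..<n} (complete_edges n) {u,v}"
  shows "even k \<Longrightarrow> (real n - 2)\<^sup>2 * (\<integral>c. partial_mean (D c) \<partial>edge_costs n) \<le> (l + threshold_error k n) / 2 + s"
    and "odd k \<Longrightarrow> (l - threshold_error k n) / 2 - s - 32 / (real n - 2) \<le>
        (real n - 2)\<^sup>2 * (\<integral>c. partial_mean (D c) \<partial>edge_costs n)"
proof -
  let ?E = "\<lambda>f. integral\<^sup>L (edge_costs n) f"
  define m where "m = real n - 2"
  have m: "10 \<le> m" using n by (simp add: m_def)
  have n4: "4 \<le> n" "3 \<le> n" "k + 5 + 2 \<le> n" "k + 5 + 4 \<le> n" using n by auto
  obtain B1 where B1: "B1 \<in> sets (edge_costs n)" "{c \<in> space (edge_costs n). \<not> cheap_escape n c \<theta> (k + 5)} \<subseteq> B1"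
    "measure (edge_costs n) B1 \<le> (real (k + 5) + 1) * (real n ^ (k + 5 + 1) * exp (- \<theta> * (real n - real (k + 5) - 1)))"
    using not_cheap_escape_prob[OF \<theta>(1) n4(3)] .
  obtain B2 where B2: "B2 \<in> sets (edge_costs n)" "{c \<in> space (edge_costs n). \<not> locally_acyclic n c \<theta> (k + 5) u v} \<subseteq> B2"
    "measure (edge_costs n) B2 \<le> (real (k + 5) + 1) * (2 ^ (k + 5 + 2)\<^sup>2 * ((2 * \<theta> * real n) ^ (k + 5 + 1) / real n))"
    using not_locally_acyclic_prob[OF \<theta> uv] .
  define B where "B = B1 \<union> B2"
  have B: "B \<in> sets (edge_costs n)" using B1 B2 by (simp add: B_def)
  have pB: "measure (edge_costs n) B \<le> bad_bound n \<theta> (k + 5)"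
    unfolding B_def bad_bound_def
    by (rule order_trans[OF measure_Un_le[OF B1(1) B2(1)] add_mono[OF B1(3) B2(3)]])
  define Y where "Y = (\<lambda>j c. local_threshold n c j u v)"
  have amY: "all_moments (edge_costs n) (Y j)" for j unfolding Y_def by (intro all_moments_local_threshold uv)
  have Y0: "0 \<le> Y j c" "Y j c \<le> Y 0 c" for j c
    unfolding Y_def by (rule local_threshold_nonneg, rule local_threshold_le_0[OF n4(2)])
  have D0: "0 \<le> D c" "D c \<le> Y 0 c" for c
    unfolding D_def Y_def by (rule edge_threshold_nonneg[OF n4(1)], rule edge_threshold_le_local_0[OF n4(1) uv])
  have sandwich: "if even k then D c \<le> Y k c else Y k c \<le> D c" if "c \<in> space (edge_costs n)" "c \<notin> B" for c
    unfolding D_def Y_def using that B1(2) B2(2) n4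
    by (intro edge_threshold_sandwich[OF uv \<theta>(1)]) (auto simp: B_def)
  have ind: "(indicator B :: _ \<Rightarrow> real) \<in> borel_measurable (edge_costs n)" using B by simp
  have amI: "all_moments (edge_costs n) (indicator B)"
    by (rule expo_prod.all_moments_bounded[OF ind, of 1]) (simp split: split_indicator)
  have bad: "m\<^sup>2 * ?E (\<lambda>c. (Y 0 c)\<^sup>2 * indicator B c) \<le> 2 * s"
  proof -
    have "?E (\<lambda>c. (Y 0 c)\<^sup>2 * indicator B c) = ?E (\<lambda>c. \<bar>(Y 0 c)\<^sup>2\<bar> * \<bar>indicator B c\<bar>)" by simp
    also have "\<dots> \<le> sqrt (?E (\<lambda>c. ((Y 0 c)\<^sup>2)\<^sup>2)) * sqrt (?E (\<lambda>c. (indicator B c)\<^sup>2))"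
      by (intro expo_prod.expectation_cauchy_schwarz expo_prod.all_moments_power amY amI)
    also have "\<dots> \<le> (28 / m\<^sup>2) * sqrt (bad_bound n \<theta> (k + 5))"
    proof (rule mult_mono)
      have "?E (\<lambda>c. Y 0 c ^ 4) \<le> 2 ^ (4 + 1) * fact 4 / m ^ 4"
        unfolding Y_def m_def by (rule integral_local_threshold_0_power[OF uv n4(2)]) simp
      \<comment> \<open>2^5 * 4! = 768 is at most 784 = 28^2; half of 28 is the 14 in
        \<open>s\<close>.\<close>
      also have "\<dots> \<le> (28 / m\<^sup>2)\<^sup>2"
        by (simp add: power_divide fact_numeral divide_right_mono)
      finally have "?E (\<lambda>c. ((Y 0 c)\<^sup>2)\<^sup>2) \<le> (28 / m\<^sup>2)\<^sup>2" by (simp add: power_mult[symmetric])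
      then show "sqrt (?E (\<lambda>c. ((Y 0 c)\<^sup>2)\<^sup>2)) \<le> 28 / m\<^sup>2" by (intro real_le_lsqrt) auto
      have "?E (\<lambda>c. (indicator B c :: real)\<^sup>2) = ?E (indicator B)"
        by (intro Bochner_Integration.integral_cong refl) (auto simp: indicator_def)
      also have "\<dots> = measure (edge_costs n) B" using B by simp
      finally show "sqrt (?E (\<lambda>c. (indicator B c)\<^sup>2)) \<le> sqrt (bad_bound n \<theta> (k + 5))" using pB by simp
    qed auto
    finally have "m\<^sup>2 * ?E (\<lambda>c. (Y 0 c)\<^sup>2 * indicator B c) \<le> m\<^sup>2 * ((28 / m\<^sup>2) * sqrt (bad_bound n \<theta> (k + 5)))"
      by (intro mult_left_mono) auto
    then show ?thesis using m by (simp add: s_def)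
  qed
  have Yk: "\<bar>m\<^sup>2 * ?E (\<lambda>c. (Y k c)\<^sup>2) - l\<bar> \<le> threshold_error k n"
    unfolding m_def l_def Y_def by (rule integral_local_threshold_sq[OF uv n])
  have Dm: "D \<in> borel_measurable (edge_costs n)" unfolding D_def by (rule borel_measurable_edge_threshold)
  have "\<bar>partial_mean (D c)\<bar> \<le> 1" for c
    using partial_mean_nonneg[OF D0(1), of c] D0(1)[of c] by (auto simp: partial_mean_def)
  then have amg: "all_moments (edge_costs n) (\<lambda>c. partial_mean (D c))"
    by (rule expo_prod.all_moments_bounded[OF measurable_compose[OF Dm borel_measurable_partial_mean]])
  have int: "integrable (edge_costs n) (\<lambda>c. (Y k c)\<^sup>2)" "integrable (edge_costs n) (\<lambda>c. (Y 0 c)\<^sup>2 * indicator B c)"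
    "integrable (edge_costs n) (\<lambda>c. (Y 0 c) ^ 3)" "integrable (edge_costs n) (\<lambda>c. partial_mean (D c))"
    by (intro all_moments_intros amY amI amg)+
  show "even k \<Longrightarrow> (real n - 2)\<^sup>2 * ?E (\<lambda>c. partial_mean (D c)) \<le> (l + threshold_error k n) / 2 + s"
  proof -
    assume k: "even k"
    have "?E (\<lambda>c. partial_mean (D c)) \<le> ?E (\<lambda>c. (Y k c)\<^sup>2 / 2 + (Y 0 c)\<^sup>2 * indicator B c / 2)"
    proof (rule integral_mono)
      fix c assume c: "c \<in> space (edge_costs n)"
      have g: "partial_mean (D c) \<le> (D c)\<^sup>2 / 2" by (rule partial_mean_le[OF D0(1)])
      show "partial_mean (D c) \<le> (Y k c)\<^sup>2 / 2 + (Y 0 c)\<^sup>2 * indicator B c / 2"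
      proof (cases "c \<in> B")
        case True
        have "(D c)\<^sup>2 \<le> (Y 0 c)\<^sup>2" using D0 by (intro power_mono)
        moreover have "0 \<le> (Y k c)\<^sup>2" by simp
        ultimately show ?thesis using g unfolding indicator_simps(1)[OF True] by linarith
      next
        case False
        then have "(D c)\<^sup>2 \<le> (Y k c)\<^sup>2" using sandwich[OF c False] k D0 by (intro power_mono) auto
        then show ?thesis using g False by simp
      qed
    qed (use int in \<open>auto intro!: Bochner_Integration.integrable_add\<close>)
    also have "\<dots> = ?E (\<lambda>c. (Y k c)\<^sup>2) / 2 + ?E (\<lambda>c. (Y 0 c)\<^sup>2 * indicator B c) / 2"
      using int by simp
    finally have "m\<^sup>2 * ?E (\<lambda>c. partial_mean (D c)) \<le> m\<^sup>2 * (?E (\<lambda>c. (Y k c)\<^sup>2) / 2 + ?E (\<lambda>c. (Y 0 c)\<^sup>2 * indicator B c) / 2)"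
      by (intro mult_left_mono) auto
    also have "\<dots> = (m\<^sup>2 * ?E (\<lambda>c. (Y k c)\<^sup>2)) / 2 + (m\<^sup>2 * ?E (\<lambda>c. (Y 0 c)\<^sup>2 * indicator B c)) / 2"
      by (simp add: algebra_simps)
    also have "\<dots> \<le> (l + threshold_error k n) / 2 + s"
    proof -
      have "a / 2 + b / 2 \<le> (l + e) / 2 + s" if "\<bar>a - l\<bar> \<le> e" "b \<le> 2 * s" for a b e l s :: real
        using that by (simp add: field_simps)
      from this[OF Yk bad] show ?thesis .
    qed
    finally show ?thesis by (simp add: m_def)
  qed
  show "odd k \<Longrightarrow> (l - threshold_error k n) / 2 - s - 32 / (real n - 2) \<le> (real n - 2)\<^sup>2 * ?E (\<lambda>c. partial_mean (D c))"
  proof -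
    assume k: "odd k"
    \<comment> \<open>Here 96 = 2^4 * 3!, and the coefficient 1/3 of the cubic term turns it into
      the 32 of the statement.\<close>
    have cube: "m\<^sup>2 * ?E (\<lambda>c. (Y 0 c) ^ 3) \<le> 96 / m"
    proof -
      have "?E (\<lambda>c. Y 0 c ^ 3) \<le> 2 ^ (3 + 1) * fact 3 / m ^ 3"
        unfolding Y_def m_def by (rule integral_local_threshold_0_power[OF uv n4(2)]) simp
      then have "m\<^sup>2 * ?E (\<lambda>c. (Y 0 c) ^ 3) \<le> m\<^sup>2 * (96 / m ^ 3)"
        by (intro mult_left_mono) (auto simp: fact_numeral)
      then show ?thesis using m by (simp add: power2_eq_square power3_eq_cube)
    qed
    have "?E (\<lambda>c. (Y k c)\<^sup>2 / 2 - (Y 0 c)\<^sup>2 * indicator B c / 2 - (Y 0 c) ^ 3 / 3) \<le> ?E (\<lambda>c. partial_mean (D c))"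
    proof (rule integral_mono)
      fix c assume c: "c \<in> space (edge_costs n)"
      have Y3: "0 \<le> (Y 0 c) ^ 3" using Y0 by simp
      show "(Y k c)\<^sup>2 / 2 - (Y 0 c)\<^sup>2 * indicator B c / 2 - (Y 0 c) ^ 3 / 3 \<le> partial_mean (D c)"
      proof (cases "c \<in> B")
        case True
        have "(Y k c)\<^sup>2 \<le> (Y 0 c)\<^sup>2" using Y0 by (intro power_mono)
        then show ?thesis using Y3 partial_mean_nonneg[OF D0(1), of c]
          unfolding indicator_simps(1)[OF True] by linarith
      next
        case False
        have "(Y k c)\<^sup>2 \<le> (D c)\<^sup>2" using sandwich[OF c False] k Y0 by (intro power_mono) auto
        moreover have "(D c) ^ 3 \<le> (Y 0 c) ^ 3" using D0 by (intro power_mono)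
        ultimately show ?thesis using False partial_mean_ge[OF D0(1), of c] by simp
      qed
    qed (use int in \<open>auto intro!: Bochner_Integration.integrable_diff\<close>)
    also have "?E (\<lambda>c. (Y k c)\<^sup>2 / 2 - (Y 0 c)\<^sup>2 * indicator B c / 2 - (Y 0 c) ^ 3 / 3) =
        ?E (\<lambda>c. (Y k c)\<^sup>2) / 2 - ?E (\<lambda>c. (Y 0 c)\<^sup>2 * indicator B c) / 2 - ?E (\<lambda>c. (Y 0 c) ^ 3) / 3"
      using int by simp
    finally have "m\<^sup>2 * (?E (\<lambda>c. (Y k c)\<^sup>2) / 2 - ?E (\<lambda>c. (Y 0 c)\<^sup>2 * indicator B c) / 2 - ?E (\<lambda>c. (Y 0 c) ^ 3) / 3) \<le> m\<^sup>2 * ?E (\<lambda>c. partial_mean (D c))"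
      by (intro mult_left_mono) auto
    also have "m\<^sup>2 * (?E (\<lambda>c. (Y k c)\<^sup>2) / 2 - ?E (\<lambda>c. (Y 0 c)\<^sup>2 * indicator B c) / 2 - ?E (\<lambda>c. (Y 0 c) ^ 3) / 3) = (m\<^sup>2 * ?E (\<lambda>c. (Y k c)\<^sup>2)) / 2 - (m\<^sup>2 * ?E (\<lambda>c. (Y 0 c)\<^sup>2 * indicator B c)) / 2 - (m\<^sup>2 * ?E (\<lambda>c. (Y 0 c) ^ 3)) / 3"
      by (simp add: algebra_simps)
    finally have low: "(m\<^sup>2 * ?E (\<lambda>c. (Y k c)\<^sup>2)) / 2 - (m\<^sup>2 * ?E (\<lambda>c. (Y 0 c)\<^sup>2 * indicator B c)) / 2 -
        (m\<^sup>2 * ?E (\<lambda>c. (Y 0 c) ^ 3)) / 3 \<le> m\<^sup>2 * ?E (\<lambda>c. partial_mean (D c))" .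
    have "(l - threshold_error k n) / 2 - s - 32 / m \<le> m\<^sup>2 * ?E (\<lambda>c. partial_mean (D c))"
    proof -
      have "(l - e) / 2 - s - x \<le> g"
        if "\<bar>a - l\<bar> \<le> e" "b \<le> 2 * s" "d \<le> 3 * x" "a / 2 - b / 2 - d / 3 \<le> g" for a b d e l s x g :: real
        using that by (simp add: field_simps)
      from this[OF Yk bad _ low] show ?thesis using cube by simp
    qed
    then show ?thesis by (simp add: m_def)
  qed
qed

section \<open>The limit\<close>

text \<open>With \<theta> = ln^2 n / n the first part of \<open>bad_bound\<close> is about n^(K + 1)
  exp(-ln^2 n), which vanishes for every fixed \<open>K\<close>, while 2 \<theta> n = 2 ln^2 n grows
  so slowly that the factor 1/n wins in the second part.\<close>

lemma bad_bound_tendsto_0: "(\<lambda>n. bad_bound n ((ln (real n))\<^sup>2 / real n) K) \<longlonglongrightarrow> 0"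
proof -
  have 1: "(\<lambda>n. real n ^ (K + 1) * exp (- ((ln (real n))\<^sup>2 / real n) * (real n - real K - 1))) \<longlonglongrightarrow> 0"
    by real_asymp
  have 2: "(\<lambda>n. (2 * ((ln (real n))\<^sup>2 / real n) * real n) ^ (K + 1) / real n) \<longlonglongrightarrow> 0"
    by real_asymp
  have "(\<lambda>n. (real K + 1) * (real n ^ (K + 1) * exp (- ((ln (real n))\<^sup>2 / real n) * (real n - real K - 1))) +
     (real K + 1) * (2 ^ (K + 2)\<^sup>2 * ((2 * ((ln (real n))\<^sup>2 / real n) * real n) ^ (K + 1) / real n)))
     \<longlonglongrightarrow> (real K + 1) * 0 + (real K + 1) * (2 ^ (K + 2)\<^sup>2 * 0)"
    by (intro tendsto_intros 1 2)
  then show ?thesis by (simp add: bad_bound_def)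
qed

lemma card_complete_edges: "real (card (complete_edges n)) = real n * (real n - 1) / 2"
proof -
  have "card (complete_edges n) = n choose 2"
    by (simp add: complete_edges_def complete_vertices_def card_nsets)
  moreover have "even (n * (n - 1))" by (cases n) auto
  then have "2 * (n choose 2) = n * (n - 1)" by (simp add: choose_two del: even_mult_iff)
  then have "real (2 * (n choose 2)) = real (n * (n - 1))" by (simp only:)
  then have "2 * real (n choose 2) = real n * (real n - 1)"
    by (cases n) (simp_all add: algebra_simps del: binomial_Suc_Suc)
  ultimately show ?thesis by simp
qed

definition mean_cost :: "nat \<Rightarrow> real" where
  "mean_cost n = (\<integral>c. min_edge_cover_cost {..<n} (complete_edges n) c \<partial>edge_costs n)"

text \<open>The ratio \<open>r n\<close> of the number of edges to (n - 2)^2 tends to 1/2, and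
  \<open>l\<close> is normalised so that the scaled bound per edge tends to
  \<open>4 * l / 2\<close>; the product is \<open>l\<close>. At a fixed depth only one inequality is
  available.\<close>

lemma mean_cost_bounds:
  fixes k :: nat
  defines "l \<equiv> mean_msg (Suc k) + (mean_msg (Suc k))\<^sup>2 / 2"
  obtains f where "f \<longlonglongrightarrow> l" 
    "\<forall>\<^sub>F n in sequentially. if even k then mean_cost n \<le> f n else f n \<le> mean_cost n"
proof -
  define s where "s = (\<lambda>n. 14 * sqrt (bad_bound n ((ln (real n))\<^sup>2 / real n) (k + 5)))"
  define r where "r = (\<lambda>n. real n * (real n - 1) / 2 / (real n - 2)\<^sup>2)"
  define f where "f = (\<lambda>n. if even k then r n * ((4 * l + threshold_error k n) / 2 + s n)
     else r n * ((4 * l - threshold_error k n) / 2 - s n - 32 / (real n - 2)))"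
  have l: "4 * mean_msg (Suc k) + 2 * (mean_msg (Suc k))\<^sup>2 = 4 * l" by (simp add: l_def)
  have r: "r \<longlonglongrightarrow> 1 / 2" unfolding r_def by real_asymp
  have s: "s \<longlonglongrightarrow> 14 * sqrt 0" unfolding s_def by (intro tendsto_intros bad_bound_tendsto_0)
  have e: "(\<lambda>n. threshold_error k n) \<longlonglongrightarrow> 0" by (rule threshold_error_tendsto_0)
  have t: "(\<lambda>n. 32 / (real n - 2)) \<longlonglongrightarrow> 0" by real_asymp
  have "f \<longlonglongrightarrow> l"
  proof (cases "even k")
    case True
    have "(\<lambda>n. r n * ((4 * l + threshold_error k n) / 2 + s n)) \<longlonglongrightarrow> 1 / 2 * ((4 * l + 0) / 2 + 14 * sqrt 0)"
      by (intro tendsto_intros r s e) auto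
    then show ?thesis using True by (simp add: f_def)
  next
    case False
    have "(\<lambda>n. r n * ((4 * l - threshold_error k n) / 2 - s n - 32 / (real n - 2))) \<longlonglongrightarrow>
        1 / 2 * ((4 * l - 0) / 2 - 14 * sqrt 0 - 0)"
      by (intro tendsto_intros r s e t) auto
    then show ?thesis using False by (simp add: f_def)
  qed
  moreover have "\<forall>\<^sub>F n in sequentially. if even k then mean_cost n \<le> f n else f n \<le> mean_cost n"
  proof -
    have "\<forall>\<^sub>F n in sequentially. 2 * ((ln (real n))\<^sup>2 / real n) \<le> 1" by real_asymp
    moreover have "\<forall>\<^sub>F n in sequentially. 1 \<le> 2 * ((ln (real n))\<^sup>2 / real n) * real n" by real_asymp
    moreover have "\<forall>\<^sub>F n in sequentially. 4 * k + 12 \<le> n" by (rule eventually_ge_at_top)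
    ultimately show ?thesis
    proof eventually_elim
      case (elim n)
      let ?\<theta> = "(ln (real n))\<^sup>2 / real n" and ?N = "complete_edges n"
      let ?I = "\<lambda>e. \<integral>c. partial_mean (edge_threshold c {..<n} ?N e) \<partial>edge_costs n"
      have m: "0 < (real n - 2)\<^sup>2" using elim by simp
      have mc: "mean_cost n = (\<Sum>e\<in>?N. ?I e)"
        unfolding mean_cost_def using elim by (intro integral_min_edge_cover_cost) auto
      have rn: "r n * x = real (card ?N) * (x / (real n - 2)\<^sup>2)" for x
        by (simp add: r_def card_complete_edges)
      have theta: "0 \<le> ?\<theta>" by simp
      note bounds = integral_partial_mean_bounds[OF _ _ _ elim(3) theta elim(1,2), unfolded l, folded s_def]
      show ?case
      proof (cases "even k")
        case True
        have "mean_cost n \<le> (\<Sum>e\<in>?N. ((4 * l + threshold_error k n) / 2 + s n) / (real n - 2)\<^sup>2)"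
          unfolding mc
        proof (rule sum_mono)
          fix e assume "e \<in> ?N"
          then obtain u v where uv: "e = {u,v}" "u < n" "v < n" "u \<noteq> v" by (rule complete_edgesE)
          have "(real n - 2)\<^sup>2 * ?I e \<le> (4 * l + threshold_error k n) / 2 + s n"
            unfolding uv(1) s_def by (rule bounds(1)[OF uv(2-4) True])
          then show "?I e \<le> ((4 * l + threshold_error k n) / 2 + s n) / (real n - 2)\<^sup>2"
            using m by (simp add: pos_le_divide_eq mult.commute)
        qed
        also have "\<dots> = f n" using True by (simp add: f_def rn)
        finally show ?thesis using True by simp
      next
        case False
        have "f n = (\<Sum>e\<in>?N. ((4 * l - threshold_error k n) / 2 - s n - 32 / (real n - 2)) / (real n - 2)\<^sup>2)"
          using False by (simp add: f_def rn)
        also have "\<dots> \<le> mean_cost n"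
          unfolding mc
        proof (rule sum_mono)
          fix e assume "e \<in> ?N"
          then obtain u v where uv: "e = {u,v}" "u < n" "v < n" "u \<noteq> v" by (rule complete_edgesE)
          have "(4 * l - threshold_error k n) / 2 - s n - 32 / (real n - 2) \<le> (real n - 2)\<^sup>2 * ?I e"
            unfolding uv(1) s_def by (rule bounds(2)[OF uv(2-4) False])
          then show "((4 * l - threshold_error k n) / 2 - s n - 32 / (real n - 2)) / (real n - 2)\<^sup>2 \<le> ?I e"
            using m by (simp add: pos_divide_le_eq mult.commute)
        qed
        finally show ?thesis using False by simp
      qed
    qed
  qed
  ultimately show ?thesis by (rule that)
qed

section \<open>Convergence to the fixed point\<close>

lemma exp_minus_contraction:
  fixes x y a :: real
  assumes "a \<le> x" "a \<le> y"
  shows "\<bar>exp (- x) - exp (- y)\<bar> \<le> exp (- a) * \<bar>x - y\<bar>"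
proof -
  have "exp (- x) = exp (- a) * exp (- (x - a))" "exp (- y) = exp (- a) * exp (- (y - a))"
    by (simp_all add: exp_add[symmetric])
  then have "\<bar>exp (- x) - exp (- y)\<bar> = \<bar>exp (- a) * (exp (- (x - a)) - exp (- (y - a)))\<bar>"
    by (simp only: right_diff_distrib)
  also have "\<dots> = exp (- a) * \<bar>exp (- (x - a)) - exp (- (y - a))\<bar>"
    by (simp add: abs_mult)
  also have "\<dots> \<le> exp (- a) * \<bar>(x - a) - (y - a)\<bar>"
    using assms by (intro mult_left_mono abs_exp_minus_diff_le) auto
  finally show ?thesis by simp
qed

text \<open>The map exp(-x) has slope -1 at 0, so it is no strict contraction on the whole interval
  from 0 to 1. From index 1 on, however, the iterates stay between exp(-1) and 1, as does
  \<open>lambert_W 1\<close>, and there the map contracts with factor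
  \<open>q = exp (- exp (- 1))\<close>.\<close>

lemma mean_msg_tendsto: "mean_msg \<longlonglongrightarrow> lambert_W 1"
proof -
  define W where "W = lambert_W 1"
  have W: "0 \<le> W" "W * exp W = 1"
    using lambert_W_nonneg[of 1] lambert_W_times_exp[of 1] by (auto simp: W_def)
  then have W': "W = exp (- W)" by (simp add: exp_minus field_simps)
  have "W \<le> 1" using W W' by (metis exp_le_one_iff neg_le_0_iff_le)
  then have Wge: "exp (- 1) \<le> W" using W' by (metis exp_le_cancel_iff neg_le_iff_le)
  have ge: "exp (- 1) \<le> mean_msg (Suc k)" for k using mean_msg_le_1[of k] by simp
  define q :: real where "q = exp (- exp (- 1))"
  have q: "0 \<le> q" "q < 1" by (auto simp: q_def)
  have bd: "\<bar>mean_msg (Suc k) - W\<bar> \<le> q ^ k" for k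
  proof (induction k)
    case 0
    show ?case using W \<open>W \<le> 1\<close> by simp
  next
    case (Suc k)
    have "\<bar>mean_msg (Suc (Suc k)) - W\<bar> = \<bar>exp (- mean_msg (Suc k)) - exp (- W)\<bar>" using W' by simp
    also have "\<dots> \<le> q * \<bar>mean_msg (Suc k) - W\<bar>"
      unfolding q_def by (rule exp_minus_contraction[OF ge Wge])
    also have "\<dots> \<le> q * q ^ k" using Suc q by (intro mult_left_mono)
    finally show ?case by simp
  qed
  have "(\<lambda>k. mean_msg (Suc k) - W) \<longlonglongrightarrow> 0"
    by (rule tendsto_rabs_zero_cancel, rule tendsto_sandwich[OF _ _ tendsto_const LIMSEQ_realpow_zero[OF q]])
      (use bd in \<open>auto simp del: mean_msg.simps intro!: always_eventually\<close>)
  then have "(\<lambda>k. mean_msg (Suc k)) \<longlonglongrightarrow> W" by (simp only: LIM_zero_iff)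
  then show ?thesis unfolding W_def by (simp only: filterlim_sequentially_Suc)
qed

text \<open>The limit in \<open>n\<close> is taken at fixed depth before the depth grows. Because
  \<open>mean_msg\<close> converges instead of oscillating between two values, odd depths (lower
  bounds) and even depths (upper bounds) lead to the same limit.\<close>

lemma mean_cost_tendsto: "mean_cost \<longlonglongrightarrow> lambert_W 1 + (lambert_W 1)\<^sup>2 / 2"
proof -
  define l where "l = (\<lambda>k. mean_msg (Suc k) + (mean_msg (Suc k))\<^sup>2 / 2)"
  define L where "L = lambert_W 1 + (lambert_W 1)\<^sup>2 / 2"
  have "(\<lambda>k. mean_msg (Suc k)) \<longlonglongrightarrow> lambert_W 1"
    using mean_msg_tendsto by (simp only: filterlim_sequentially_Suc)
  then have l: "l \<longlonglongrightarrow> L" unfolding l_def L_def by (intro tendsto_intros) auto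
  have ex: "\<exists>k. P k \<and> Q (l k)" if ev: "\<forall>\<^sub>F k in sequentially. Q (l k)" and P: "P = even \<or> P = odd" for P Q
  proof -
    obtain N where N: "\<And>k. k \<ge> N \<Longrightarrow> Q (l k)" using ev unfolding eventually_sequentially by blast
    have "even (2 * N) \<and> Q (l (2 * N))" "odd (2 * N + 1) \<and> Q (l (2 * N + 1))"
      using N[of "2 * N"] N[of "2 * N + 1"] by auto
    then show ?thesis using P by blast
  qed
  have "mean_cost \<longlonglongrightarrow> L"
  proof (rule order_tendstoI)
    fix a assume "a < L"
    then have "\<forall>\<^sub>F k in sequentially. a < l k" using l by (simp add: order_tendsto_iff)
    then obtain k where k: "odd k" "a < l k" using ex[of "\<lambda>x. a < x" odd] by auto
    obtain f where f: "f \<longlonglongrightarrow> l k"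
      "\<forall>\<^sub>F n in sequentially. if even k then mean_cost n \<le> f n else f n \<le> mean_cost n"
      using mean_cost_bounds[of k] unfolding l_def by blast
    have "\<forall>\<^sub>F n in sequentially. a < f n" using f(1) k by (simp add: order_tendsto_iff)
    then show "\<forall>\<^sub>F n in sequentially. a < mean_cost n" using f(2)
      by eventually_elim (use k in auto)
  next
    fix a assume "L < a"
    then have "\<forall>\<^sub>F k in sequentially. l k < a" using l by (simp add: order_tendsto_iff)
    then obtain k where k: "even k" "l k < a" using ex[of "\<lambda>x. x < a" even] by auto
    obtain f where f: "f \<longlonglongrightarrow> l k"
      "\<forall>\<^sub>F n in sequentially. if even k then mean_cost n \<le> f n else f n \<le> mean_cost n"
      using mean_cost_bounds[of k] unfolding l_def by blast
    have "\<forall>\<^sub>F n in sequentially. f n < a" using f(1) k by (simp add: order_tendsto_iff)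
    then show "\<forall>\<^sub>F n in sequentially. mean_cost n < a" using f(2)
      by eventually_elim (use k in auto)
  qed
  then show ?thesis by (simp only: L_def)
qed

section \<open>Transfer to arbitrary probability spaces\<close>

text \<open>Independence makes the joint law of the costs, restricted to the edges, the product
  measure \<open>edge_costs n\<close>. The restriction is harmless because the cover cost reads
  edges only.\<close>

lemma (in prob_space) expectation_min_edge_cover_cost:
  assumes n: "2 \<le> n"
    and indep: "indep_vars (\<lambda>_. borel) cost (complete_edges n)"
    and dist: "\<And>e. e \<in> complete_edges n \<Longrightarrow> distributed M lborel (cost e) (exponential_density 1)"
  shows "expectation (\<lambda>\<omega>. min_edge_cover_cost {..<n} (complete_edges n) (\<lambda>e. cost e \<omega>)) = mean_cost n"
proof -
  let ?E = "complete_edges n"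
  let ?X = "\<lambda>\<omega>. \<lambda>e\<in>?E. cost e \<omega>"
  have "{0,1} \<in> ?E" using n by (auto simp: mem_complete_edges)
  then have ne: "?E \<noteq> {}" by auto
  have rv: "random_variable borel (cost e)" if "e \<in> ?E" for e
    using distributed_measurable[OF dist[OF that]] by simp
  have law: "distr M borel (cost e) = expo" if "e \<in> ?E" for e
  proof -
    have "distr M borel (cost e) = distr M lborel (cost e)" by (rule distr_cong) auto
    then show ?thesis using distributed_distr_eq_density[OF dist[OF that]] by (simp add: expo_def)
  qed
  have "distr M (Pi\<^sub>M ?E (\<lambda>_. borel)) ?X = Pi\<^sub>M ?E (\<lambda>e. distr M borel (cost e))"
    by (rule iffD1[OF indep_vars_iff_distr_eq_PiM'[OF ne rv] indep])
  also have "\<dots> = edge_costs n" unfolding expo_prod_def by (rule PiM_cong) (auto simp: law)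
  finally have eq: "distr M (Pi\<^sub>M ?E (\<lambda>_. borel)) ?X = edge_costs n" .
  have sets: "sets (edge_costs n) = sets (Pi\<^sub>M ?E (\<lambda>_. borel))"
    unfolding expo_prod_def by (rule sets_PiM_cong) auto
  have "(\<lambda>c. min_edge_cover_cost {..<n} ?E c) \<in> borel_measurable (edge_costs n)"
    by (rule borel_measurable_min_edge_cover_cost) simp
  then have meas: "(\<lambda>c. min_edge_cover_cost {..<n} ?E c) \<in> borel_measurable (Pi\<^sub>M ?E (\<lambda>_. borel))"
    by (simp add: measurable_cong_sets[OF sets refl])
  have X: "?X \<in> measurable M (Pi\<^sub>M ?E (\<lambda>_. borel))"
    by (rule measurable_restrict) (rule rv)
  have "mean_cost n = expectation (\<lambda>\<omega>. min_edge_cover_cost {..<n} ?E (?X \<omega>))"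
    unfolding mean_cost_def eq[symmetric] by (rule integral_distr[OF X meas])
  also have "\<dots> = expectation (\<lambda>\<omega>. min_edge_cover_cost {..<n} ?E (\<lambda>e. cost e \<omega>))"
    by (intro Bochner_Integration.integral_cong refl min_edge_cover_cost_cong) simp
  finally show ?thesis ..
qed

theorem theorem1:
  fixes M :: "nat \<Rightarrow> 'a measure"
    and cost :: "nat \<Rightarrow> nat set \<Rightarrow> 'a \<Rightarrow> real"
    and C :: "nat \<Rightarrow> 'a \<Rightarrow> real"
  assumes "\<And>n. n \<ge> 2 \<Longrightarrow> prob_space (M n)"
    and "\<And>n. n \<ge> 2 \<Longrightarrow>
           prob_space.indep_vars (M n) (\<lambda>_. borel) (cost n) (complete_edges n)"
    and "\<And>n e. n \<ge> 2 \<Longrightarrow> e \<in> complete_edges n \<Longrightarrow>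
           distributed (M n) lborel (cost n e) (exponential_density 1)"
    and "\<And>n \<omega>. n \<ge> 2 \<Longrightarrow> \<omega> \<in> space (M n) \<Longrightarrow>
           C n \<omega> = min_edge_cover_cost (complete_vertices n) (complete_edges n)
                      (\<lambda>e. cost n e \<omega>)"
  shows "(\<lambda>n. prob_space.expectation (M n) (C n))
           \<longlonglongrightarrow> lambert_W 1 + (lambert_W 1)\<^sup>2 / 2"
proof (rule Lim_transform_eventually[OF mean_cost_tendsto])
  show "\<forall>\<^sub>F n in sequentially. mean_cost n = prob_space.expectation (M n) (C n)"
    using eventually_ge_at_top[of 2]
  proof eventually_elim
    case (elim n)
    have "prob_space.expectation (M n) (C n) =
        prob_space.expectation (M n) (\<lambda>\<omega>. min_edge_cover_cost {..<n} (complete_edges n) (\<lambda>e. cost n e \<omega>))"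
      using assms(4)[OF elim] by (intro Bochner_Integration.integral_cong) (auto simp: complete_vertices_def)
    also have "\<dots> = mean_cost n"
      using assms(2,3)[OF elim]
      by (rule prob_space.expectation_min_edge_cover_cost[OF assms(1)[OF elim] elim])
    finally show ?case ..
  qed
qed

end
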